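(* Let $n$ be a positive integer and let $f:(0,\infty)\to\mathbb{R}$ be a non-negative non-increasing function. Assume that at least one of the following two conditions is satisfied: (i) $n\ge 3$ and the function $r\mapsto f(r)\min\{1,r\}$ is integrable on $(0,\infty)$; (ii) $n\ge 9$ and the function $r\mapsto r f(r)$ is locally integrable on $[0,\infty)$ (that is, integrable on $(0,R)$ for every $R>0$). Then the function $x\mapsto |x|^{-n+2} f(|x|)$, defined for $x\in\mathbb{R}^n\setminus\{0\}$, is a positive-definite distribution on $\mathbb{R}^n$.
   Context: $|x|$ is the Euclidean norm and $(\cdot,\cdot)$ the inner product on $\mathbb{R}^n$. $\mathcal{S}$ is the Schwartz space on $\mathbb{R}^n$, and distributions are elements of its dual $\mathcal{S}'$ (tempered distributions). A locally integrable function $g$ defined almost everywhere on $\mathbb{R}^n$ is identified with the distribution $\langle g,\varphi\rangle=\int_{\mathbb{R}^n} g(x)\varphi(x)\,dx$. The Fourier transform of $\varphi\in\mathcal{S}$ is $\hat\varphi(\xi)=\int_{\mathbb{R}^n}\varphi(x)e^{-i(x,\xi)}\,dx$, and for a distribution $g$ it is defined by $\langle\hat g,\varphi\rangle=\langle g,\hat\varphi\rangle$. A distribution $g$ is positive-definite if it is the Fourier transform of a non-negative tempered measure $\mu$ on $\mathbb{R}^n$ (tempered: $\int_{\mathbb{R}^n}(1+|x|)^{-\beta}\,d\mu(x)<\infty$ for some $\beta>0$); for the even functions considered here this is equivalent to $\langle g,\hat\varphi\rangle\ge 0$ for every non-negative $\varphi\in\mathcal{S}$. *)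

theory Defs
  imports "HOL-Analysis.Analysis"
begin

definition partial_deriv :: "'a::euclidean_space \<Rightarrow> ('a \<Rightarrow> complex) \<Rightarrow> 'a \<Rightarrow> complex" where
  "partial_deriv b \<phi> x = frechet_derivative \<phi> (at x) b"

text \<open>A multi-index is encoded as a list of basis vectors.\<close>

definition iter_partial :: "'a::euclidean_space list \<Rightarrow> ('a \<Rightarrow> complex) \<Rightarrow> 'a \<Rightarrow> complex" where
  "iter_partial bs \<phi> = foldr partial_deriv bs \<phi>"

text \<open>Differentiability is demanded of every iterated partial derivative (including
  \<open>\<phi>\<close> itself), so the elements are smooth and no \<^const>\<open>frechet_derivative\<close> is a junk value.\<close>

definition schwartz_space :: "('a::euclidean_space \<Rightarrow> complex) set" where
  "schwartz_space = {\<phi>. \<forall>bs \<in> lists Basis.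
     (\<forall>x. iter_partial bs \<phi> differentiable (at x)) \<and>
     (\<forall>k::nat. bdd_above (range (\<lambda>x. norm x ^ k * norm (iter_partial bs \<phi> x))))}"

definition schwartz_seminorm ::
    "nat \<Rightarrow> 'a::euclidean_space list \<Rightarrow> ('a \<Rightarrow> complex) \<Rightarrow> real" where
  "schwartz_seminorm k bs \<phi> = (SUP x. norm x ^ k * norm (iter_partial bs \<phi> x))"

text \<open>A functional is a total function on \<open>'a \<Rightarrow> complex\<close>; only its values on the Schwartz space
  matter. The last conjunct is continuity for the locally convex topology given by the seminorms.\<close>

definition tempered_distribution ::
    "(('a::euclidean_space \<Rightarrow> complex) \<Rightarrow> complex) \<Rightarrow> bool" where
  "tempered_distribution T \<longleftrightarrow>
     (\<forall>\<phi>\<in>schwartz_space. \<forall>\<psi>\<in>schwartz_space. \<forall>a b.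
        T (\<lambda>x. a * \<phi> x + b * \<psi> x) = a * T \<phi> + b * T \<psi>) \<and>
     (\<exists>C F. finite F \<and> F \<subseteq> UNIV \<times> lists Basis \<and>
        (\<forall>\<phi>\<in>schwartz_space.
           norm (T \<phi>) \<le> C * (\<Sum>(k, bs)\<in>F. schwartz_seminorm k bs \<phi>)))"

definition locally_integrable :: "('a::euclidean_space \<Rightarrow> complex) \<Rightarrow> bool" where
  "locally_integrable g \<longleftrightarrow> (\<forall>K. compact K \<longrightarrow> g absolutely_integrable_on K)"

definition distribution_of ::
    "('a::euclidean_space \<Rightarrow> complex) \<Rightarrow> ('a \<Rightarrow> complex) \<Rightarrow> complex" where
  "distribution_of g \<phi> = (LINT x|lebesgue. g x * \<phi> x)"

text \<open>The Bochner integral of a non-integrable function is \<open>0\<close>, so convergence of the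
  integrals defining \<^const>\<open>distribution_of\<close> has to be required explicitly.\<close>

definition defines_distribution :: "('a::euclidean_space \<Rightarrow> complex) \<Rightarrow> bool" where
  "defines_distribution g \<longleftrightarrow>
     locally_integrable g \<and>
     (\<forall>\<phi>\<in>schwartz_space. integrable lebesgue (\<lambda>x. g x * \<phi> x)) \<and>
     tempered_distribution (distribution_of g)"

definition fourier :: "('a::euclidean_space \<Rightarrow> complex) \<Rightarrow> 'a \<Rightarrow> complex" where
  "fourier \<phi> \<xi> = (LINT x|lebesgue. \<phi> x * exp (- \<i> * complex_of_real (x \<bullet> \<xi>)))"

definition fourier_distribution ::
    "(('a::euclidean_space \<Rightarrow> complex) \<Rightarrow> complex) \<Rightarrow> ('a \<Rightarrow> complex) \<Rightarrow> complex" where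
  "fourier_distribution T \<phi> = T (fourier \<phi>)"

definition tempered_measure :: "'a::euclidean_space measure \<Rightarrow> bool" where
  "tempered_measure \<mu> \<longleftrightarrow>
     sets \<mu> = sets borel \<and>
     (\<exists>\<beta>>0. (\<integral>\<^sup>+x. ennreal ((1 + norm x) powr (- \<beta>)) \<partial>\<mu>) < \<infinity>)"

definition distribution_of_measure ::
    "'a::euclidean_space measure \<Rightarrow> ('a \<Rightarrow> complex) \<Rightarrow> complex" where
  "distribution_of_measure \<mu> \<phi> = (LINT x|\<mu>. \<phi> x)"

definition positive_definite ::
    "(('a::euclidean_space \<Rightarrow> complex) \<Rightarrow> complex) \<Rightarrow> bool" where
  "positive_definite T \<longleftrightarrow>
     tempered_distribution T \<and>
     (\<exists>\<mu>. tempered_measure \<mu> \<and>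
        (\<forall>\<phi>\<in>schwartz_space. T \<phi> = fourier_distribution (distribution_of_measure \<mu>) \<phi>))"

end

theory Submission imports Defs "HOL-Probability.Probability" "HOL-Real_Asymp.Real_Asymp" begin

text \<open>Write \<open>n\<close> for the dimension and \<open>h\<^sub>T(x) = \<bar>x\<bar>\<^sup>2\<^sup>-\<^sup>n\<close> for \<open>\<bar>x\<bar> < T\<close>, \<open>h\<^sub>T(x) = 0\<close> otherwise. Let \<open>c\<close> be the limit of
\<open>f\<close> at infinity. Slicing \<open>f - c\<close> horizontally writes it as the integral over \<open>s > 0\<close> of the indicators of
the sets \<open>{r. s < f r - c}\<close>. Each of these is an interval with left end point \<open>0\<close>, because \<open>f\<close> is
non-increasing. Hence \<open>\<bar>x\<bar>\<^sup>2\<^sup>-\<^sup>n f(\<bar>x\<bar>)\<close> is a superposition, with non-negative weights, of the kernels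
\<open>h\<^sub>T\<close> and of the full Newton kernel \<open>\<bar>x\<bar>\<^sup>2\<^sup>-\<^sup>n\<close>, and it suffices to treat these kernels with enough
uniformity in \<open>T\<close> (lemma \<open>layer_cake_pairing\<close>).

The decisive point is an explicit formula (lemma \<open>truncated_kernel_transform\<close>): the Fourier transform
of \<open>h\<^sub>T\<close> is \<open>n (n - 2) \<omega> (1 - j(T \<bar>\<xi>\<bar>)) / \<bar>\<xi>\<bar>\<^sup>2\<close>, where \<open>\<omega>\<close> is the volume of the unit ball and \<open>j\<close> is
the Fourier transform of the uniform probability measure on the unit sphere of a space of dimension
\<open>n - 2\<close>, a normalised Bessel function (for \<open>n = 3\<close> it is the cosine). Since \<open>\<bar>j\<bar> \<le> 1\<close>, the transform is
non-negative and at most a constant times \<open>\<bar>\<xi>\<bar>\<^sup>-\<^sup>2\<close>, uniformly in \<open>T\<close>. The non-negativity makes the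
superposition of the transforms the density of a measure. The uniform bound, which is locally
integrable because \<open>n \<ge> 3\<close>, takes care of the slices with \<open>s \<le> f(1) - c\<close>, which form a set of finite
length; on the remaining slices the transform is at most its value at \<open>0\<close>, the integral of the
kernel, and these add up to at most a multiple of the integral of \<open>r f(r)\<close> over \<open>(0, 1)\<close>, which is
finite under either condition on \<open>f\<close>.

The formula for the transform is obtained by expanding the cosine into its power series. In polar
coordinates the moments of \<open>h\<^sub>T\<close> reduce to the moments of the unit sphere, and the same reduction
applied to a Gaussian, whose moments satisfy a recursion by partial integration, determines those.
The bound on \<open>j\<close> comes from the differential equation of \<open>j\<close>: it has a non-increasing energy that
dominates \<open>j\<^sup>2\<close> and equals \<open>1\<close> at the origin.

The passage from transforms to distributions is Fourier inversion on the Schwartz space, proved by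
Gaussian regularisation; it gives \<open>\<integral> h \<phi> = (2\<pi>)\<^sup>-\<^sup>n \<integral> v F(\<phi>)\<close> for an even integrable function \<open>h\<close> with
transform \<open>v\<close>, where \<open>F(\<phi>)\<close> is the transform of \<open>\<phi>\<close> (lemma \<open>even_kernel_pairing\<close>). The full Newton kernel is not integrable, but it is a
mixture of Gaussians, and the mixture of their transforms is a multiple of \<open>\<bar>\<xi>\<bar>\<^sup>-\<^sup>2\<close>
(lemma \<open>newton_kernel_pairing\<close>).\<close>

section \<open>Changes of variables and polar coordinates\<close>

lemma nn_integral_lborel_affine:
  fixes f :: "'a::euclidean_space \<Rightarrow> ennreal" and c :: real
  assumes [measurable]: "f \<in> borel_measurable borel" and c: "c \<noteq> 0"
  shows "(\<integral>\<^sup>+x. f x \<partial>lborel) = ennreal (\<bar>c\<bar> ^ DIM('a)) * (\<integral>\<^sup>+x. f (t + c *\<^sub>R x) \<partial>lborel)"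
  by (subst lborel_affine[OF c, of t])
     (simp add: nn_integral_density nn_integral_distr nn_integral_cmult ennreal_power)

lemma integrable_lborel_affine:
  fixes f :: "'a::euclidean_space \<Rightarrow> 'b::{banach, second_countable_topology}" and c :: real
  assumes f: "integrable lborel f" and c: "c \<noteq> 0"
  shows "integrable lborel (\<lambda>x. f (t + c *\<^sub>R x))"
proof -
  note [measurable] = borel_measurable_integrable[OF f, simplified]
  have "(\<integral>\<^sup>+x. ennreal (norm (f x)) \<partial>lborel) =
      ennreal (\<bar>c\<bar> ^ DIM('a)) * (\<integral>\<^sup>+x. ennreal (norm (f (t + c *\<^sub>R x))) \<partial>lborel)"
    by (rule nn_integral_lborel_affine[OF _ c]) measurable
  moreover have "(\<integral>\<^sup>+x. ennreal (norm (f x)) \<partial>lborel) < \<infinity>"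
    using f by (simp add: integrable_iff_bounded)
  ultimately have "(\<integral>\<^sup>+x. ennreal (norm (f (t + c *\<^sub>R x))) \<partial>lborel) < \<infinity>"
    using c by (auto simp: ennreal_mult_less_top ennreal_mult_eq_top_iff top.not_eq_extremum)
  then show ?thesis
    by (intro integrableI_bounded) measurable
qed

lemma integral_lborel_affine:
  fixes f :: "'a::euclidean_space \<Rightarrow> 'b::{banach, second_countable_topology}" and c :: real
  assumes f: "integrable lborel f" and c: "c \<noteq> 0"
  shows "(\<integral>x. f x \<partial>lborel) = \<bar>c\<bar> ^ DIM('a) *\<^sub>R (\<integral>x. f (t + c *\<^sub>R x) \<partial>lborel)"
  using f[THEN borel_measurable_integrable] integrable_lborel_affine[OF f c, of t]
  by (subst lborel_affine[OF c, of t]) (simp add: integral_density integral_distr ennreal_power)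

lemma integral_lborel_prod:
  fixes f :: "'a::euclidean_space \<Rightarrow> real \<Rightarrow> 'b::{real_normed_field, banach, second_countable_topology}"
  assumes f: "\<And>b. b \<in> Basis \<Longrightarrow> integrable lborel (f b)"
  shows "integrable lborel (\<lambda>x::'a. \<Prod>b\<in>Basis. f b (x \<bullet> b))"
    and "(\<integral>x. (\<Prod>b\<in>(Basis::'a set). f b (x \<bullet> b)) \<partial>lborel) = (\<Prod>b\<in>Basis. \<integral>t. f b t \<partial>lborel)"
proof -
  interpret product_sigma_finite "\<lambda>_::'a. lborel :: real measure" ..
  have [measurable]: "f b \<in> borel_measurable borel" if "b \<in> Basis" for b
    using f[OF that] by simp
  have T: "(\<lambda>f. \<Sum>b\<in>Basis. f b *\<^sub>R b) \<in> (\<Pi>\<^sub>M b\<in>Basis. lborel) \<rightarrow>\<^sub>M (borel :: 'a measure)"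
    by measurable
  have eq: "(\<Prod>b\<in>Basis. f b ((\<Sum>j\<in>Basis. \<omega> j *\<^sub>R j) \<bullet> b)) = (\<Prod>b\<in>Basis. f b (\<omega> b))" for \<omega>
    by (intro prod.cong) (auto simp: inner_sum_left inner_Basis if_distrib cong: if_cong)
  show "integrable lborel (\<lambda>x::'a. \<Prod>b\<in>Basis. f b (x \<bullet> b))"
    by (subst lborel_eq, subst integrable_distr_eq[OF T])
      (use product_integrable_prod[OF finite_Basis, of f] f in \<open>simp_all add: eq\<close>)
  show "(\<integral>x. (\<Prod>b\<in>(Basis::'a set). f b (x \<bullet> b)) \<partial>lborel) = (\<Prod>b\<in>Basis. \<integral>t. f b t \<partial>lborel)"
    by (subst lborel_eq, subst integral_distr[OF T])
      (use product_integral_prod[OF finite_Basis, of f] f in \<open>simp_all add: eq\<close>)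
qed

text \<open>Polar coordinates without surface measure. By scaling, the measure with density \<open>p\<close> gives the ball of
radius \<open>t\<close> the mass \<open>P t\<^sup>D\<close> with \<open>D = d + n\<close>, so its image under the norm has the same distribution
function as the density \<open>P D r\<^sup>D\<^sup>-\<^sup>1\<close> on the positive half-line, and the two measures agree.\<close>

lemma nn_integral_homogeneous:
  fixes p :: "'a::euclidean_space \<Rightarrow> real" and w :: "real \<Rightarrow> ennreal"
  assumes p[measurable]: "p \<in> borel_measurable borel" and w[measurable]: "w \<in> borel_measurable borel"
    and nonneg: "\<And>x. 0 \<le> p x" and hom: "\<And>r x. 0 < r \<Longrightarrow> p (r *\<^sub>R x) = r ^ d * p x"
    and "0 \<le> P" and P: "(\<integral>\<^sup>+x. ennreal (p x) * indicator (ball 0 1) x \<partial>lborel) = ennreal P"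
  shows "(\<integral>\<^sup>+x. w (norm x) * ennreal (p x) \<partial>lborel) =
         (\<integral>\<^sup>+r. w r * ennreal (P * real (d + DIM('a)) * r ^ (d + DIM('a) - 1)) * indicator {0<..} r \<partial>lborel)"
proof -
  define D where "D = d + DIM('a)"
  have D: "D > 0" by (simp add: D_def)
  \<comment> \<open>The image under the negative norm is taken because its half-lines \<open>{t<..}\<close> have finite mass.\<close>
  define \<mu> where "\<mu> = distr (density lborel (\<lambda>x. ennreal (p x))) borel (\<lambda>x. - norm x)"
  define \<nu> where "\<nu> = density lborel (\<lambda>r::real. ennreal (P * real D * (- r) ^ (D - 1)) * indicator {..<0} r)"
  have \<mu>: "emeasure \<mu> {t<..} = ennreal (if t < 0 then P * (- t) ^ D else 0)" for t :: real
  proof (cases "t < 0")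
    case True
    have "emeasure \<mu> {t<..} = (\<integral>\<^sup>+x. ennreal (p x) * indicator {x. t < - norm x} x \<partial>lborel)"
      by (simp add: \<mu>_def emeasure_distr emeasure_density vimage_def)
    also have "\<dots> = ennreal (\<bar>-t\<bar> ^ DIM('a)) *
       (\<integral>\<^sup>+x. ennreal (p (0 + (-t) *\<^sub>R x)) * indicator {x. t < - norm x} (0 + (-t) *\<^sub>R x) \<partial>lborel)"
      by (rule nn_integral_lborel_affine) (use True in simp_all)
    also have "\<dots> = ennreal ((-t) ^ DIM('a)) *
       (\<integral>\<^sup>+x. ennreal ((-t) ^ d) * (ennreal (p x) * indicator (ball 0 1) x) \<partial>lborel)"
    proof -
      have "ennreal (p (0 + (-t) *\<^sub>R x)) = ennreal ((-t) ^ d) * ennreal (p x)" for x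
        using True hom[of "-t" x] by (simp add: ennreal_mult'[symmetric] del: scaleR_minus_left)
      moreover have "indicator {x. t < - norm x} (0 + (-t) *\<^sub>R x) = (indicator (ball 0 1) x :: ennreal)" for x :: 'a
      proof -
        have "t < - (\<bar>t\<bar> * norm x) \<longleftrightarrow> (-t) * norm x < (-t) * 1"
          using True by simp
        also have "\<dots> \<longleftrightarrow> norm x < 1"
          using True by (intro mult_less_cancel_left_pos) simp
        finally show ?thesis
          by (simp add: indicator_def)
      qed
      ultimately show ?thesis using True by (simp add: mult.assoc)
    qed
    also have "\<dots> = ennreal ((-t) ^ DIM('a)) * (ennreal ((-t) ^ d) * ennreal P)"
      by (subst nn_integral_cmult, use borel_open[OF open_ball] in measurable) (simp only: P)
    also have "\<dots> = ennreal (P * (- t) ^ D)"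
      using True \<open>0 \<le> P\<close> by (simp add: D_def ennreal_mult[symmetric] power_add mult_ac)
    finally show ?thesis using True by simp
  next
    case False
    have "\<not> t < - norm x" for x :: 'a
      using False norm_ge_zero[of x] by linarith
    then have "(\<lambda>x::'a. - norm x) -` {t<..} = {}"
      by auto
    with False show ?thesis
      by (simp add: \<mu>_def emeasure_distr)
  qed
  have \<nu>: "emeasure \<nu> {t<..} = ennreal (if t < 0 then P * (- t) ^ D else 0)" for t :: real
  proof (cases "t < 0")
    case True
    have "emeasure \<nu> {t<..} = (\<integral>\<^sup>+r. ennreal (P * real D * (- r) ^ (D - 1)) * indicator {..<0} r * indicator {t<..} r \<partial>lborel)"
      by (simp add: \<nu>_def emeasure_density)
    also have "\<dots> = (\<integral>\<^sup>+r. ennreal (P * real D * (- r) ^ (D - 1)) * indicator {t..0} r \<partial>lborel)"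
      by (intro nn_integral_cong_AE AE_I[where N="{t, 0}"]) (auto simp: indicator_def emeasure_lborel_countable)
    also have "\<dots> = ennreal ((- P * (- 0) ^ D) - (- P * (- t) ^ D))"
      by (rule nn_integral_FTC_Icc)
         (use True \<open>0 \<le> P\<close> in \<open>auto intro!: derivative_eq_intros\<close>)
    finally show ?thesis using True D by (simp add: power_0_left)
  next
    case False
    have "emeasure \<nu> {t<..} = (\<integral>\<^sup>+r. ennreal (P * real D * (- r) ^ (D - 1)) * indicator {..<0} r * indicator {t<..} r \<partial>lborel)"
      by (simp add: \<nu>_def emeasure_density)
    also have "\<dots> = (\<integral>\<^sup>+r. 0 * indicator {t<..} r \<partial>lborel)"
      using False by (intro nn_integral_cong) (auto simp: indicator_def)
    finally show ?thesis using False by simp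
  qed
  have eq: "\<mu> = \<nu>"
    by (rule measure_eqI_lessThan) (simp_all add: \<mu> \<nu>, simp_all add: \<mu>_def \<nu>_def)
  have "(\<integral>\<^sup>+x. w (norm x) * ennreal (p x) \<partial>lborel) = (\<integral>\<^sup>+y. w (- y) \<partial>\<mu>)"
    by (simp add: \<mu>_def nn_integral_distr nn_integral_density mult.commute)
  also have "\<dots> = (\<integral>\<^sup>+r. ennreal (P * real D * (- r) ^ (D - 1)) * indicator {..<0} r * w (- r) \<partial>lborel)"
    by (simp add: eq \<nu>_def nn_integral_density)
  also have "\<dots> = (\<integral>\<^sup>+r. ennreal (P * real D * r ^ (D - 1)) * indicator {..<0} (- r) * w r \<partial>lborel)"
    using nn_integral_real_affine[of "\<lambda>r. ennreal (P * real D * (- r) ^ (D - 1)) * indicator {..<0} r * w (- r)" "-1" 0]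
    by simp
  also have "\<dots> = (\<integral>\<^sup>+r. w r * ennreal (P * real D * r ^ (D - 1)) * indicator {0<..} r \<partial>lborel)"
    by (intro nn_integral_cong) (auto simp: indicator_def mult_ac)
  finally show ?thesis
    by (simp add: D_def)
qed

lemma nn_integral_radial:
  fixes w :: "real \<Rightarrow> ennreal"
  assumes w[measurable]: "w \<in> borel_measurable borel"
  shows "(\<integral>\<^sup>+x. w (norm (x::'a::euclidean_space)) \<partial>lborel) =
    (\<integral>\<^sup>+r. w r * ennreal (measure lborel (ball (0::'a) 1) * real DIM('a) * r ^ (DIM('a) - 1)) * indicator {0<..} r \<partial>lborel)"
proof -
  have "(\<integral>\<^sup>+x. ennreal 1 * indicator (ball (0::'a) 1) x \<partial>lborel) = emeasure lborel (ball (0::'a) 1)"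
    by simp
  also have "\<dots> = ennreal (measure lborel (ball (0::'a) 1))"
    using emeasure_bounded_finite[OF bounded_ball, of "0::'a" 1]
    by (intro emeasure_eq_ennreal_measure) (auto simp: less_top)
  finally show ?thesis
    using nn_integral_homogeneous[of "\<lambda>_::'a. 1" w 0 "measure lborel (ball (0::'a) 1)"]
    by (simp only: ennreal_1 mult_1_right add_0 power_0 measure_nonneg zero_le_one w borel_measurable_const simp_thms)
qed

section \<open>A normalised Bessel function\<close>

text \<open>The power series of the normalised Bessel function of dimension \<open>a\<close>: for an integer \<open>a \<ge> 1\<close>, the value
of the series at \<open>s\<^sup>2\<close> is the Fourier transform, at frequencies of length \<open>s\<close>, of the uniform
probability measure on the unit sphere of a space of dimension \<open>a\<close>. The squared argument keeps the
series free of vanishing coefficients.\<close>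

definition bessel_coeff :: "real \<Rightarrow> nat \<Rightarrow> real" where
  "bessel_coeff a k = (\<Prod>i<k. - 1 / ((2 * real i + 2) * (2 * real i + a)))"

definition bessel_series :: "real \<Rightarrow> real \<Rightarrow> real" where
  "bessel_series a z = (\<Sum>k. bessel_coeff a k * z ^ k)"

lemma bessel_coeff_0 [simp]: "bessel_coeff a 0 = 1"
  by (simp add: bessel_coeff_def)

lemma bessel_coeff_Suc:
  "bessel_coeff a (Suc k) = - bessel_coeff a k / ((2 * real k + 2) * (2 * real k + a))"
  by (simp add: bessel_coeff_def)

lemma summable_bessel_series:
  assumes "a \<ge> 1"
  shows "summable (\<lambda>k. bessel_coeff a k * z ^ k)"
proof (rule summable_comparison_test)
  have coeff: "\<bar>bessel_coeff a k\<bar> \<le> inverse (fact k)" for k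
  proof (induction k)
    case (Suc k)
    have 1: "1 + real k \<le> (2 * real k + 2) * (2 * real k + a)"
      using assms mult_mono[of "1 + real k" "2 * real k + 2" 1 "2 * real k + a"] by simp
    have "\<bar>bessel_coeff a (Suc k)\<bar> = \<bar>bessel_coeff a k\<bar> / ((2 * real k + 2) * (2 * real k + a))"
      using assms by (simp add: bessel_coeff_Suc abs_mult)
    also have "\<dots> \<le> inverse (fact k) / (1 + real k)"
      using Suc.IH 1 by (intro frac_le) auto
    also have "\<dots> = inverse (fact (Suc k))"
      by (simp add: field_simps)
    finally show ?case .
  qed simp
  show "\<exists>N. \<forall>k\<ge>N. norm (bessel_coeff a k * z ^ k) \<le> inverse (fact k) * \<bar>z\<bar> ^ k"
    using coeff by (auto simp: abs_mult power_abs intro!: mult_right_mono)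
  show "summable (\<lambda>k. inverse (fact k) * \<bar>z\<bar> ^ k)"
    by (rule summable_exp)
qed

text \<open>The series solves \<open>4 z F'' + 2 a F' + F = 0\<close>. The energy \<open>F\<^sup>2 + 4 z F'\<^sup>2\<close> therefore has the derivative
\<open>- 4 (a - 1) F'\<^sup>2 \<le> 0\<close>; it starts at \<open>F(0)\<^sup>2 = 1\<close> and dominates \<open>F\<^sup>2\<close>.\<close>

lemma bessel_series_abs_le_1:
  assumes a: "a \<ge> 1" and z: "z \<ge> 0"
  shows "\<bar>bessel_series a z\<bar> \<le> 1"
proof -
  define c where "c = bessel_coeff a"
  define F F1 F2 where "F = bessel_series a"
    and "F1 = (\<lambda>x::real. \<Sum>k. diffs c k * x ^ k)" and "F2 = (\<lambda>x::real. \<Sum>k. diffs (diffs c) k * x ^ k)"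
  have s0: "summable (\<lambda>k. c k * x ^ k)" for x
    unfolding c_def by (rule summable_bessel_series[OF a])
  have s1: "summable (\<lambda>k. diffs c k * x ^ k)" for x
    by (rule termdiff_converges_all[OF s0])
  have s2: "summable (\<lambda>k. diffs (diffs c) k * x ^ k)" for x
    by (rule termdiff_converges_all[OF s1])
  have F: "F = (\<lambda>x. \<Sum>k. c k * x ^ k)"
    by (simp add: F_def c_def bessel_series_def fun_eq_iff)
  have d0: "(F has_real_derivative F1 x) (at x)" for x
    unfolding F F1_def by (rule termdiffs_strong_converges_everywhere[OF s0])
  have d1: "(F1 has_real_derivative F2 x) (at x)" for x
    unfolding F1_def F2_def by (rule termdiffs_strong_converges_everywhere[OF s1])
  have ode: "4 * x * F2 x + 2 * a * F1 x + F x = 0" for x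
  proof -
    \<comment> \<open>Multiplication by \<open>x\<close> shifts the index of the series of \<open>F''\<close>; the new term of index \<open>0\<close> vanishes.\<close>
    have "(\<lambda>k. diffs (diffs c) k * x ^ k * x) sums (F2 x * x)"
      unfolding F2_def by (intro sums_mult2 summable_sums s2)
    then have "(\<lambda>k. real (Suc k) * diffs c (Suc k) * x ^ Suc k) sums (F2 x * x)"
      by (simp add: diffs_def mult_ac)
    then have "(\<lambda>k. real k * diffs c k * x ^ k) sums (F2 x * x)"
      by (subst (asm) sums_Suc_iff) simp
    moreover have "(\<lambda>k. diffs c k * x ^ k) sums F1 x"
      unfolding F1_def by (intro summable_sums s1)
    moreover have "(\<lambda>k. c k * x ^ k) sums F x"
      unfolding F by (intro summable_sums s0)
    ultimately have "(\<lambda>k. 4 * (real k * diffs c k * x ^ k) + 2 * a * (diffs c k * x ^ k) + c k * x ^ k)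
        sums (4 * (F2 x * x) + 2 * a * F1 x + F x)"
      by (intro sums_add sums_mult)
    moreover have "4 * (real k * diffs c k * x ^ k) + 2 * a * (diffs c k * x ^ k) + c k * x ^ k = 0" for k
    proof -
      have "(2 * real k + 2) * (2 * real k + a) * c (Suc k) + c k = 0"
        unfolding c_def bessel_coeff_Suc using a by (simp add: add_nonneg_eq_0_iff)
      then have "x ^ k * ((2 * real k + 2) * (2 * real k + a) * c (Suc k) + c k) = 0"
        by simp
      then show ?thesis
        by (simp add: diffs_def algebra_simps)
    qed
    ultimately have "(\<lambda>k. 0) sums (4 * (F2 x * x) + 2 * a * F1 x + F x)"
      by simp
    then show ?thesis
      using sums_unique2[OF sums_zero] by (simp add: mult_ac)
  qed
  have "(F 0)\<^sup>2 + 4 * 0 * (F1 0)\<^sup>2 \<ge> (F z)\<^sup>2 + 4 * z * (F1 z)\<^sup>2"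
  proof (rule DERIV_nonpos_imp_nonincreasing[OF z])
    fix x assume "0 \<le> x" "x \<le> z"
    have "((\<lambda>x. (F x)\<^sup>2 + 4 * x * (F1 x)\<^sup>2) has_real_derivative
        (2 * F x * F1 x + 4 * (F1 x)\<^sup>2 + 8 * x * F1 x * F2 x)) (at x)"
      by (auto intro!: derivative_eq_intros d0 d1 simp: power2_eq_square algebra_simps)
    moreover have "2 * F x * F1 x + 4 * (F1 x)\<^sup>2 + 8 * x * F1 x * F2 x \<le> 0"
    proof -
      have "2 * F x * F1 x + 4 * (F1 x)\<^sup>2 + 8 * x * F1 x * F2 x
        = 2 * F1 x * (4 * x * F2 x + 2 * a * F1 x + F x) - 4 * (a - 1) * (F1 x)\<^sup>2"
        by (simp add: power2_eq_square algebra_simps)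
      then show ?thesis
        using a by (simp add: ode)
    qed
    ultimately show "\<exists>y. ((\<lambda>x. (F x)\<^sup>2 + 4 * x * (F1 x)\<^sup>2) has_real_derivative y) (at x) \<and> y \<le> 0"
      by blast
  qed
  moreover have "F 0 = 1"
    unfolding F by (subst powser_zero) (simp add: c_def)
  moreover have "0 \<le> 4 * z * (F1 z)\<^sup>2"
    using z by simp
  ultimately have "(F z)\<^sup>2 \<le> 1"
    by simp
  then show ?thesis
    by (simp add: F_def abs_square_le_1)
qed

section \<open>Integration by parts\<close>

text \<open>For every \<open>x\<close>, the difference \<open>\<psi>(x + b) - \<psi>(x)\<close> is the integral of \<open>\<psi>'(x + t b)\<close> over \<open>t\<close> in \<open>[0, 1]\<close>.
Integrated over \<open>x\<close>, the left side gives \<open>0\<close> and the right side the integral of \<open>\<psi>'\<close>, both by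
translation invariance.\<close>

lemma integral_directional_derivative_eq_0:
  fixes \<psi> \<psi>' :: "'a::euclidean_space \<Rightarrow> 'b::euclidean_space"
  assumes deriv: "\<And>x t. ((\<lambda>t. \<psi> (x + t *\<^sub>R b)) has_vector_derivative \<psi>' (x + t *\<^sub>R b)) (at t)"
    and cont: "continuous_on UNIV \<psi>'"
    and int: "integrable lborel \<psi>" and int': "integrable lborel \<psi>'"
  shows "(\<integral>x. \<psi>' x \<partial>lborel) = 0"
proof -
  have shift: "integrable lborel (\<lambda>x. f (x + v))" "(\<integral>x. f (x + v) \<partial>lborel) = (\<integral>x. f x \<partial>lborel)"
    if "integrable lborel f" for f :: "'a \<Rightarrow> 'b" and v
    using integrable_lborel_affine[OF that, of 1 v] integral_lborel_affine[OF that, of 1 v]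
    by (simp_all add: add.commute)
  have [measurable]: "\<psi>' \<in> borel_measurable borel"
    by (rule borel_measurable_continuous_onI[OF cont])
  define h where "h t x = indicator {0..1} t *\<^sub>R \<psi>' (x + t *\<^sub>R b)" for t :: real and x
  have FTC: "(\<integral>t. h t x \<partial>lborel) = \<psi> (x + b) - \<psi> x" for x
  proof -
    have "(\<integral>t. h t x \<partial>lborel) = \<psi> (x + 1 *\<^sub>R b) - \<psi> (x + 0 *\<^sub>R b)"
      unfolding h_def
    proof (rule integral_FTC_Icc)
      show "continuous_on {0..1} (\<lambda>t. \<psi>' (x + t *\<^sub>R b))"
        by (intro continuous_on_compose2[OF cont] continuous_intros) auto
    qed (auto intro: has_vector_derivative_at_within deriv)
    then show ?thesis by simp
  qed
  have "integrable (lborel \<Otimes>\<^sub>M lborel) (case_prod h)"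
  proof (rule lborel_pair.Fubini_integrable)
    show "case_prod h \<in> borel_measurable (lborel \<Otimes>\<^sub>M lborel)"
      unfolding h_def by measurable
    have "(\<integral>x. norm (h t x) \<partial>lborel) = indicator {0..1} t *\<^sub>R (\<integral>x. norm (\<psi>' x) \<partial>lborel)" for t
      using integral_lborel_affine[OF integrable_norm[OF int'], of 1 "t *\<^sub>R b"]
      by (simp add: h_def add.commute)
    then show "integrable lborel (\<lambda>t. \<integral>x. norm (case_prod h (t, x)) \<partial>lborel)"
      by simp
    show "AE t in lborel. integrable lborel (\<lambda>x. case_prod h (t, x))"
      using shift(1)[OF int'] by (simp add: h_def)
  qed
  from lborel_pair.Fubini_integral[OF this]
  have "(\<integral>x. (\<psi> (x + b) - \<psi> x) \<partial>lborel) = (\<integral>t. (\<integral>x. h t x \<partial>lborel) \<partial>lborel)"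
    by (simp add: FTC)
  also have "\<dots> = (\<integral>t. indicator {0..1::real} t *\<^sub>R (\<integral>x. \<psi>' x \<partial>lborel) \<partial>lborel)"
    using shift(2)[OF int'] by (simp add: h_def)
  also have "\<dots> = (\<integral>x. \<psi>' x \<partial>lborel)"
    by simp
  finally show ?thesis
    using shift[OF int, of b] int by simp
qed

section \<open>Moments of the unit sphere\<close>

text \<open>The values depend on the parity of \<open>m\<close>, but what is needed of them is common to both cases: positivity
and the recursion in steps of two.\<close>

definition half_moment :: "nat \<Rightarrow> real" where
  "half_moment m = (\<integral>r. indicator {0..} r *\<^sub>R (exp (- r\<^sup>2) * r ^ m) \<partial>lborel)"

lemma half_moment:
  shows half_moment_has_integral:
      "has_bochner_integral lborel (\<lambda>r. indicator {0..} r *\<^sub>R (exp (- r\<^sup>2) * r ^ m)) (half_moment m)"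
    and half_moment_pos: "half_moment m > 0"
    and half_moment_Suc_Suc: "half_moment (Suc (Suc m)) = (real m + 1) / 2 * half_moment m"
proof -
  have even: "half_moment (2 * k) = (sqrt pi / 2) * (fact (2 * k) / (2 ^ (2 * k) * fact k))" for k
    unfolding half_moment_def by (rule has_bochner_integral_integral_eq[OF gaussian_moment_even_pos])
  have odd: "half_moment (2 * k + 1) = fact k / 2" for k
    unfolding half_moment_def by (rule has_bochner_integral_integral_eq[OF gaussian_moment_odd_pos])
  consider k where "m = 2 * k" | k where "m = 2 * k + 1"
    by (metis evenE oddE)
  note cases = this
  show "has_bochner_integral lborel (\<lambda>r. indicator {0..} r *\<^sub>R (exp (- r\<^sup>2) * r ^ m)) (half_moment m)"
    by (cases rule: cases)
      (use gaussian_moment_even_pos gaussian_moment_odd_pos in \<open>simp_all only: even odd\<close>)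
  show "half_moment m > 0"
    by (cases rule: cases) (simp_all only: even odd, simp_all)
  show "half_moment (Suc (Suc m)) = (real m + 1) / 2 * half_moment m"
  proof (cases rule: cases)
    case (1 k)
    have "half_moment (Suc (Suc m)) = half_moment (2 * Suc k)"
      using 1 by simp
    also have "\<dots> = (real m + 1) / 2 * half_moment (2 * k)"
    proof -
      have f: "fact (2 * Suc k) = (2 * real k + 2) * (2 * real k + 1) * (fact (2 * k) :: real)"
        "fact (Suc k) = (real k + 1) * (fact k :: real)"
        by (simp_all add: algebra_simps)
      have e: "2 ^ (2 * Suc k) = 4 * (2 ^ (2 * k) :: real)"
        by simp
      have "S / 2 * ((2 * real k + 2) * (2 * real k + 1) * F / (4 * E * ((real k + 1) * G)))
          = (2 * real k + 1) / 2 * (S / 2 * (F / (E * G)))" if "E > 0" "G > 0" for E F G S :: real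
        using that by (simp add: divide_simps)
      from this[of "2 ^ (2 * k)" "fact k" "sqrt pi" "fact (2 * k)"] show ?thesis
        unfolding even f e 1 by simp
    qed
    finally show ?thesis using 1 by simp
  next
    case (2 k)
    have "half_moment (Suc (Suc m)) = half_moment (2 * Suc k + 1)"
      using 2 by simp
    also have "\<dots> = (real m + 1) / 2 * half_moment (2 * k + 1)"
      unfolding odd using 2 by (simp add: field_simps)
    finally show ?thesis using 2 by simp
  qed
qed

lemma nn_integral_half_moment:
  assumes "0 \<le> c"
  shows "(\<integral>\<^sup>+r. ennreal (exp (- r\<^sup>2)) * ennreal (c * r ^ m) * indicator {0<..} r \<partial>lborel) = ennreal (c * half_moment m)"
proof -
  have "(\<integral>\<^sup>+r. ennreal (exp (- r\<^sup>2)) * ennreal (c * r ^ m) * indicator {0<..} r \<partial>lborel) =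
      (\<integral>\<^sup>+r. ennreal (c * (indicator {0..} r *\<^sub>R (exp (- r\<^sup>2) * r ^ m))) \<partial>lborel)"
    using assms
    by (intro nn_integral_cong_AE AE_I[where N="{0}"])
       (auto simp: indicator_def ennreal_mult'[symmetric] mult_ac)
  also have "\<dots> = ennreal (\<integral>r. c * (indicator {0..} r *\<^sub>R (exp (- r\<^sup>2) * r ^ m)) \<partial>lborel)"
  proof (rule nn_integral_eq_integral)
    show "integrable lborel (\<lambda>r. c * (indicator {0..} r *\<^sub>R (exp (- r\<^sup>2) * r ^ m)))"
      using half_moment_has_integral[of m] by (intro integrable_mult_right integrable.intros)
    show "AE r in lborel. 0 \<le> c * (indicator {0..} r *\<^sub>R (exp (- r\<^sup>2) * r ^ m))"
      using assms by (auto simp: indicator_def)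
  qed
  also have "\<dots> = ennreal (c * half_moment m)"
    using has_bochner_integral_integral_eq[OF half_moment_has_integral[of m]] by simp
  finally show ?thesis .
qed

lemma integrable_gaussian_norm_power:
  "integrable lborel (\<lambda>x::'a::euclidean_space. exp (- (norm x)\<^sup>2) * norm x ^ m)"
proof (rule integrableI_bounded)
  let ?V = "measure lborel (ball (0::'a) 1) * real DIM('a)"
  have "(\<integral>\<^sup>+x. ennreal (norm (exp (- (norm (x::'a))\<^sup>2) * norm x ^ m)) \<partial>lborel) =
      (\<integral>\<^sup>+x. ennreal (exp (- (norm (x::'a))\<^sup>2) * norm x ^ m) \<partial>lborel)"
    by simp
  also have "\<dots> = (\<integral>\<^sup>+r. ennreal (exp (- r\<^sup>2) * r ^ m) * ennreal (?V * r ^ (DIM('a) - 1)) * indicator {0<..} r \<partial>lborel)"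
    by (rule nn_integral_radial) measurable
  also have "\<dots> = (\<integral>\<^sup>+r. ennreal (exp (- r\<^sup>2)) * ennreal (?V * r ^ (m + DIM('a) - 1)) * indicator {0<..} r \<partial>lborel)"
  proof (intro nn_integral_cong)
    fix r :: real
    have "r ^ m * r ^ (DIM('a) - 1) = r ^ (m + DIM('a) - 1)"
      by (simp add: power_add[symmetric])
    then have "r > 0 \<Longrightarrow> ennreal (exp (- r\<^sup>2) * r ^ m) * ennreal (?V * r ^ (DIM('a) - 1)) =
        ennreal (exp (- r\<^sup>2)) * ennreal (?V * r ^ (m + DIM('a) - 1))"
      by (simp add: ennreal_mult'[symmetric] mult.assoc mult.left_commute)
    then show "ennreal (exp (- r\<^sup>2) * r ^ m) * ennreal (?V * r ^ (DIM('a) - 1)) * indicator {0<..} r =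
        ennreal (exp (- r\<^sup>2)) * ennreal (?V * r ^ (m + DIM('a) - 1)) * indicator {0<..} r"
      by (simp add: indicator_def)
  qed
  also have "\<dots> < \<infinity>"
    by (subst nn_integral_half_moment) simp_all
  finally show "(\<integral>\<^sup>+x. ennreal (norm (exp (- (norm (x::'a))\<^sup>2) * norm x ^ m)) \<partial>lborel) < \<infinity>" .
qed measurable

lemma integrable_gaussian_inner_power:
  "integrable lborel (\<lambda>x::'a::euclidean_space. exp (- (norm x)\<^sup>2) * (x \<bullet> \<xi>) ^ m)"
proof (rule Bochner_Integration.integrable_bound)
  show "integrable lborel (\<lambda>x::'a. norm \<xi> ^ m * (exp (- (norm x)\<^sup>2) * norm x ^ m))"
    by (intro integrable_mult_right integrable_gaussian_norm_power)
  show "AE x in lborel. norm (exp (- (norm x)\<^sup>2) * (x \<bullet> \<xi>) ^ m)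
      \<le> norm (norm \<xi> ^ m * (exp (- (norm x)\<^sup>2) * norm x ^ m))"
  proof (rule AE_I2)
    fix x :: 'a
    have "\<bar>x \<bullet> \<xi>\<bar> ^ m \<le> (norm x * norm \<xi>) ^ m"
      by (intro power_mono Cauchy_Schwarz_ineq2) auto
    then show "norm (exp (- (norm x)\<^sup>2) * (x \<bullet> \<xi>) ^ m) \<le> norm (norm \<xi> ^ m * (exp (- (norm x)\<^sup>2) * norm x ^ m))"
      by (simp add: abs_mult power_abs power_mult_distrib mult.commute mult.left_commute)
  qed
qed measurable

text \<open>The integral of \<open>(\<omega> \<bullet> \<xi>)\<^sup>2\<^sup>k\<close> over the unit sphere with respect to surface measure, expressed through
the unit ball by homogeneity.\<close>

definition sphere_moment :: "'a::euclidean_space \<Rightarrow> nat \<Rightarrow> real" where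
  "sphere_moment \<xi> k = real (2 * k + DIM('a)) * (\<integral>x. indicator (ball 0 1) x * (x \<bullet> \<xi>) ^ (2 * k) \<partial>lborel)"

lemma nn_integral_sphere_moment:
  fixes \<xi> :: "'a::euclidean_space"
  assumes w: "w \<in> borel_measurable borel"
  shows "(\<integral>\<^sup>+x. w (norm x) * ennreal ((x \<bullet> \<xi>) ^ (2 * k)) \<partial>lborel) =
    (\<integral>\<^sup>+r. w r * ennreal (sphere_moment \<xi> k * r ^ (2 * k + DIM('a) - 1)) * indicator {0<..} r \<partial>lborel)"
proof -
  let ?P = "\<integral>x. indicator (ball 0 1) x * (x \<bullet> \<xi>) ^ (2 * k) \<partial>lborel"
  have "set_integrable lborel (cball 0 1) (\<lambda>x::'a. (x \<bullet> \<xi>) ^ (2 * k))"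
    unfolding set_integrable_def by (intro borel_integrable_compact continuous_intros) simp
  then have "set_integrable lborel (ball 0 1) (\<lambda>x::'a. (x \<bullet> \<xi>) ^ (2 * k))"
    by (rule set_integrable_subset) auto
  then have int: "integrable lborel (\<lambda>x::'a. indicator (ball 0 1) x * (x \<bullet> \<xi>) ^ (2 * k))"
    by (simp add: set_integrable_def)
  have nonneg: "0 \<le> indicator (ball 0 1) x * (x \<bullet> \<xi>) ^ (2 * k)" for x :: 'a
    by (simp add: power_mult)
  have "(\<integral>\<^sup>+x. ennreal ((x \<bullet> \<xi>) ^ (2 * k)) * indicator (ball 0 1) x \<partial>lborel) =
      (\<integral>\<^sup>+x. ennreal (indicator (ball 0 1) x * (x \<bullet> \<xi>) ^ (2 * k)) \<partial>lborel)"
    by (intro nn_integral_cong) (auto simp: indicator_def)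
  also have "\<dots> = ennreal ?P"
    using int nonneg by (intro nn_integral_eq_integral) auto
  finally have P: "(\<integral>\<^sup>+x. ennreal ((x \<bullet> \<xi>) ^ (2 * k)) * indicator (ball 0 1) x \<partial>lborel) = ennreal ?P" .
  have "(\<integral>\<^sup>+x. w (norm x) * ennreal ((x \<bullet> \<xi>) ^ (2 * k)) \<partial>lborel) =
    (\<integral>\<^sup>+r. w r * ennreal (?P * real (2 * k + DIM('a)) * r ^ (2 * k + DIM('a) - 1)) * indicator {0<..} r \<partial>lborel)"
  proof (rule nn_integral_homogeneous[OF _ w _ _ _ P])
    show "0 \<le> ?P"
      using nonneg by (rule integral_nonneg_AE[OF AE_I2])
  qed (auto simp: power_mult power_mult_distrib)
  then show ?thesis
    by (simp add: sphere_moment_def mult_ac)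
qed

lemma sphere_moment_nonneg: "0 \<le> sphere_moment \<xi> k"
  unfolding sphere_moment_def
  by (intro mult_nonneg_nonneg integral_nonneg_AE AE_I2) (auto simp: power_mult)

text \<open>The corresponding Gaussian integral equals the moment of the sphere times a half-line moment. Partial
integration in the direction \<open>\<xi>\<close> relates the Gaussian integrals for \<open>k + 1\<close> and \<open>k\<close>, and the
half-line moments have their own recursion; the quotient of the two recursions is the claim.\<close>

lemma sphere_moment_Suc:
  fixes \<xi> :: "'a::euclidean_space"
  shows "real (2 * k + DIM('a)) * sphere_moment \<xi> (Suc k) = (2 * real k + 1) * (norm \<xi>)\<^sup>2 * sphere_moment \<xi> k"
proof -
  let ?n = "DIM('a)"
  define Q where "Q m = (\<integral>x. exp (- (norm (x::'a))\<^sup>2) * (x \<bullet> \<xi>) ^ m \<partial>lborel)" for m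
  have Q: "Q (2 * k) = sphere_moment \<xi> k * half_moment (2 * k + ?n - 1)" for k
  proof -
    have "ennreal (Q (2 * k)) = (\<integral>\<^sup>+x. ennreal (exp (- (norm x)\<^sup>2) * (x \<bullet> \<xi>) ^ (2 * k)) \<partial>lborel)"
      unfolding Q_def
      by (intro nn_integral_eq_integral[symmetric] integrable_gaussian_inner_power) (simp add: power_mult)
    also have "\<dots> = (\<integral>\<^sup>+x. ennreal (exp (- (norm x)\<^sup>2)) * ennreal ((x \<bullet> \<xi>) ^ (2 * k)) \<partial>lborel)"
      by (simp add: ennreal_mult')
    also have "\<dots> = (\<integral>\<^sup>+r. ennreal (exp (- r\<^sup>2)) * ennreal (sphere_moment \<xi> k * r ^ (2 * k + ?n - 1)) * indicator {0<..} r \<partial>lborel)"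
      by (rule nn_integral_sphere_moment) measurable
    also have "\<dots> = ennreal (sphere_moment \<xi> k * half_moment (2 * k + ?n - 1))"
      by (rule nn_integral_half_moment[OF sphere_moment_nonneg])
    finally have "ennreal (Q (2 * k)) = ennreal (sphere_moment \<xi> k * half_moment (2 * k + ?n - 1))" .
    moreover have "0 \<le> Q (2 * k)"
      unfolding Q_def by (intro integral_nonneg_AE AE_I2) (simp add: power_mult)
    ultimately show ?thesis
      using sphere_moment_nonneg[of \<xi> k] half_moment_pos[of "2 * k + ?n - 1"] by simp
  qed
  \<comment> \<open>The derivative of \<open>exp(- \<bar>x\<bar>\<^sup>2) (x \<bullet> \<xi>)\<^sup>2\<^sup>k\<^sup>+\<^sup>1\<close> in the direction \<open>\<xi>\<close> has integral \<open>0\<close>.\<close>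
  have rec: "2 * Q (2 * k + 2) = (2 * real k + 1) * (norm \<xi>)\<^sup>2 * Q (2 * k)"
  proof -
    let ?\<psi> = "\<lambda>x::'a. exp (- (norm x)\<^sup>2) * (x \<bullet> \<xi>) ^ (2 * k + 1)"
    let ?\<psi>' = "\<lambda>x::'a. (2 * real k + 1) * (norm \<xi>)\<^sup>2 * (exp (- (norm x)\<^sup>2) * (x \<bullet> \<xi>) ^ (2 * k))
        - 2 * (exp (- (norm x)\<^sup>2) * (x \<bullet> \<xi>) ^ (2 * k + 2))"
    have "(\<integral>x. ?\<psi>' x \<partial>lborel) = 0"
    proof (rule integral_directional_derivative_eq_0[where \<psi>="?\<psi>" and b=\<xi>])
      fix x :: 'a and t :: real
      have "((\<lambda>t. exp (- ((x + t *\<^sub>R \<xi>) \<bullet> (x + t *\<^sub>R \<xi>))) * ((x + t *\<^sub>R \<xi>) \<bullet> \<xi>) ^ (2 * k + 1))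
          has_real_derivative ?\<psi>' (x + t *\<^sub>R \<xi>)) (at t)"
      proof -
        let ?y = "\<lambda>t. (x + t *\<^sub>R \<xi>) \<bullet> \<xi>"
        have y: "(?y has_real_derivative \<xi> \<bullet> \<xi>) (at t)"
          by (auto intro!: derivative_eq_intros simp: inner_simps)
        have E: "((\<lambda>t. exp (- ((x + t *\<^sub>R \<xi>) \<bullet> (x + t *\<^sub>R \<xi>)))) has_real_derivative
            exp (- ((x + t *\<^sub>R \<xi>) \<bullet> (x + t *\<^sub>R \<xi>))) * (- 2 * ?y t)) (at t)"
          by (auto intro!: derivative_eq_intros simp: inner_simps algebra_simps inner_commute)
        show ?thesis
          using DERIV_mult[OF E DERIV_power[OF y, of "2 * k + 1"]]
          by (rule DERIV_cong) (simp add: power2_norm_eq_inner algebra_simps)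
      qed
      then show "((\<lambda>t. ?\<psi> (x + t *\<^sub>R \<xi>)) has_vector_derivative ?\<psi>' (x + t *\<^sub>R \<xi>)) (at t)"
        by (simp add: has_real_derivative_iff_has_vector_derivative power2_norm_eq_inner)
    qed (intro continuous_intros integrable_gaussian_inner_power Bochner_Integration.integrable_diff
          integrable_mult_right)+
    moreover have "(\<integral>x. ?\<psi>' x \<partial>lborel) = (2 * real k + 1) * (norm \<xi>)\<^sup>2 * Q (2 * k) - 2 * Q (2 * k + 2)"
      unfolding Q_def
      by (subst Bochner_Integration.integral_diff)
         (intro integrable_gaussian_inner_power integrable_mult_right | simp)+
    ultimately show ?thesis
      by simp
  qed
  have "half_moment (2 * Suc k + ?n - 1) = real (2 * k + ?n) / 2 * half_moment (2 * k + ?n - 1)"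
  proof -
    obtain d where "?n = Suc d"
      using DIM_positive[where 'a='a] gr0_implies_Suc by blast
    then show ?thesis
      using half_moment_Suc_Suc[of "2 * k + d"] by (simp add: add_ac)
  qed
  then have "2 * Q (2 * k + 2) = real (2 * k + ?n) * sphere_moment \<xi> (Suc k) * half_moment (2 * k + ?n - 1)"
    using Q[of "Suc k"] by simp
  moreover have "2 * Q (2 * k + 2) = (2 * real k + 1) * (norm \<xi>)\<^sup>2 * sphere_moment \<xi> k * half_moment (2 * k + ?n - 1)"
    unfolding rec Q by (simp only: mult.assoc)
  ultimately have "real (2 * k + ?n) * sphere_moment \<xi> (Suc k) * half_moment (2 * k + ?n - 1) =
      (2 * real k + 1) * (norm \<xi>)\<^sup>2 * sphere_moment \<xi> k * half_moment (2 * k + ?n - 1)"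
    by (simp only:)
  then show ?thesis
    using half_moment_pos[of "2 * k + ?n - 1"] by simp
qed

lemma sphere_moment_le:
  fixes \<xi> :: "'a::euclidean_space"
  shows "sphere_moment \<xi> k \<le> sphere_moment \<xi> 0 * norm \<xi> ^ (2 * k)"
proof (induction k)
  case (Suc k)
  have "real (2 * k + DIM('a)) * sphere_moment \<xi> (Suc k) = (2 * real k + 1) * ((norm \<xi>)\<^sup>2 * sphere_moment \<xi> k)"
    using sphere_moment_Suc[of k \<xi>] by (simp add: mult.assoc)
  also have "\<dots> \<le> real (2 * k + DIM('a)) * ((norm \<xi>)\<^sup>2 * sphere_moment \<xi> k)"
    by (intro mult_right_mono mult_nonneg_nonneg sphere_moment_nonneg) (auto simp: Suc_le_eq)
  finally have "sphere_moment \<xi> (Suc k) \<le> (norm \<xi>)\<^sup>2 * sphere_moment \<xi> k"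
    by (rule mult_left_le_imp_le) (simp add: add_nonneg_pos)
  also have "\<dots> \<le> (norm \<xi>)\<^sup>2 * (sphere_moment \<xi> 0 * norm \<xi> ^ (2 * k))"
    using Suc.IH by (intro mult_left_mono) auto
  finally show ?case
    by (simp add: power2_eq_square mult_ac)
qed simp

section \<open>The Fourier transform of the truncated Newton kernel\<close>

definition newton_kernel :: "'a::euclidean_space \<Rightarrow> real" where
  "newton_kernel x = 1 / norm x ^ (DIM('a) - 2)"

lemma newton_kernel_nonneg [simp]: "0 \<le> newton_kernel x"
  by (simp add: newton_kernel_def)

lemma newton_kernel_measurable [measurable]: "newton_kernel \<in> borel_measurable borel"
  unfolding newton_kernel_def[abs_def] by measurable

lemma newton_kernel_uminus [simp]: "newton_kernel (- x) = newton_kernel x"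
  by (simp add: newton_kernel_def)

text \<open>In polar coordinates the kernel leaves the radial factor \<open>r\<^sup>2\<^sup>k\<^sup>+\<^sup>1\<close>, whatever the dimension.\<close>

lemma truncated_kernel_moment:
  fixes \<xi> :: "'a::euclidean_space"
  assumes "T \<ge> 0" and n: "DIM('a) \<ge> 2"
  shows "has_bochner_integral lborel (\<lambda>x. indicator (ball 0 T) x * newton_kernel x * (x \<bullet> \<xi>) ^ (2 * k))
    (sphere_moment \<xi> k * T ^ (2 * k + 2) / real (2 * k + 2))"
proof (rule has_bochner_integral_nn_integral)
  have [measurable]: "ball (0::'a) T \<in> sets borel"
    by simp
  show "(\<lambda>x. indicator (ball 0 T) x * newton_kernel x * (x \<bullet> \<xi>) ^ (2 * k)) \<in> borel_measurable lborel"
    by measurable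
  show "AE x in lborel. 0 \<le> indicator (ball 0 T) x * newton_kernel x * (x \<bullet> \<xi>) ^ (2 * k)"
    by (simp add: power_mult)
  show "0 \<le> sphere_moment \<xi> k * T ^ (2 * k + 2) / real (2 * k + 2)"
    using sphere_moment_nonneg[of \<xi> k] assms by simp
  let ?w = "\<lambda>r::real. ennreal (indicator {..<T} r / r ^ (DIM('a) - 2))"
  have "(\<integral>\<^sup>+x. ennreal (indicator (ball 0 T) x * newton_kernel x * (x \<bullet> \<xi>) ^ (2 * k)) \<partial>lborel) =
      (\<integral>\<^sup>+x. ?w (norm x) * ennreal ((x \<bullet> \<xi>) ^ (2 * k)) \<partial>lborel)"
    by (intro nn_integral_cong)
       (simp add: newton_kernel_def ennreal_mult'[symmetric] indicator_def power_mult)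
  also have "\<dots> = (\<integral>\<^sup>+r. ?w r * ennreal (sphere_moment \<xi> k * r ^ (2 * k + DIM('a) - 1)) * indicator {0<..} r \<partial>lborel)"
    by (rule nn_integral_sphere_moment) measurable
  also have "\<dots> = (\<integral>\<^sup>+r. ennreal (sphere_moment \<xi> k * r ^ (2 * k + 1)) * indicator {0..T} r \<partial>lborel)"
  proof (intro nn_integral_cong_AE AE_I[where N="{0, T}"] subsetI)
    fix r assume "r \<in> {r \<in> space lborel. ?w r * ennreal (sphere_moment \<xi> k * r ^ (2 * k + DIM('a) - 1)) * indicator {0<..} r
      \<noteq> ennreal (sphere_moment \<xi> k * r ^ (2 * k + 1)) * indicator {0..T} r}"
    then have ne: "?w r * ennreal (sphere_moment \<xi> k * r ^ (2 * k + DIM('a) - 1)) * indicator {0<..} r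
      \<noteq> ennreal (sphere_moment \<xi> k * r ^ (2 * k + 1)) * indicator {0..T} r" by simp
    show "r \<in> {0, T}"
    proof (rule ccontr)
      assume r: "r \<notin> {0, T}"
      have "2 * k + DIM('a) - 1 = (DIM('a) - 2) + (2 * k + 1)"
        using n by simp
      then have "r ^ (2 * k + DIM('a) - 1) = r ^ (DIM('a) - 2) * r ^ (2 * k + 1)"
        by (simp only: power_add)
      then have "0 < r \<Longrightarrow> ennreal (1 / r ^ (DIM('a) - 2)) * ennreal (sphere_moment \<xi> k * r ^ (2 * k + DIM('a) - 1)) =
          ennreal (sphere_moment \<xi> k * r ^ (2 * k + 1))"
        by (simp add: ennreal_mult'[symmetric])
      with ne r show False
        by (cases "0 < r"; cases "r < T") (simp_all add: indicator_def)
    qed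
  qed (simp_all add: emeasure_lborel_countable)
  also have "\<dots> = ennreal (sphere_moment \<xi> k * T ^ (2 * k + 2) / real (2 * k + 2)
      - sphere_moment \<xi> k * 0 ^ (2 * k + 2) / real (2 * k + 2))"
  proof (rule nn_integral_FTC_Icc[where F="\<lambda>r. sphere_moment \<xi> k * r ^ (2 * k + 2) / real (2 * k + 2)"])
    fix r :: real assume r: "r \<in> {0..T}"
    show "((\<lambda>r. sphere_moment \<xi> k * r ^ (2 * k + 2) / real (2 * k + 2)) has_real_derivative
        sphere_moment \<xi> k * r ^ (2 * k + 1)) (at r)"
      using DERIV_cdivide[OF DERIV_cmult[OF DERIV_pow[of "2 * k + 2" r]]]
      by (rule DERIV_cong) (simp add: field_simps)
    show "0 \<le> sphere_moment \<xi> k * r ^ (2 * k + 1)"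
      using r sphere_moment_nonneg[of \<xi> k] by simp
  qed (use assms in simp_all)
  finally show "(\<integral>\<^sup>+x. ennreal (indicator (ball 0 T) x * newton_kernel x * (x \<bullet> \<xi>) ^ (2 * k)) \<partial>lborel) =
      ennreal (sphere_moment \<xi> k * T ^ (2 * k + 2) / real (2 * k + 2))"
    by simp
qed

corollary integrable_truncated_kernel:
  assumes "T \<ge> 0" and "DIM('a) \<ge> 2"
  shows "integrable lborel (\<lambda>x::'a::euclidean_space. indicator (ball 0 T) x * newton_kernel x)"
  using integrable.intros[OF truncated_kernel_moment[OF assms, of 0 0]] by simp

lemma summable_power_even_fact:
  "summable (\<lambda>k. (y::real) ^ (2 * k) / fact (2 * k))"
proof -
  have "summable ((\<lambda>k. inverse (fact k) * \<bar>y\<bar> ^ k) \<circ> (\<lambda>k. 2 * k))"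
    by (intro summable_reindex summable_exp) (auto simp: inj_on_def)
  then show ?thesis
    by (simp add: o_def power_even_abs divide_inverse mult.commute)
qed

text \<open>The cosine series may be integrated term by term, because the moments of the sphere grow at most like
\<open>\<bar>\<xi>\<bar>\<^sup>2\<^sup>k\<close>, so that the factorials dominate.\<close>

lemma truncated_kernel_cos_sums:
  fixes \<xi> :: "'a::euclidean_space"
  assumes T: "T \<ge> 0" and n: "DIM('a) \<ge> 2"
  shows "(\<lambda>k. (- 1) ^ k / fact (2 * k) * (sphere_moment \<xi> k * T ^ (2 * k + 2) / real (2 * k + 2)))
    sums (\<integral>x. indicator (ball 0 T) x * newton_kernel x * cos (x \<bullet> \<xi>) \<partial>lborel)"
proof -
  let ?h = "\<lambda>x::'a. indicator (ball 0 T) x * newton_kernel x"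
  let ?M = "\<lambda>k. sphere_moment \<xi> k * T ^ (2 * k + 2) / real (2 * k + 2)"
  let ?f = "\<lambda>k x. (- 1) ^ k / fact (2 * k) * (?h x * (x \<bullet> \<xi>) ^ (2 * k))"
  note mom = truncated_kernel_moment[OF T n, of \<xi>]
  have cos: "(\<lambda>k. ?f k x) sums (?h x * cos (x \<bullet> \<xi>))" for x
    using sums_mult[OF cos_paired[of "x \<bullet> \<xi>"], of "?h x"] by (simp add: mult_ac)
  have "(\<lambda>k. \<integral>x. ?f k x \<partial>lborel) sums (\<integral>x. (\<Sum>k. ?f k x) \<partial>lborel)"
  proof (rule sums_integral)
    show "integrable lborel (?f k)" for k
      by (intro integrable_mult_right integrable.intros[OF mom])
    have norm: "norm (?f k x) = 1 / fact (2 * k) * (?h x * (x \<bullet> \<xi>) ^ (2 * k))" for k x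
      by (simp add: abs_mult power_abs power_mult)
    have "summable (\<lambda>k. ?h x * ((x \<bullet> \<xi>) ^ (2 * k) / fact (2 * k)))" for x
      by (intro summable_mult summable_power_even_fact)
    then show "AE x in lborel. summable (\<lambda>k. norm (?f k x))"
      unfolding norm by (simp add: mult_ac)
    have int: "(\<integral>x. norm (?f k x) \<partial>lborel) = 1 / fact (2 * k) * ?M k" for k
      unfolding norm using has_bochner_integral_integral_eq[OF mom[of k]] by simp
    show "summable (\<lambda>k. \<integral>x. norm (?f k x) \<partial>lborel)"
    proof (rule summable_comparison_test)
      show "summable (\<lambda>k. sphere_moment \<xi> 0 * T\<^sup>2 * ((T * norm \<xi>) ^ (2 * k) / fact (2 * k)))"
        by (intro summable_mult summable_power_even_fact)
      have b1: "1 / fact (2 * k) * ?M k \<le> sphere_moment \<xi> 0 * T\<^sup>2 * ((T * norm \<xi>) ^ (2 * k) / fact (2 * k))" for k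
      proof -
        have "?M k \<le> sphere_moment \<xi> k * T ^ (2 * k + 2) / 1"
          using sphere_moment_nonneg[of \<xi> k] T by (intro divide_left_mono) auto
        also have "\<dots> \<le> (sphere_moment \<xi> 0 * norm \<xi> ^ (2 * k)) * T ^ (2 * k + 2) / 1"
          using sphere_moment_le[of \<xi> k] T by (intro divide_right_mono mult_right_mono) auto
        finally have "1 / fact (2 * k) * ?M k \<le> 1 / fact (2 * k) * ((sphere_moment \<xi> 0 * norm \<xi> ^ (2 * k)) * T ^ (2 * k + 2))"
          by (intro mult_left_mono) simp_all
        also have "\<dots> = sphere_moment \<xi> 0 * T\<^sup>2 * ((T * norm \<xi>) ^ (2 * k) / fact (2 * k))"
          by (simp add: power_mult_distrib power2_eq_square mult_ac)
        finally show ?thesis .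
      qed
      have b2: "0 \<le> 1 / fact (2 * k) * ?M k" for k
        using sphere_moment_nonneg[of \<xi> k] T by simp
      show "\<exists>N. \<forall>k\<ge>N. norm (\<integral>x. norm (?f k x) \<partial>lborel)
          \<le> sphere_moment \<xi> 0 * T\<^sup>2 * ((T * norm \<xi>) ^ (2 * k) / fact (2 * k))"
        unfolding int using b1 b2 by (intro exI[of _ 0] allI impI) (simp only: real_norm_def abs_of_nonneg)
    qed
  qed
  moreover have "(\<integral>x. ?f k x \<partial>lborel) = (- 1) ^ k / fact (2 * k) * ?M k" for k
    using has_bochner_integral_integral_eq[OF mom[of k]] by simp
  ultimately show ?thesis
    using sums_unique[OF cos] by simp
qed

text \<open>Term by term, \<open>\<bar>\<xi>\<bar>\<^sup>2\<close> times the cosine series of the transform is \<open>- K\<close> times the Bessel series without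
its constant term: the recursion of the sphere moments in dimension \<open>n\<close> turns into the recursion of
the Bessel coefficients for the dimension \<open>n - 2\<close>, shifted by one index.\<close>

lemma truncated_kernel_transform:
  fixes \<xi> :: "'a::euclidean_space"
  assumes T: "T \<ge> 0" and n: "DIM('a) \<ge> 3"
  defines "K \<equiv> measure lborel (ball (0::'a) 1) * real DIM('a) * (real DIM('a) - 2)"
  shows "(norm \<xi>)\<^sup>2 * (\<integral>x. indicator (ball 0 T) x * newton_kernel x * cos (x \<bullet> \<xi>) \<partial>lborel) =
    K * (1 - bessel_series (real DIM('a) - 2) ((T * norm \<xi>)\<^sup>2))"
proof -
  let ?a = "real DIM('a) - 2" and ?z = "(T * norm \<xi>)\<^sup>2"
  let ?c = "bessel_coeff ?a"
  let ?t = "\<lambda>k. (- 1) ^ k / fact (2 * k) * (sphere_moment \<xi> k * T ^ (2 * k + 2) / real (2 * k + 2))"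
  have a: "?a \<ge> 1" using n by simp
  have "sphere_moment \<xi> 0 = measure lborel (ball (0::'a) 1) * real DIM('a)"
    by (simp add: sphere_moment_def)
  then have K: "sphere_moment \<xi> 0 * ?a = K"
    by (simp add: K_def)
  have summand: "(norm \<xi>)\<^sup>2 * ?t k = - K * (?c (Suc k) * ?z ^ Suc k)" for k
  proof (induction k)
    case 0
    then show ?case
      using a by (simp add: bessel_coeff_Suc K[symmetric] power_mult_distrib power2_eq_square field_simps)
  next
    case (Suc k)
    have "(real (2 * k + DIM('a)) * (2 * real k + 4)) * ((norm \<xi>)\<^sup>2 * ?t (Suc k)) = - ?z * ((norm \<xi>)\<^sup>2 * ?t k)"
    proof -
      have f: "fact (2 * Suc k) = (2 * real k + 2) * (2 * real k + 1) * (fact (2 * k) :: real)"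
        by (simp add: algebra_simps)
      have "(real (2 * k + DIM('a)) * (2 * real k + 4)) * ?t (Suc k)
          = - ((- 1) ^ k) * (real (2 * k + DIM('a)) * sphere_moment \<xi> (Suc k)) * (T ^ (2 * k + 2) * T\<^sup>2) / fact (2 * Suc k)"
      proof -
        have "(D * E) * (- e / G * (S * U / E)) = - e * (D * S) * U / G" if "E > 0" for D E e G S U :: real
          using that by simp
        from this[of "2 * real k + 4" "real (2 * k + DIM('a))" "(- 1) ^ k" "fact (2 * Suc k)"
            "sphere_moment \<xi> (Suc k)" "T ^ (2 * k + 2) * T\<^sup>2"]
        show ?thesis
          by (simp add: power_add power2_eq_square add_ac del: fact_Suc)
      qed
      also have "\<dots> = - ((- 1) ^ k) * ((norm \<xi>)\<^sup>2 * sphere_moment \<xi> k) * (T ^ (2 * k + 2) * T\<^sup>2)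
          * ((2 * real k + 1) / fact (2 * Suc k))"
        unfolding sphere_moment_Suc by (simp add: mult_ac del: fact_Suc)
      also have "(2 * real k + 1) / fact (2 * Suc k) = 1 / ((2 * real k + 2) * (fact (2 * k) :: real))"
        unfolding f by (simp add: divide_simps)
      finally have main: "(real (2 * k + DIM('a)) * (2 * real k + 4)) * ?t (Suc k)
          = - ((- 1) ^ k) * ((norm \<xi>)\<^sup>2 * sphere_moment \<xi> k) * (T ^ (2 * k + 2) * T\<^sup>2)
          * (1 / (real (2 * k + 2) * fact (2 * k)))"
        by simp
      have "A * (N * t) = - (Q * N) * (N * (e / F * (S * U / G)))"
        if t: "A * t = - e * (N * S) * (U * Q) * (1 / (G * F))" for A N t Q e F S U G :: real
      proof -
        have "A * (N * t) = N * (A * t)"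
          by (simp add: mult_ac)
        then show ?thesis
          unfolding t by (simp add: mult_ac)
      qed
      from this[OF main] show ?thesis
        by (simp only: power_mult_distrib)
    qed
    also have "\<dots> = K * ?z * (?c (Suc k) * ?z ^ Suc k)"
      unfolding Suc.IH by (simp only: minus_mult_minus mult_minus_left mult_minus_right minus_minus mult_ac)
    also have "\<dots> = (real (2 * k + DIM('a)) * (2 * real k + 4)) * (- K * (?c (Suc (Suc k)) * ?z ^ Suc (Suc k)))"
    proof -
      let ?A = "real (2 * k + DIM('a)) * (2 * real k + 4)"
      have A: "(2 * real (Suc k) + 2) * (2 * real (Suc k) + ?a) = ?A"
        by (simp add: algebra_simps)
      have gen: "x = - (A * (- x / A))" if "A > 0" for x A :: real
        using that by simp
      have "?A > 0"
        using n by (intro mult_pos_pos) auto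
      then have c: "?c (Suc k) = - (?A * ?c (Suc (Suc k)))"
        unfolding bessel_coeff_Suc[of _ "Suc k"] A by (rule gen)
      show ?thesis
        unfolding c power_Suc[of ?z "Suc k"]
        by (simp only: mult_minus_left mult_minus_right minus_minus mult_ac)
    qed
    finally show ?case
      using n by (subst (asm) mult_cancel_left) (auto simp del: power_Suc fact_Suc)
  qed
  have "(\<lambda>k. (norm \<xi>)\<^sup>2 * ?t k) sums
      ((norm \<xi>)\<^sup>2 * (\<integral>x. indicator (ball 0 T) x * newton_kernel x * cos (x \<bullet> \<xi>) \<partial>lborel))"
    using n by (intro sums_mult truncated_kernel_cos_sums T) simp
  moreover have "(\<lambda>k. - K * (?c (Suc k) * ?z ^ Suc k)) sums (- K * (bessel_series ?a ?z - 1))"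
  proof (intro sums_mult)
    have "(\<lambda>k. ?c k * ?z ^ k) sums bessel_series ?a ?z"
      unfolding bessel_series_def by (intro summable_sums summable_bessel_series a)
    then show "(\<lambda>k. ?c (Suc k) * ?z ^ Suc k) sums (bessel_series ?a ?z - 1)"
      by (subst sums_Suc_iff) simp
  qed
  ultimately show ?thesis
    unfolding summand by (auto dest: sums_unique2 simp: algebra_simps)
qed

lemma truncated_kernel_transform_bounds:
  fixes \<xi> :: "'a::euclidean_space"
  assumes T: "T \<ge> 0" and n: "DIM('a) \<ge> 3"
  defines "v \<equiv> (\<integral>x. indicator (ball 0 T) x * newton_kernel x * cos (x \<bullet> \<xi>) \<partial>lborel)"
  shows "0 \<le> v"
    and "v \<le> 2 * (measure lborel (ball (0::'a) 1) * real DIM('a) * (real DIM('a) - 2)) / (norm \<xi>)\<^sup>2 \<or> \<xi> = 0"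
proof -
  define K where "K = measure lborel (ball (0::'a) 1) * real DIM('a) * (real DIM('a) - 2)"
  have K: "K \<ge> 0" using n by (simp add: K_def)
  have F: "\<bar>bessel_series (real DIM('a) - 2) ((T * norm \<xi>)\<^sup>2)\<bar> \<le> 1"
    using n by (intro bessel_series_abs_le_1) auto
  have v: "(norm \<xi>)\<^sup>2 * v = K * (1 - bessel_series (real DIM('a) - 2) ((T * norm \<xi>)\<^sup>2))"
    unfolding v_def K_def by (rule truncated_kernel_transform[OF T n])
  have "K * (1 - bessel_series (real DIM('a) - 2) ((T * norm \<xi>)\<^sup>2)) \<le> K * 2"
    using F K by (intro mult_left_mono) auto
  then show "v \<le> 2 * (measure lborel (ball (0::'a) 1) * real DIM('a) * (real DIM('a) - 2)) / (norm \<xi>)\<^sup>2 \<or> \<xi> = 0"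
    unfolding v[symmetric] K_def[symmetric] by (auto simp: field_simps)
  show "0 \<le> v"
  proof (cases "\<xi> = 0")
    case True
    then show ?thesis
      by (auto simp: v_def intro!: integral_nonneg_AE)
  next
    case False
    have "0 \<le> (norm \<xi>)\<^sup>2 * v"
      unfolding v using F K by (intro mult_nonneg_nonneg) auto
    then show ?thesis
      using False by (simp add: zero_le_mult_iff)
  qed
qed

section \<open>Gaussians and integrable radial weights\<close>

text \<open>The substitution \<open>x = \<surd>(2 a) t\<close> turns the integral into the characteristic function of the standard
normal distribution.\<close>

lemma gaussian_fourier_real:
  fixes y :: real
  assumes a: "a > 0"
  shows "integrable lborel (\<lambda>t. complex_of_real (exp (- a * t\<^sup>2)) * iexp (t * y))"
    and "(\<integral>t. complex_of_real (exp (- a * t\<^sup>2)) * iexp (t * y) \<partial>lborel) =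
      complex_of_real (sqrt (pi / a) * exp (- (y\<^sup>2) / (4 * a)))"
proof -
  define s where "s = sqrt (2 * a)"
  have s: "s > 0" "s\<^sup>2 = 2 * a" using a by (simp_all add: s_def)
  let ?f = "\<lambda>x. std_normal_density x *\<^sub>R iexp (y / s * x)"
  have int: "integrable lborel ?f"
  proof (rule Bochner_Integration.integrable_bound)
    show "integrable lborel std_normal_density"
      using integrable_std_normal_moment[of 0] by simp
  qed (auto simp: norm_mult)
  have val: "(\<integral>x. ?f x \<partial>lborel) = complex_of_real (exp (- ((y / s)\<^sup>2) / 2))"
    using fun_cong[OF char_std_normal_distribution, of "y / s"]
    by (simp add: char_def integral_density)
  have eq: "?f (0 + s * t) = complex_of_real (1 / sqrt (2 * pi)) * (complex_of_real (exp (- a * t\<^sup>2)) * iexp (t * y))" for t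
  proof -
    have "std_normal_density (s * t) = 1 / sqrt (2 * pi) * exp (- a * t\<^sup>2)"
      by (simp add: std_normal_density_def power_mult_distrib s)
    moreover have "y / s * (s * t) = t * y" using s by simp
    ultimately show ?thesis
      by (simp add: scaleR_conv_of_real)
  qed
  have "integrable lborel (\<lambda>t. ?f (0 + s * t))"
    using s by (intro lborel_integrable_real_affine int) simp
  then have "integrable lborel (\<lambda>t. complex_of_real (sqrt (2 * pi)) * ?f (0 + s * t))"
    by (rule integrable_mult_right)
  moreover have eq': "complex_of_real (sqrt (2 * pi)) * ?f (0 + s * t) = complex_of_real (exp (- a * t\<^sup>2)) * iexp (t * y)" for t
    unfolding eq by simp
  ultimately show "integrable lborel (\<lambda>t. complex_of_real (exp (- a * t\<^sup>2)) * iexp (t * y))"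
    by simp
  have "\<bar>s\<bar> *\<^sub>R (\<integral>t. ?f (0 + s * t) \<partial>lborel) = complex_of_real (exp (- ((y / s)\<^sup>2) / 2))"
    using s by (intro trans[OF lborel_integral_real_affine[symmetric] val]) simp
  then have "complex_of_real s * (\<integral>t. ?f (0 + s * t) \<partial>lborel) = complex_of_real (exp (- ((y / s)\<^sup>2) / 2))"
    using s by (simp only: scaleR_conv_of_real abs_of_pos)
  then have "(\<integral>t. ?f (0 + s * t) \<partial>lborel) = complex_of_real (exp (- ((y / s)\<^sup>2) / 2)) / complex_of_real s"
    using s by (simp add: field_simps)
  then have "(\<integral>t. complex_of_real (sqrt (2 * pi)) * ?f (0 + s * t) \<partial>lborel) =
      complex_of_real (sqrt (2 * pi) * (exp (- ((y / s)\<^sup>2) / 2) / s))"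
    by (simp only: integral_mult_right_zero of_real_mult of_real_divide)
  moreover have "sqrt (2 * pi) * (exp (- ((y / s)\<^sup>2) / 2) / s) = sqrt (pi / a) * exp (- (y\<^sup>2) / (4 * a))"
  proof -
    have "sqrt (2 * pi) / s = sqrt (pi / a)"
      unfolding s_def by (simp add: real_sqrt_divide[symmetric])
    moreover have "(y / s)\<^sup>2 / 2 = y\<^sup>2 / (4 * a)"
      by (simp add: power_divide s)
    moreover have "sqrt (2 * pi) * (exp (- ((y / s)\<^sup>2) / 2) / s) = sqrt (2 * pi) / s * exp (- ((y / s)\<^sup>2 / 2))"
      by simp
    ultimately show ?thesis
      by (simp only: minus_divide_left)
  qed
  ultimately show "(\<integral>t. complex_of_real (exp (- a * t\<^sup>2)) * iexp (t * y) \<partial>lborel) =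
      complex_of_real (sqrt (pi / a) * exp (- (y\<^sup>2) / (4 * a)))"
    unfolding eq' by (simp only:)
qed

lemma power2_norm_eq_sum_Basis: "(norm (x::'a::euclidean_space))\<^sup>2 = (\<Sum>b\<in>Basis. (x \<bullet> b)\<^sup>2)"
  by (subst power2_norm_eq_inner, subst euclidean_inner) (simp add: power2_eq_square)

lemma gaussian_fourier:
  fixes \<xi> :: "'a::euclidean_space"
  assumes a: "a > 0"
  shows "integrable lborel (\<lambda>x. complex_of_real (exp (- a * (norm x)\<^sup>2)) * iexp (x \<bullet> \<xi>))"
    and "(\<integral>x. complex_of_real (exp (- a * (norm x)\<^sup>2)) * iexp (x \<bullet> \<xi>) \<partial>lborel) =
      complex_of_real (sqrt (pi / a) ^ DIM('a) * exp (- ((norm \<xi>)\<^sup>2) / (4 * a)))"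
proof -
  let ?f = "\<lambda>b t. complex_of_real (exp (- a * t\<^sup>2)) * iexp (t * (\<xi> \<bullet> b))"
  have eq: "complex_of_real (exp (- a * (norm x)\<^sup>2)) * iexp (x \<bullet> \<xi>) = (\<Prod>b\<in>Basis. ?f b (x \<bullet> b))" for x :: 'a
  proof -
    have "exp (- a * (norm x)\<^sup>2) = (\<Prod>b\<in>Basis. exp (- a * (x \<bullet> b)\<^sup>2))"
      by (simp add: power2_norm_eq_sum_Basis sum_distrib_left exp_sum[symmetric])
    moreover have "iexp (x \<bullet> \<xi>) = (\<Prod>b\<in>Basis. iexp ((x \<bullet> b) * (\<xi> \<bullet> b)))"
      by (subst euclidean_inner) (simp add: sum_distrib_left exp_sum[symmetric] del: of_real_mult)
    ultimately show ?thesis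
      by (simp add: prod.distrib del: of_real_mult of_real_exp)
  qed
  have int: "b \<in> Basis \<Longrightarrow> integrable lborel (?f b)" for b
    by (rule gaussian_fourier_real(1)[OF a])
  show "integrable lborel (\<lambda>x. complex_of_real (exp (- a * (norm x)\<^sup>2)) * iexp (x \<bullet> \<xi>))"
    unfolding eq using int by (rule integral_lborel_prod(1))
  have "(\<integral>x. complex_of_real (exp (- a * (norm x)\<^sup>2)) * iexp (x \<bullet> \<xi>) \<partial>lborel) = (\<Prod>b\<in>(Basis::'a set). \<integral>t. ?f b t \<partial>lborel)"
    unfolding eq using int by (rule integral_lborel_prod(2))
  also have "\<dots> = (\<Prod>b\<in>(Basis::'a set). complex_of_real (sqrt (pi / a) * exp (- ((\<xi> \<bullet> b)\<^sup>2) / (4 * a))))"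
    by (simp only: gaussian_fourier_real(2)[OF a])
  also have "\<dots> = complex_of_real (\<Prod>b\<in>(Basis::'a set). sqrt (pi / a) * exp (- ((\<xi> \<bullet> b)\<^sup>2) / (4 * a)))"
    by (rule of_real_prod[symmetric])
  also have "(\<Prod>b\<in>(Basis::'a set). sqrt (pi / a) * exp (- ((\<xi> \<bullet> b)\<^sup>2) / (4 * a))) =
      sqrt (pi / a) ^ DIM('a) * exp (- ((norm \<xi>)\<^sup>2) / (4 * a))"
    by (simp add: prod.distrib power2_norm_eq_sum_Basis sum_divide_distrib sum_negf exp_sum[symmetric])
  finally show "(\<integral>x. complex_of_real (exp (- a * (norm x)\<^sup>2)) * iexp (x \<bullet> \<xi>) \<partial>lborel) =
      complex_of_real (sqrt (pi / a) ^ DIM('a) * exp (- ((norm \<xi>)\<^sup>2) / (4 * a)))" .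
qed

lemma integral_gaussian:
  fixes a :: real
  assumes a: "a > 0"
  shows "integrable lborel (\<lambda>x::'a::euclidean_space. exp (- a * (norm x)\<^sup>2))"
    and "(\<integral>x. exp (- a * (norm (x::'a))\<^sup>2) \<partial>lborel) = sqrt (pi / a) ^ DIM('a)"
proof -
  note g = gaussian_fourier[OF a, of "0::'a", simplified]
  show "integrable lborel (\<lambda>x::'a. exp (- a * (norm x)\<^sup>2))"
    using integrable_norm[OF g(1)] by (simp add: norm_mult)
  have "complex_of_real (\<integral>x. exp (- a * (norm (x::'a))\<^sup>2) \<partial>lborel) = complex_of_real (sqrt (pi / a) ^ DIM('a))"
    using g(2) by (subst integral_complex_of_real[symmetric]) simp
  then show "(\<integral>x. exp (- a * (norm (x::'a))\<^sup>2) \<partial>lborel) = sqrt (pi / a) ^ DIM('a)"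
    by (simp only: of_real_eq_iff)
qed

lemma integrable_radial:
  fixes W :: "real \<Rightarrow> real"
  assumes [measurable]: "W \<in> borel_measurable borel" and W: "\<And>r. r > 0 \<Longrightarrow> 0 \<le> W r"
    and fin: "(\<integral>\<^sup>+r. ennreal (W r * r ^ (DIM('a) - 1)) * indicator {0<..} r \<partial>lborel) < \<infinity>"
  shows "integrable lborel (\<lambda>x::'a::euclidean_space. W (norm x))"
proof (rule integrableI_bounded)
  let ?V = "measure lborel (ball (0::'a) 1) * real DIM('a)"
  have "(\<integral>\<^sup>+x. ennreal (norm (W (norm (x::'a)))) \<partial>lborel) =
      (\<integral>\<^sup>+r. ennreal (norm (W r)) * ennreal (?V * r ^ (DIM('a) - 1)) * indicator {0<..} r \<partial>lborel)"
    by (rule nn_integral_radial) measurable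
  also have "\<dots> = (\<integral>\<^sup>+r. ennreal ?V * (ennreal (W r * r ^ (DIM('a) - 1)) * indicator {0<..} r) \<partial>lborel)"
    using W by (intro nn_integral_cong) (simp add: indicator_def ennreal_mult[symmetric] mult_ac)
  also have "\<dots> = ennreal ?V * (\<integral>\<^sup>+r. ennreal (W r * r ^ (DIM('a) - 1)) * indicator {0<..} r \<partial>lborel)"
    by (rule nn_integral_cmult) measurable
  also have "\<dots> < \<infinity>"
    using fin by (simp add: ennreal_mult_less_top)
  finally show "(\<integral>\<^sup>+x. ennreal (norm (W (norm (x::'a)))) \<partial>lborel) < \<infinity>" .
qed measurable

lemma nn_integral_inverse_square_tail:
  "(\<integral>\<^sup>+r. ennreal (1 / (1 + r)\<^sup>2) * indicator {0..} (r::real) \<partial>lborel) = 1"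
proof -
  have "(\<integral>\<^sup>+r. ennreal (1 / (1 + r)\<^sup>2) * indicator {0..} (r::real) \<partial>lborel) = ennreal (0 - (- 1 / (1 + 0)))"
  proof (rule nn_integral_FTC_atLeast)
    show "((\<lambda>r::real. - 1 / (1 + r)) has_real_derivative 1 / (1 + r)\<^sup>2) (at r)" if "0 \<le> r" for r
      using that by (auto intro!: derivative_eq_intros simp: power2_eq_square)
    show "((\<lambda>r::real. - 1 / (1 + r)) \<longlongrightarrow> 0) at_top"
      by real_asymp
  qed auto
  then show ?thesis by simp
qed

lemma integrable_inverse_power:
  "integrable lborel (\<lambda>x::'a::euclidean_space. 1 / (1 + norm x) ^ (DIM('a) + 1))"
proof (rule integrable_radial)
  show "(\<integral>\<^sup>+r. ennreal (1 / (1 + r) ^ (DIM('a) + 1) * r ^ (DIM('a) - 1)) * indicator {0<..} r \<partial>lborel) < \<infinity>"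
  proof (rule le_less_trans[OF nn_integral_mono])
    fix r :: real
    have "1 / (1 + r) ^ (DIM('a) + 1) * r ^ (DIM('a) - 1) \<le> 1 / (1 + r)\<^sup>2" if "r > 0"
    proof -
      have "(1 + r) ^ (DIM('a) + 1) = (1 + r) ^ (DIM('a) - 1) * (1 + r)\<^sup>2"
        by (simp add: power_add[symmetric])
      moreover have "r ^ (DIM('a) - 1) \<le> (1 + r) ^ (DIM('a) - 1)"
        using that by (intro power_mono) auto
      ultimately show ?thesis
        using that by (simp add: divide_simps)
    qed
    then show "ennreal (1 / (1 + r) ^ (DIM('a) + 1) * r ^ (DIM('a) - 1)) * indicator {0<..} r
        \<le> ennreal (1 / (1 + r)\<^sup>2) * indicator {0..} r"
      by (auto simp: indicator_def intro!: ennreal_leI)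
  qed (simp add: nn_integral_inverse_square_tail)
qed auto

lemma integrable_inverse_square_inverse_power:
  assumes n: "DIM('a) \<ge> 3"
  shows "integrable lborel (\<lambda>x::'a::euclidean_space. 1 / (norm x)\<^sup>2 * (1 / (1 + norm x) ^ (DIM('a) + 1)))"
proof (rule integrable_radial)
  show "(\<integral>\<^sup>+r. ennreal (1 / r\<^sup>2 * (1 / (1 + r) ^ (DIM('a) + 1)) * r ^ (DIM('a) - 1)) * indicator {0<..} r \<partial>lborel) < \<infinity>"
  proof (rule le_less_trans[OF nn_integral_mono])
    fix r :: real
    have "1 / r\<^sup>2 * (1 / (1 + r) ^ (DIM('a) + 1)) * r ^ (DIM('a) - 1) \<le> 1 / (1 + r)\<^sup>2" if "r > 0"
    proof -
      have "(1 + r) ^ (DIM('a) + 1) = (1 + r) ^ (DIM('a) - 1) * (1 + r)\<^sup>2"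
        by (simp add: power_add[symmetric])
      moreover have "DIM('a) - 1 = 2 + (DIM('a) - 3)"
        using n by simp
      then have "r ^ (DIM('a) - 1) = r\<^sup>2 * r ^ (DIM('a) - 3)"
        by (simp only: power_add)
      moreover have "r ^ (DIM('a) - 3) \<le> (1 + r) ^ (DIM('a) - 1)"
        using that order.trans[OF power_mono[of r "1 + r" "DIM('a) - 3"] power_increasing[of "DIM('a) - 3" "DIM('a) - 1" "1 + r"]]
        by auto
      ultimately show ?thesis
        using that by (simp add: divide_simps)
    qed
    then show "ennreal (1 / r\<^sup>2 * (1 / (1 + r) ^ (DIM('a) + 1)) * r ^ (DIM('a) - 1)) * indicator {0<..} r
        \<le> ennreal (1 / (1 + r)\<^sup>2) * indicator {0..} r"
      by (auto simp: indicator_def intro!: ennreal_leI)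
  qed (simp add: nn_integral_inverse_square_tail)
qed auto

section \<open>Schwartz functions and the decay of their Fourier transforms\<close>

lemma schwartz_iter_partial:
  assumes "\<phi> \<in> schwartz_space" "bs \<in> lists Basis"
  shows "iter_partial bs \<phi> \<in> schwartz_space"
proof -
  have "iter_partial cs (iter_partial bs \<phi>) = iter_partial (cs @ bs) \<phi>" for cs
    by (simp add: iter_partial_def)
  then show ?thesis
    using assms by (auto simp: schwartz_space_def)
qed

lemma schwartz_differentiable:
  assumes "\<phi> \<in> schwartz_space"
  shows "\<phi> differentiable (at x)"
proof -
  have "\<forall>bs\<in>lists Basis. \<forall>x. iter_partial bs \<phi> differentiable (at x)"
    using assms by (simp add: schwartz_space_def)
  from bspec[OF this, of "[]"] show ?thesis
    by (simp add: iter_partial_def)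
qed

lemma schwartz_continuous:
  assumes "\<phi> \<in> schwartz_space"
  shows "continuous_on A \<phi>"
  by (meson assms schwartz_differentiable continuous_at_imp_continuous_on differentiable_imp_continuous_within)

lemma schwartz_measurable:
  "\<phi> \<in> schwartz_space \<Longrightarrow> \<phi> \<in> borel_measurable borel"
  by (rule borel_measurable_continuous_onI[OF schwartz_continuous])

lemma schwartz_seminorm_upper:
  assumes "\<phi> \<in> schwartz_space" "bs \<in> lists Basis"
  shows "norm x ^ k * norm (iter_partial bs \<phi> x) \<le> schwartz_seminorm k bs \<phi>"
proof -
  have bdd: "bdd_above (range (\<lambda>x. norm x ^ k * norm (iter_partial bs \<phi> x)))"
    using assms by (auto simp: schwartz_space_def)
  show "norm x ^ k * norm (iter_partial bs \<phi> x) \<le> schwartz_seminorm k bs \<phi>"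
    unfolding schwartz_seminorm_def by (rule cSUP_upper[OF _ bdd]) simp
qed

lemma one_plus_power_le:
  fixes r :: real
  assumes "0 \<le> r"
  shows "(1 + r) ^ N \<le> 2 ^ N * (1 + r ^ N)"
proof -
  have "(1 + r) ^ N \<le> (2 * max 1 r) ^ N"
    using assms by (intro power_mono) auto
  also have "\<dots> = 2 ^ N * max 1 r ^ N"
    by (rule power_mult_distrib)
  also have "max 1 r ^ N \<le> 1 + r ^ N"
    using assms by (cases "r \<le> 1") (auto simp: max_def)
  finally show ?thesis by simp
qed

lemma schwartz_decay:
  assumes "\<phi> \<in> schwartz_space"
  shows "(1 + norm x) ^ N * norm (\<phi> x) \<le> 2 ^ N * (schwartz_seminorm 0 [] \<phi> + schwartz_seminorm N [] \<phi>)"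
proof -
  have "(1 + norm x) ^ N * norm (\<phi> x) \<le> 2 ^ N * (1 + norm x ^ N) * norm (\<phi> x)"
    by (intro mult_right_mono one_plus_power_le) auto
  also have "\<dots> = 2 ^ N * (norm x ^ 0 * norm (\<phi> x) + norm x ^ N * norm (\<phi> x))"
    by (simp add: algebra_simps)
  also have "\<dots> \<le> 2 ^ N * (schwartz_seminorm 0 [] \<phi> + schwartz_seminorm N [] \<phi>)"
    using schwartz_seminorm_upper[OF assms, of "[]" x 0] schwartz_seminorm_upper[OF assms, of "[]" x N]
    by (intro mult_left_mono add_mono) (simp_all add: iter_partial_def)
  finally show ?thesis .
qed

lemma integrable_schwartz:
  fixes \<phi> :: "'a::euclidean_space \<Rightarrow> complex"
  assumes "\<phi> \<in> schwartz_space"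
  shows "integrable lborel \<phi>"
proof (rule Bochner_Integration.integrable_bound)
  define C where "C = 2 ^ (DIM('a) + 1) * (schwartz_seminorm 0 [] \<phi> + schwartz_seminorm (DIM('a) + 1) [] \<phi>)"
  show "integrable lborel (\<lambda>x::'a. C * (1 / (1 + norm x) ^ (DIM('a) + 1)))"
    by (intro integrable_mult_right integrable_inverse_power)
  show "\<phi> \<in> borel_measurable lborel"
    using schwartz_measurable[OF assms] by simp
  have "norm (\<phi> x) \<le> C * (1 / (1 + norm x) ^ (DIM('a) + 1))" for x
    using schwartz_decay[OF assms, of x "DIM('a) + 1"]
    by (simp add: C_def field_simps add_pos_nonneg del: power_Suc)
  then show "AE x in lborel. norm (\<phi> x) \<le> norm (C * (1 / (1 + norm x) ^ (DIM('a) + 1)))"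
    by (intro AE_I2, unfold real_norm_def) (rule order_trans[OF _ abs_ge_self])
qed

lemma fourier_lborel:
  fixes \<phi> :: "'a::euclidean_space \<Rightarrow> complex"
  assumes [measurable]: "\<phi> \<in> borel_measurable borel"
  shows "fourier \<phi> \<xi> = (\<integral>x. \<phi> x * iexp (- (x \<bullet> \<xi>)) \<partial>lborel)"
  unfolding fourier_def by (subst integral_completion) simp_all

lemma fourier_measurable:
  fixes \<phi> :: "'a::euclidean_space \<Rightarrow> complex"
  assumes "\<phi> \<in> schwartz_space"
  shows "fourier \<phi> \<in> borel_measurable borel"
proof -
  note [measurable] = schwartz_measurable[OF assms]
  have "(\<lambda>\<xi>. \<integral>x. \<phi> x * iexp (- (x \<bullet> \<xi>)) \<partial>lborel) \<in> borel_measurable borel"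
    by (rule lborel.borel_measurable_lebesgue_integral) measurable
  moreover have "fourier \<phi> = (\<lambda>\<xi>. \<integral>x. \<phi> x * iexp (- (x \<bullet> \<xi>)) \<partial>lborel)"
    by (intro ext fourier_lborel schwartz_measurable assms)
  ultimately show ?thesis
    by simp
qed

lemma norm_fourier_le:
  assumes "\<phi> \<in> schwartz_space"
  shows "norm (fourier \<phi> \<xi>) \<le> (\<integral>x. norm (\<phi> x) \<partial>lborel)"
  unfolding fourier_lborel[OF schwartz_measurable[OF assms]]
  using integral_norm_bound[of lborel "\<lambda>x. \<phi> x * iexp (- (x \<bullet> \<xi>))"] by (simp add: norm_mult)

lemma fourier_partial_deriv:
  fixes \<phi> :: "'a::euclidean_space \<Rightarrow> complex"
  assumes \<phi>: "\<phi> \<in> schwartz_space" and b: "b \<in> Basis"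
  shows "fourier (partial_deriv b \<phi>) \<xi> = \<i> * complex_of_real (\<xi> \<bullet> b) * fourier \<phi> \<xi>"
proof -
  have \<phi>': "partial_deriv b \<phi> \<in> schwartz_space"
    using schwartz_iter_partial[OF \<phi>, of "[b]"] b by (simp add: iter_partial_def)
  let ?e = "\<lambda>x::'a. iexp (- (x \<bullet> \<xi>))"
  have int: "integrable lborel (\<lambda>x. \<psi> x * ?e x)" if "\<psi> \<in> schwartz_space" for \<psi> :: "'a \<Rightarrow> complex"
    by (rule Bochner_Integration.integrable_bound[OF integrable_schwartz[OF that]])
       (use schwartz_measurable[OF that] in \<open>auto simp: norm_mult\<close>)
  let ?\<psi>' = "\<lambda>x. partial_deriv b \<phi> x * ?e x - \<i> * complex_of_real (\<xi> \<bullet> b) * (\<phi> x * ?e x)"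
  have "(\<integral>x. ?\<psi>' x \<partial>lborel) = 0"
  proof (rule integral_directional_derivative_eq_0[where \<psi>="\<lambda>x. \<phi> x * ?e x" and b=b])
    fix x :: 'a and t :: real
    have "((\<lambda>t. x + t *\<^sub>R b) has_derivative (\<lambda>s. s *\<^sub>R b)) (at t)"
      by (auto intro!: derivative_eq_intros)
    moreover have "(\<phi> has_derivative frechet_derivative \<phi> (at (x + t *\<^sub>R b))) (at (x + t *\<^sub>R b))"
      using schwartz_differentiable[OF \<phi>] by (simp add: frechet_derivative_works)
    ultimately have "((\<lambda>t. \<phi> (x + t *\<^sub>R b)) has_derivative (\<lambda>s. frechet_derivative \<phi> (at (x + t *\<^sub>R b)) (s *\<^sub>R b))) (at t)"
      by (rule has_derivative_compose)
    then have d: "((\<lambda>t. \<phi> (x + t *\<^sub>R b)) has_vector_derivative partial_deriv b \<phi> (x + t *\<^sub>R b)) (at t)"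
      unfolding has_vector_derivative_def partial_deriv_def
      using linear_frechet_derivative[OF schwartz_differentiable[OF \<phi>]] by (simp add: linear_scale)
    have e: "((\<lambda>t. ?e (x + t *\<^sub>R b)) has_vector_derivative
        (- \<i> * complex_of_real (\<xi> \<bullet> b) * ?e (x + t *\<^sub>R b))) (at t)"
    proof -
      have r: "((\<lambda>t. - ((x + t *\<^sub>R b) \<bullet> \<xi>)) has_real_derivative - (\<xi> \<bullet> b)) (at t)"
        by (auto intro!: derivative_eq_intros simp: inner_simps inner_commute)
      have "((\<lambda>t. (- ((x + t *\<^sub>R b) \<bullet> \<xi>)) *\<^sub>R \<i>) has_vector_derivative (- (\<xi> \<bullet> b)) *\<^sub>R \<i>) (at t)"
        using has_vector_derivative_scaleR[OF r has_vector_derivative_const[of \<i>]] by simp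
      from field_vector_diff_chain_at[OF this DERIV_exp] show ?thesis
        by (simp add: o_def scaleR_conv_of_real mult_ac)
    qed
    show "((\<lambda>t. \<phi> (x + t *\<^sub>R b) * ?e (x + t *\<^sub>R b)) has_vector_derivative ?\<psi>' (x + t *\<^sub>R b)) (at t)"
      using has_vector_derivative_mult[OF d e] by (simp add: algebra_simps)
  next
    show "continuous_on UNIV ?\<psi>'"
      by (intro continuous_intros schwartz_continuous \<phi> \<phi>')
    show "integrable lborel (\<lambda>x. \<phi> x * ?e x)"
      by (rule int[OF \<phi>])
    show "integrable lborel ?\<psi>'"
      by (intro Bochner_Integration.integrable_diff integrable_mult_right int \<phi> \<phi>')
  qed
  moreover have "(\<integral>x. ?\<psi>' x \<partial>lborel) = fourier (partial_deriv b \<phi>) \<xi> - \<i> * complex_of_real (\<xi> \<bullet> b) * fourier \<phi> \<xi>"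
    unfolding fourier_lborel[OF schwartz_measurable[OF \<phi>]] fourier_lborel[OF schwartz_measurable[OF \<phi>']]
    by (subst Bochner_Integration.integral_diff) (intro integrable_mult_right int \<phi> \<phi>' | simp)+
  ultimately show ?thesis
    by simp
qed

text \<open>Differentiating \<open>N\<close> times in a coordinate direction multiplies the transform by the \<open>N\<close>-th power of
that coordinate (up to a unit), and the transform of the derivative is bounded. The largest coordinate
of \<open>\<xi>\<close> controls \<open>\<bar>\<xi>\<bar>\<close>.\<close>

lemma fourier_schwartz_decay:
  fixes \<phi> :: "'a::euclidean_space \<Rightarrow> complex"
  assumes \<phi>: "\<phi> \<in> schwartz_space"
  obtains C where "C \<ge> 0" "\<And>\<xi>. norm (fourier \<phi> \<xi>) \<le> C * (1 / (1 + norm \<xi>) ^ N)"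
proof -
  let ?D = "\<lambda>b. iter_partial (replicate N b) \<phi>"
  define A where "A = (\<integral>x. norm (\<phi> x) \<partial>lborel)"
  define B where "B = (\<Sum>b\<in>Basis. \<integral>x. norm (?D b x) \<partial>lborel)"
  have rep: "iter_partial (replicate k b) \<phi> \<in> schwartz_space" if "b \<in> Basis" for b k
    using that by (intro schwartz_iter_partial[OF \<phi>]) (auto simp: in_lists_conv_set)
  have four: "fourier (iter_partial (replicate k b) \<phi>) \<xi> = (\<i> * complex_of_real (\<xi> \<bullet> b)) ^ k * fourier \<phi> \<xi>"
    if b: "b \<in> Basis" for b k \<xi>
  proof (induction k)
    case (Suc k)
    have "iter_partial (replicate (Suc k) b) \<phi> = partial_deriv b (iter_partial (replicate k b) \<phi>)"
      by (simp add: iter_partial_def)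
    then show ?case
      using Suc.IH by (simp add: fourier_partial_deriv[OF rep[OF b] b] mult.assoc)
  qed (simp add: iter_partial_def)
  have A: "norm (fourier \<phi> \<xi>) \<le> A" for \<xi>
    unfolding A_def by (rule norm_fourier_le[OF \<phi>])
  have nn: "0 \<le> A" "0 \<le> B"
    unfolding A_def B_def by (auto intro!: sum_nonneg)
  have coord: "\<bar>\<xi> \<bullet> b\<bar> ^ N * norm (fourier \<phi> \<xi>) \<le> B" if b: "b \<in> Basis" for b \<xi>
  proof -
    have "\<bar>\<xi> \<bullet> b\<bar> ^ N * norm (fourier \<phi> \<xi>) = norm (fourier (?D b) \<xi>)"
      by (simp add: four[OF b] norm_mult norm_power)
    also have "\<dots> \<le> (\<integral>x. norm (?D b x) \<partial>lborel)"
      by (rule norm_fourier_le[OF rep[OF b]])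
    also have "\<dots> \<le> B"
      unfolding B_def by (rule member_le_sum[OF b]) auto
    finally show ?thesis .
  qed
  have pw: "norm \<xi> ^ N * norm (fourier \<phi> \<xi>) \<le> real DIM('a) ^ N * B" for \<xi>
  proof -
    obtain b where b: "b \<in> Basis" "\<And>c. c \<in> Basis \<Longrightarrow> \<bar>\<xi> \<bullet> c\<bar> \<le> \<bar>\<xi> \<bullet> b\<bar>"
    proof -
      have "Max ((\<lambda>c. \<bar>\<xi> \<bullet> c\<bar>) ` Basis) \<in> (\<lambda>c. \<bar>\<xi> \<bullet> c\<bar>) ` Basis"
        by (intro Max_in) auto
      then obtain b where b: "b \<in> Basis" "Max ((\<lambda>c. \<bar>\<xi> \<bullet> c\<bar>) ` Basis) = \<bar>\<xi> \<bullet> b\<bar>"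
        by (rule imageE)
      have "\<bar>\<xi> \<bullet> c\<bar> \<le> \<bar>\<xi> \<bullet> b\<bar>" if "c \<in> Basis" for c
        unfolding b(2)[symmetric] using that by (intro Max_ge) auto
      with b(1) show ?thesis
        by (rule that)
    qed
    have "norm \<xi> \<le> (\<Sum>c\<in>Basis. \<bar>\<xi> \<bullet> c\<bar>)"
      by (rule norm_le_l1)
    also have "\<dots> \<le> real DIM('a) * \<bar>\<xi> \<bullet> b\<bar>"
      using sum_bounded_above[of Basis "\<lambda>c. \<bar>\<xi> \<bullet> c\<bar>" "\<bar>\<xi> \<bullet> b\<bar>"] b by simp
    finally have "norm \<xi> ^ N \<le> real DIM('a) ^ N * \<bar>\<xi> \<bullet> b\<bar> ^ N"
      by (simp add: power_mono flip: power_mult_distrib)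
    then have "norm \<xi> ^ N * norm (fourier \<phi> \<xi>) \<le> real DIM('a) ^ N * \<bar>\<xi> \<bullet> b\<bar> ^ N * norm (fourier \<phi> \<xi>)"
      by (rule mult_right_mono) simp
    also have "\<dots> \<le> real DIM('a) ^ N * B"
      using coord[OF b(1), of \<xi>] by (simp add: mult.assoc mult_left_mono)
    finally show ?thesis .
  qed
  let ?C = "2 ^ N * (A + real DIM('a) ^ N * B)"
  have "norm (fourier \<phi> \<xi>) \<le> ?C * (1 / (1 + norm \<xi>) ^ N)" for \<xi>
  proof -
    have "(1 + norm \<xi>) ^ N * norm (fourier \<phi> \<xi>) \<le> 2 ^ N * (1 + norm \<xi> ^ N) * norm (fourier \<phi> \<xi>)"
      by (intro mult_right_mono one_plus_power_le) auto
    also have "\<dots> = 2 ^ N * (norm (fourier \<phi> \<xi>) + norm \<xi> ^ N * norm (fourier \<phi> \<xi>))"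
      by (simp add: algebra_simps)
    also have "\<dots> \<le> ?C"
      using A pw by (intro mult_left_mono add_mono) auto
    finally show ?thesis
      by (simp add: pos_le_divide_eq add_pos_nonneg mult.commute)
  qed
  moreover have "0 \<le> ?C"
    using nn by simp
  ultimately show ?thesis
    by (intro that[of ?C])
qed

section \<open>Fourier inversion\<close>

lemma integrable_pair_bound:
  fixes F :: "'a::euclidean_space \<times> 'b::euclidean_space \<Rightarrow> complex"
    and f :: "'a \<Rightarrow> real" and g :: "'b \<Rightarrow> real"
  assumes f: "integrable lborel f" and g: "integrable lborel g"
    and F: "F \<in> borel_measurable (lborel \<Otimes>\<^sub>M lborel)"
    and bound: "\<And>x y. norm (F (x, y)) \<le> f x * g y"
  shows "integrable (lborel \<Otimes>\<^sub>M lborel) F"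
proof (rule Bochner_Integration.integrable_bound[OF _ F])
  have [measurable]: "f \<in> borel_measurable borel" "g \<in> borel_measurable borel"
    using f g by auto
  show "integrable (lborel \<Otimes>\<^sub>M lborel) (\<lambda>(x, y). f x * g y)"
  proof (rule lborel_pair.Fubini_integrable)
    show "(\<lambda>(x, y). f x * g y) \<in> borel_measurable (lborel \<Otimes>\<^sub>M lborel)"
      by measurable
    show "integrable lborel (\<lambda>x. \<integral>y. norm (case (x, y) of (x, y) \<Rightarrow> f x * g y) \<partial>lborel)"
      using f by (auto simp: abs_mult)
    show "AE x in lborel. integrable lborel (\<lambda>y. case (x, y) of (x, y) \<Rightarrow> f x * g y)"
      using g by auto
  qed
  show "AE p in lborel \<Otimes>\<^sub>M lborel. norm (F p) \<le> norm (case p of (x, y) \<Rightarrow> f x * g y)"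
  proof (rule AE_I2)
    fix p show "norm (F p) \<le> norm (case p of (x, y) \<Rightarrow> f x * g y)"
      using bound[of "fst p" "snd p"] by (cases p) simp
  qed
qed

lemma integrable_fourier:
  fixes \<phi> :: "'a::euclidean_space \<Rightarrow> complex"
  assumes \<phi>: "\<phi> \<in> schwartz_space"
  shows "integrable lborel (fourier \<phi>)"
proof -
  obtain C where C: "\<And>\<xi>. norm (fourier \<phi> \<xi>) \<le> C * (1 / (1 + norm \<xi>) ^ (DIM('a) + 1))"
    using fourier_schwartz_decay[OF \<phi>] by metis
  show ?thesis
  proof (rule Bochner_Integration.integrable_bound)
    show "integrable lborel (\<lambda>\<xi>::'a. C * (1 / (1 + norm \<xi>) ^ (DIM('a) + 1)))"
      by (intro integrable_mult_right integrable_inverse_power)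
    show "fourier \<phi> \<in> borel_measurable lborel"
      using fourier_measurable[OF \<phi>] by simp
    show "AE \<xi> in lborel. norm (fourier \<phi> \<xi>) \<le> norm (C * (1 / (1 + norm \<xi>) ^ (DIM('a) + 1)))"
      by (intro AE_I2, unfold real_norm_def) (rule order_trans[OF C abs_ge_self])
  qed
qed

text \<open>The Gaussian factor makes the double integral absolutely convergent. Exchanging the integrals produces
the transform of the Gaussian, that is, a Gaussian of width proportional to \<open>\<delta>\<close> centred at \<open>x\<close>; the
substitution \<open>y = x + \<delta> z\<close> rescales it.\<close>

lemma fourier_gaussian_regularized:
  fixes \<phi> :: "'a::euclidean_space \<Rightarrow> complex"
  assumes \<phi>: "\<phi> \<in> schwartz_space" and \<delta>: "\<delta> > 0"
  shows "(\<integral>\<xi>. complex_of_real (exp (- (\<delta>\<^sup>2 / 4) * (norm \<xi>)\<^sup>2)) * (fourier \<phi> \<xi> * iexp (x \<bullet> \<xi>)) \<partial>lborel) =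
    complex_of_real ((2 * sqrt pi) ^ DIM('a)) * (\<integral>z. \<phi> (x + \<delta> *\<^sub>R z) * complex_of_real (exp (- ((norm z)\<^sup>2))) \<partial>lborel)"
proof -
  note [measurable] = schwartz_measurable[OF \<phi>]
  \<comment> \<open>With this parameter the transformed Gaussian is \<open>exp(- \<bar>x - y\<bar>\<^sup>2 / \<delta>\<^sup>2)\<close> up to a factor.\<close>
  define a where "a = \<delta>\<^sup>2 / 4"
  have a: "a > 0" using \<delta> by (simp add: a_def)
  define f where "f \<xi> y = complex_of_real (exp (- a * (norm \<xi>)\<^sup>2)) * (\<phi> y * iexp (- (y \<bullet> \<xi>)) * iexp (x \<bullet> \<xi>))" for \<xi> y :: 'a
  have "integrable (lborel \<Otimes>\<^sub>M lborel) (case_prod f)"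
  proof (rule integrable_pair_bound)
    show "integrable lborel (\<lambda>\<xi>::'a. exp (- a * (norm \<xi>)\<^sup>2))"
      by (rule integral_gaussian(1)[OF a])
    show "integrable lborel (\<lambda>y. norm (\<phi> y))"
      by (rule integrable_norm[OF integrable_schwartz[OF \<phi>]])
    show "case_prod f \<in> borel_measurable (lborel \<Otimes>\<^sub>M lborel)"
      unfolding f_def by measurable
    show "norm (case_prod f (\<xi>, y)) \<le> exp (- a * (norm \<xi>)\<^sup>2) * norm (\<phi> y)" for \<xi> y
      by (simp add: f_def norm_mult)
  qed
  note swap = lborel_pair.Fubini_integral[OF this]
  have inner1: "(\<integral>y. f \<xi> y \<partial>lborel) = complex_of_real (exp (- a * (norm \<xi>)\<^sup>2)) * (fourier \<phi> \<xi> * iexp (x \<bullet> \<xi>))" for \<xi>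
    unfolding f_def fourier_lborel[OF schwartz_measurable[OF \<phi>]]
    by (simp only: integral_mult_right_zero integral_mult_left_zero)
  have inner2: "(\<integral>\<xi>. f \<xi> y \<partial>lborel) =
      \<phi> y * complex_of_real (sqrt (pi / a) ^ DIM('a) * exp (- ((norm (x - y))\<^sup>2) / (4 * a)))" for y
  proof -
    have "f \<xi> y = \<phi> y * (complex_of_real (exp (- a * (norm \<xi>)\<^sup>2)) * iexp (\<xi> \<bullet> (x - y)))" for \<xi>
      by (simp add: f_def exp_add[symmetric] inner_simps algebra_simps inner_commute)
    then show ?thesis
      by (simp only: integral_mult_right_zero gaussian_fourier(2)[OF a])
  qed
  have int: "integrable lborel (\<lambda>y. \<phi> y * complex_of_real (sqrt (pi / a) ^ DIM('a) * exp (- ((norm (x - y))\<^sup>2) / (4 * a))))"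
  proof (rule Bochner_Integration.integrable_bound)
    show "integrable lborel (\<lambda>y. complex_of_real (sqrt (pi / a) ^ DIM('a)) * \<phi> y)"
      by (intro integrable_mult_right integrable_schwartz \<phi>)
    have "exp (- ((norm (x - y))\<^sup>2) / (4 * a)) \<le> 1" for y
      using a by simp
    then show "AE y in lborel. norm (\<phi> y * complex_of_real (sqrt (pi / a) ^ DIM('a) * exp (- ((norm (x - y))\<^sup>2) / (4 * a))))
        \<le> norm (complex_of_real (sqrt (pi / a) ^ DIM('a)) * \<phi> y)"
      using a by (intro AE_I2) (simp add: norm_mult norm_power mult.assoc[symmetric] mult_left_le mult.commute[of _ "norm (\<phi> _)"])
  qed measurable
  have "(\<integral>\<xi>. complex_of_real (exp (- a * (norm \<xi>)\<^sup>2)) * (fourier \<phi> \<xi> * iexp (x \<bullet> \<xi>)) \<partial>lborel) =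
      (\<integral>y. \<phi> y * complex_of_real (sqrt (pi / a) ^ DIM('a) * exp (- ((norm (x - y))\<^sup>2) / (4 * a))) \<partial>lborel)"
    using swap by (simp only: inner1 inner2)
  also have "\<dots> = \<bar>\<delta>\<bar> ^ DIM('a) *\<^sub>R
      (\<integral>z. \<phi> (x + \<delta> *\<^sub>R z) * complex_of_real (sqrt (pi / a) ^ DIM('a) * exp (- ((norm (x - (x + \<delta> *\<^sub>R z)))\<^sup>2) / (4 * a))) \<partial>lborel)"
    using \<delta> by (intro integral_lborel_affine int) simp
  also have "\<dots> = complex_of_real (\<delta> ^ DIM('a) * sqrt (pi / a) ^ DIM('a)) *
      (\<integral>z. \<phi> (x + \<delta> *\<^sub>R z) * complex_of_real (exp (- ((norm z)\<^sup>2))) \<partial>lborel)"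
  proof -
    have "\<phi> (x + \<delta> *\<^sub>R z) * complex_of_real (sqrt (pi / a) ^ DIM('a) * exp (- ((norm (x - (x + \<delta> *\<^sub>R z)))\<^sup>2) / (4 * a))) =
        complex_of_real (sqrt (pi / a) ^ DIM('a)) * (\<phi> (x + \<delta> *\<^sub>R z) * complex_of_real (exp (- ((norm z)\<^sup>2))))" for z
    proof -
      have "(norm (x - (x + \<delta> *\<^sub>R z)))\<^sup>2 / (4 * a) = (norm z)\<^sup>2"
        using \<delta> by (simp add: a_def power_mult_distrib)
      then show ?thesis
        by (simp only: minus_divide_left[symmetric]) simp
    qed
    then show ?thesis
      using \<delta> by (simp only: integral_mult_right_zero scaleR_conv_of_real abs_of_pos of_real_mult mult.assoc)
  qed
  also have "\<delta> ^ DIM('a) * sqrt (pi / a) ^ DIM('a) = (2 * sqrt pi) ^ DIM('a)"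
  proof -
    have "sqrt (pi / a) = 2 * sqrt pi / \<delta>"
      by (rule real_sqrt_unique) (use \<delta> in \<open>simp_all add: a_def power_divide power_mult_distrib\<close>)
    then have "\<delta> * sqrt (pi / a) = 2 * sqrt pi"
      using \<delta> by simp
    then show ?thesis
      by (simp only: power_mult_distrib[symmetric])
  qed
  finally show ?thesis
    by (simp only: a_def)
qed

text \<open>Both sides of the regularised identity converge as \<open>\<delta>\<close> tends to \<open>0\<close>: the left side is dominated by the
integrable transform, and the right side by a multiple of a fixed Gaussian, as \<open>\<phi>\<close> is bounded.\<close>

lemma fourier_inversion:
  fixes \<phi> :: "'a::euclidean_space \<Rightarrow> complex"
  assumes \<phi>: "\<phi> \<in> schwartz_space"
  shows "(\<integral>\<xi>. fourier \<phi> \<xi> * iexp (x \<bullet> \<xi>) \<partial>lborel) = complex_of_real ((2 * pi) ^ DIM('a)) * \<phi> x"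
proof -
  note [measurable] = schwartz_measurable[OF \<phi>] fourier_measurable[OF \<phi>]
  define \<delta> where "\<delta> m = 1 / (real m + 1)" for m :: nat
  have \<delta>: "\<delta> m > 0" for m by (simp add: \<delta>_def)
  have \<delta>0: "\<delta> \<longlonglongrightarrow> 0"
    unfolding \<delta>_def by real_asymp
  let ?L = "\<lambda>m \<xi>. complex_of_real (exp (- ((\<delta> m)\<^sup>2 / 4) * (norm \<xi>)\<^sup>2)) * (fourier \<phi> \<xi> * iexp (x \<bullet> \<xi>))"
  let ?R = "\<lambda>m z. \<phi> (x + \<delta> m *\<^sub>R z) * complex_of_real (exp (- ((norm z)\<^sup>2)))"
  have L: "(\<lambda>m. \<integral>\<xi>. ?L m \<xi> \<partial>lborel) \<longlonglongrightarrow> (\<integral>\<xi>. fourier \<phi> \<xi> * iexp (x \<bullet> \<xi>) \<partial>lborel)"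
  proof (rule integral_dominated_convergence[where w="\<lambda>\<xi>. norm (fourier \<phi> \<xi>)"])
    show "integrable lborel (\<lambda>\<xi>. norm (fourier \<phi> \<xi>))"
      by (rule integrable_norm[OF integrable_fourier[OF \<phi>]])
    show "AE \<xi> in lborel. (\<lambda>m. ?L m \<xi>) \<longlonglongrightarrow> fourier \<phi> \<xi> * iexp (x \<bullet> \<xi>)"
    proof (rule AE_I2)
      fix \<xi>
      have "(\<lambda>m. ?L m \<xi>) \<longlonglongrightarrow> complex_of_real (exp (- ((0::real)\<^sup>2 / 4) * (norm \<xi>)\<^sup>2)) * (fourier \<phi> \<xi> * iexp (x \<bullet> \<xi>))"
        by (intro tendsto_intros \<delta>0) auto
      then show "(\<lambda>m. ?L m \<xi>) \<longlonglongrightarrow> fourier \<phi> \<xi> * iexp (x \<bullet> \<xi>)"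
        by simp
    qed
    show "AE \<xi> in lborel. norm (?L m \<xi>) \<le> norm (fourier \<phi> \<xi>)" for m
      by (intro AE_I2) (auto simp: norm_mult intro!: mult_left_le_one_le)
  qed measurable
  obtain B where B: "\<And>y. norm (\<phi> y) \<le> B"
    using schwartz_decay[OF \<phi>, of _ 0] by auto
  have R: "(\<lambda>m. \<integral>z. ?R m z \<partial>lborel) \<longlonglongrightarrow> (\<integral>z. \<phi> x * complex_of_real (exp (- ((norm (z::'a))\<^sup>2))) \<partial>lborel)"
  proof (rule integral_dominated_convergence[where w="\<lambda>z::'a. B * exp (- 1 * (norm z)\<^sup>2)"])
    show "integrable lborel (\<lambda>z::'a. B * exp (- 1 * (norm z)\<^sup>2))"
      by (intro integrable_mult_right integral_gaussian) simp
    show "AE z in lborel. (\<lambda>m. ?R m z) \<longlonglongrightarrow> \<phi> x * complex_of_real (exp (- ((norm z)\<^sup>2)))"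
    proof (rule AE_I2)
      fix z
      have "isCont \<phi> (x + 0 *\<^sub>R z)"
        using schwartz_continuous[OF \<phi>, of UNIV] by (simp add: continuous_on_eq_continuous_at)
      then have "(\<lambda>m. \<phi> (x + \<delta> m *\<^sub>R z)) \<longlonglongrightarrow> \<phi> (x + 0 *\<^sub>R z)"
        by (rule isCont_tendsto_compose) (intro tendsto_intros \<delta>0)
      then have "(\<lambda>m. \<phi> (x + \<delta> m *\<^sub>R z)) \<longlonglongrightarrow> \<phi> x"
        by simp
      then show "(\<lambda>m. ?R m z) \<longlonglongrightarrow> \<phi> x * complex_of_real (exp (- ((norm z)\<^sup>2)))"
        by (intro tendsto_intros)
    qed
    show "AE z in lborel. norm (?R m z) \<le> B * exp (- 1 * (norm z)\<^sup>2)" for m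
      using B by (intro AE_I2) (auto simp: norm_mult intro!: mult_right_mono)
  qed measurable
  have gauss: "(\<integral>z. complex_of_real (exp (- ((norm (z::'a))\<^sup>2))) \<partial>lborel) = complex_of_real (sqrt pi ^ DIM('a))"
    using integral_gaussian(2)[of 1, where 'a='a] by (subst integral_complex_of_real) simp
  have "(\<lambda>m. \<integral>\<xi>. ?L m \<xi> \<partial>lborel) \<longlonglongrightarrow> complex_of_real ((2 * sqrt pi) ^ DIM('a)) *
      (\<integral>z. \<phi> x * complex_of_real (exp (- ((norm (z::'a))\<^sup>2))) \<partial>lborel)"
    unfolding fourier_gaussian_regularized[OF \<phi> \<delta>] by (intro tendsto_mult tendsto_const R)
  with L have "(\<integral>\<xi>. fourier \<phi> \<xi> * iexp (x \<bullet> \<xi>) \<partial>lborel) = complex_of_real ((2 * sqrt pi) ^ DIM('a)) *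
      (\<integral>z. \<phi> x * complex_of_real (exp (- ((norm (z::'a))\<^sup>2))) \<partial>lborel)"
    by (rule LIMSEQ_unique)
  also have "\<dots> = complex_of_real ((2 * sqrt pi) ^ DIM('a) * sqrt pi ^ DIM('a)) * \<phi> x"
    by (simp only: integral_mult_right_zero gauss) simp
  also have "(2 * sqrt pi) ^ DIM('a) * sqrt pi ^ DIM('a) = (2 * pi) ^ DIM('a)"
    by (simp only: power_mult_distrib[symmetric]) (simp add: mult.assoc)
  finally show ?thesis .
qed

lemma integral_even_kernel_iexp:
  fixes h :: "'a::euclidean_space \<Rightarrow> real"
  assumes h: "integrable lborel h" and even: "\<And>x. h (- x) = h x"
  shows "(\<integral>x. complex_of_real (h x) * iexp (x \<bullet> \<xi>) \<partial>lborel) = complex_of_real (\<integral>x. h x * cos (x \<bullet> \<xi>) \<partial>lborel)"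
proof -
  have [measurable]: "h \<in> borel_measurable borel"
    using h by auto
  have bnd: "integrable lborel (\<lambda>x. h x * u x)" if "u \<in> borel_measurable borel" "\<And>x. \<bar>u x\<bar> \<le> 1" for u :: "'a \<Rightarrow> real"
    by (rule Bochner_Integration.integrable_bound[OF h])
       (use that in \<open>auto simp: abs_mult intro!: mult_right_le_one_le\<close>)
  have c: "integrable lborel (\<lambda>x. h x * cos (x \<bullet> \<xi>))" and s: "integrable lborel (\<lambda>x. h x * sin (x \<bullet> \<xi>))"
    by (auto intro!: bnd)
  have "(\<integral>x. h x * sin (x \<bullet> \<xi>) \<partial>lborel) = - (\<integral>x. h x * sin (x \<bullet> \<xi>) \<partial>lborel)"
    using integral_lborel_affine[OF s, of "-1" 0] by (simp add: even)
  then have s0: "(\<integral>x. h x * sin (x \<bullet> \<xi>) \<partial>lborel) = 0"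
    by simp
  have "(\<integral>x. complex_of_real (h x) * iexp (x \<bullet> \<xi>) \<partial>lborel) =
      (\<integral>x. complex_of_real (h x * cos (x \<bullet> \<xi>)) + \<i> * complex_of_real (h x * sin (x \<bullet> \<xi>)) \<partial>lborel)"
    by (intro Bochner_Integration.integral_cong) (simp_all add: cis_conv_exp[symmetric] complex_eq_iff)
  also have "\<dots> = complex_of_real (\<integral>x. h x * cos (x \<bullet> \<xi>) \<partial>lborel)"
    using c s by (simp add: s0 integral_complex_of_real del: of_real_mult)
  finally show ?thesis .
qed

text \<open>Inserting the inversion formula for \<open>\<phi>\<close> and exchanging the integrals leaves the transform of \<open>h\<close>, which
is real because the odd sine part integrates to \<open>0\<close>.\<close>

lemma even_kernel_pairing:
  fixes h :: "'a::euclidean_space \<Rightarrow> real"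
  assumes h: "integrable lborel h" and even: "\<And>x. h (- x) = h x" and \<phi>: "\<phi> \<in> schwartz_space"
  shows "(\<integral>x. complex_of_real (h x) * \<phi> x \<partial>lborel) =
    (\<integral>\<xi>. complex_of_real ((\<integral>x. h x * cos (x \<bullet> \<xi>) \<partial>lborel) / (2 * pi) ^ DIM('a)) * fourier \<phi> \<xi> \<partial>lborel)"
proof -
  have [measurable]: "h \<in> borel_measurable borel" "fourier \<phi> \<in> borel_measurable borel"
    using h fourier_measurable[OF \<phi>] by auto
  let ?c = "complex_of_real ((2 * pi) ^ DIM('a))"
  let ?f = "\<lambda>x \<xi>. complex_of_real (h x) * (fourier \<phi> \<xi> * iexp (x \<bullet> \<xi>))"
  have int: "integrable (lborel \<Otimes>\<^sub>M lborel) (case_prod ?f)"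
  proof (rule integrable_pair_bound)
    show "integrable lborel (\<lambda>x. \<bar>h x\<bar>)" using h by (rule integrable_abs)
    show "integrable lborel (\<lambda>\<xi>. norm (fourier \<phi> \<xi>))"
      by (rule integrable_norm[OF integrable_fourier[OF \<phi>]])
  qed (measurable, simp add: norm_mult)
  have "?c * (\<integral>x. complex_of_real (h x) * \<phi> x \<partial>lborel) = (\<integral>x. complex_of_real (h x) * (?c * \<phi> x) \<partial>lborel)"
    by (simp only: integral_mult_right_zero[symmetric] mult.left_commute)
  also have "\<dots> = (\<integral>x. (\<integral>\<xi>. ?f x \<xi> \<partial>lborel) \<partial>lborel)"
    by (simp only: integral_mult_right_zero fourier_inversion[OF \<phi>])
  also have "\<dots> = (\<integral>\<xi>. (\<integral>x. ?f x \<xi> \<partial>lborel) \<partial>lborel)"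
    by (rule lborel_pair.Fubini_integral[OF int, symmetric])
  also have "\<dots> = (\<integral>\<xi>. ?c * (complex_of_real ((\<integral>x. h x * cos (x \<bullet> \<xi>) \<partial>lborel) / (2 * pi) ^ DIM('a)) * fourier \<phi> \<xi>) \<partial>lborel)"
  proof (intro Bochner_Integration.integral_cong refl)
    fix \<xi>
    have "(\<integral>x. ?f x \<xi> \<partial>lborel) = (\<integral>x. fourier \<phi> \<xi> * (complex_of_real (h x) * iexp (x \<bullet> \<xi>)) \<partial>lborel)"
      by (simp only: mult_ac)
    also have "\<dots> = fourier \<phi> \<xi> * complex_of_real (\<integral>x. h x * cos (x \<bullet> \<xi>) \<partial>lborel)"
      by (simp only: integral_mult_right_zero integral_even_kernel_iexp[OF h even])
    also have "\<dots> = ?c * (complex_of_real ((\<integral>x. h x * cos (x \<bullet> \<xi>) \<partial>lborel) / (2 * pi) ^ DIM('a)) * fourier \<phi> \<xi>)"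
      by simp
    finally show "(\<integral>x. ?f x \<xi> \<partial>lborel) =
        ?c * (complex_of_real ((\<integral>x. h x * cos (x \<bullet> \<xi>) \<partial>lborel) / (2 * pi) ^ DIM('a)) * fourier \<phi> \<xi>)" .
  qed
  also have "\<dots> = ?c * (\<integral>\<xi>. complex_of_real ((\<integral>x. h x * cos (x \<bullet> \<xi>) \<partial>lborel) / (2 * pi) ^ DIM('a)) * fourier \<phi> \<xi> \<partial>lborel)"
    by (rule integral_mult_right_zero)
  finally show ?thesis
    by (subst (asm) mult_cancel_left) (simp only: of_real_eq_0_iff, simp)
qed

section \<open>The Newton kernel\<close>

text \<open>Fubini's theorem for a kernel \<open>K\<close> that is a superposition of non-negative kernels \<open>k u\<close>. Integrability of
\<open>K \<phi>\<close> alone gives absolute convergence of the double integral, because the \<open>k u\<close> are non-negative.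
The lemma is used on both sides of the Fourier transform: for kernels in \<open>x\<close> and for densities in \<open>\<xi>\<close>.\<close>

lemma integral_mixture:
  fixes k :: "real \<Rightarrow> 'a::euclidean_space \<Rightarrow> real" and \<phi> :: "'a \<Rightarrow> complex"
  assumes k[measurable]: "case_prod k \<in> borel_measurable (lborel \<Otimes>\<^sub>M lborel)"
    and \<phi>[measurable]: "\<phi> \<in> borel_measurable borel"
    and nonneg: "\<And>u x. 0 \<le> k u x" "\<And>x. 0 \<le> K x"
    and K: "AE x in lborel. (\<integral>\<^sup>+u. ennreal (k u x) \<partial>lborel) = ennreal (K x)"
    and int: "integrable lborel (\<lambda>x. complex_of_real (K x) * \<phi> x)"
  shows "(\<integral>x. complex_of_real (K x) * \<phi> x \<partial>lborel) = (\<integral>u. (\<integral>x. complex_of_real (k u x) * \<phi> x \<partial>lborel) \<partial>lborel)"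
proof -
  have [measurable]: "(\<lambda>x. k u x) \<in> borel_measurable borel" "(\<lambda>u. k u x) \<in> borel_measurable borel" for u x
    by measurable
  have K': "AE x in lborel. has_bochner_integral lborel (\<lambda>u. k u x) (K x)"
    using K by eventually_elim (intro has_bochner_integral_nn_integral, auto simp: nonneg)
  let ?F = "\<lambda>x u. complex_of_real (k u x) * \<phi> x"
  have inner: "AE x in lborel. (\<integral>u. ?F x u \<partial>lborel) = complex_of_real (K x) * \<phi> x"
    using K' by eventually_elim
      (auto dest!: has_bochner_integral_integral_eq simp: integral_complex_of_real)
  have norm_inner: "AE x in lborel. (\<integral>u. norm (?F x u) \<partial>lborel) = norm (complex_of_real (K x) * \<phi> x)"
    using K' by eventually_elim
      (auto dest!: has_bochner_integral_integral_eq simp: norm_mult nonneg)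
  have "integrable (lborel \<Otimes>\<^sub>M lborel) (case_prod ?F)"
  proof (rule lborel_pair.Fubini_integrable)
    show "case_prod ?F \<in> borel_measurable (lborel \<Otimes>\<^sub>M lborel)"
      by measurable
    have "integrable lborel (\<lambda>x. \<integral>u. norm (?F x u) \<partial>lborel) \<longleftrightarrow> integrable lborel (\<lambda>x. norm (complex_of_real (K x) * \<phi> x))"
      by (rule integrable_cong_AE[OF _ borel_measurable_integrable[OF integrable_norm[OF int]] norm_inner])
        measurable
    then show "integrable lborel (\<lambda>x. \<integral>u. norm (case (x, u) of (x, u) \<Rightarrow> ?F x u) \<partial>lborel)"
      using integrable_norm[OF int] by simp
    show "AE x in lborel. integrable lborel (\<lambda>u. case (x, u) of (x, u) \<Rightarrow> ?F x u)"
      using K' by eventually_elim (auto simp: has_bochner_integral_iff)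
  qed
  from lborel_pair.Fubini_integral[OF this]
  have "(\<integral>u. (\<integral>x. ?F x u \<partial>lborel) \<partial>lborel) = (\<integral>x. (\<integral>u. ?F x u \<partial>lborel) \<partial>lborel)" .
  also have "\<dots> = (\<integral>x. complex_of_real (K x) * \<phi> x \<partial>lborel)"
    by (rule integral_cong_AE[OF _ borel_measurable_integrable[OF int] inner]) measurable
  finally show ?thesis ..
qed

text \<open>In polar coordinates the Newton kernel turns the volume element \<open>r\<^sup>n\<^sup>-\<^sup>1\<close> into \<open>r\<close>, so integrability near
the origin is that of \<open>r F(r)\<close>; the power weight provides the decay at infinity.\<close>

lemma integrable_newton_kernel_weight:
  fixes F :: "real \<Rightarrow> real"
  assumes n: "DIM('a) \<ge> 2"
    and [measurable]: "F \<in> borel_measurable borel" and F: "\<And>r. r > 0 \<Longrightarrow> 0 \<le> F r"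
    and M: "\<And>r. r \<ge> 1 \<Longrightarrow> F r \<le> M"
    and fin: "(\<integral>\<^sup>+r. ennreal (r * F r) * indicator {0<..<1} r \<partial>lborel) < \<infinity>"
  shows "integrable lborel (\<lambda>x::'a::euclidean_space. newton_kernel x * F (norm x) * (1 / (1 + norm x) ^ (DIM('a) + 1)))"
  unfolding newton_kernel_def
proof (rule integrable_radial)
  let ?W = "\<lambda>r. 1 / r ^ (DIM('a) - 2) * F r * (1 / (1 + r) ^ (DIM('a) + 1))"
  have M0: "0 \<le> M"
    using F[of 1] M[of 1] by simp
  have W: "?W r * r ^ (DIM('a) - 1) = r * F r / (1 + r) ^ (DIM('a) + 1)" if "r > 0" for r
  proof -
    have "DIM('a) - 1 = Suc (DIM('a) - 2)"
      using n by simp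
    then have "r ^ (DIM('a) - 1) = r * r ^ (DIM('a) - 2)"
      by (simp only: power_Suc)
    then show ?thesis
      using that by simp
  qed
  have "ennreal (?W r * r ^ (DIM('a) - 1)) * indicator {0<..} r \<le>
      ennreal (r * F r) * indicator {0<..<1} r + ennreal M * (ennreal (1 / (1 + r)\<^sup>2) * indicator {0..} r)" for r :: real
  proof (cases "r > 0")
    case r: True
    show ?thesis
    proof (cases "r < 1")
      case True
      have "r * F r / (1 + r) ^ (DIM('a) + 1) \<le> r * F r / 1"
        using r F[OF r] by (intro divide_left_mono one_le_power) auto
      then have "ennreal (?W r * r ^ (DIM('a) - 1)) * indicator {0<..} r \<le> ennreal (r * F r) * indicator {0<..<1} r"
        unfolding W[OF r] using r True by (simp add: ennreal_leI)
      then show ?thesis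
        by (rule order_trans) simp
    next
      case False
      have "(1 + r) * (1 + r)\<^sup>2 \<le> (1 + r) ^ (DIM('a) + 1)"
      proof -
        have "(1 + r)\<^sup>2 \<le> (1 + r) ^ DIM('a)"
          using n r by (intro power_increasing) auto
        then have "(1 + r) * (1 + r)\<^sup>2 \<le> (1 + r) * (1 + r) ^ DIM('a)"
          using r by (intro mult_left_mono) auto
        then show ?thesis
          by (simp only: Suc_eq_plus1[symmetric] power_Suc)
      qed
      then have "r * (1 + r)\<^sup>2 \<le> (1 + r) ^ (DIM('a) + 1)"
        using mult_right_mono[of r "1 + r" "(1 + r)\<^sup>2"] by simp
      then have "r / (1 + r) ^ (DIM('a) + 1) \<le> 1 / (1 + r)\<^sup>2"
        using r by (simp add: divide_simps del: power_Suc)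
      then have "F r * (r / (1 + r) ^ (DIM('a) + 1)) \<le> M * (1 / (1 + r)\<^sup>2)"
        using M[of r] False r M0 by (intro mult_mono) auto
      then have "ennreal (?W r * r ^ (DIM('a) - 1)) \<le> ennreal M * ennreal (1 / (1 + r)\<^sup>2)"
        unfolding W[OF r] using M0 by (subst ennreal_mult[symmetric]) (auto intro!: ennreal_leI simp: mult.commute)
      then show ?thesis
        using False r by simp
    qed
  qed simp
  then have "(\<integral>\<^sup>+r. ennreal (?W r * r ^ (DIM('a) - 1)) * indicator {0<..} r \<partial>lborel) \<le>
      (\<integral>\<^sup>+r. ennreal (r * F r) * indicator {0<..<1} r + ennreal M * (ennreal (1 / (1 + r)\<^sup>2) * indicator {0..} r) \<partial>lborel)"
    by (rule nn_integral_mono)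
  also have "\<dots> = (\<integral>\<^sup>+r. ennreal (r * F r) * indicator {0<..<1} r \<partial>lborel) + ennreal M"
    by (subst nn_integral_add, measurable, subst nn_integral_cmult, measurable)
       (simp add: nn_integral_inverse_square_tail)
  also have "\<dots> < \<infinity>"
    using fin by (simp add: less_top)
  finally show "(\<integral>\<^sup>+r. ennreal (?W r * r ^ (DIM('a) - 1)) * indicator {0<..} r \<partial>lborel) < \<infinity>" .
qed (use F in auto)

lemma integrable_newton_kernel_schwartz:
  fixes F :: "real \<Rightarrow> real" and \<phi> :: "'a::euclidean_space \<Rightarrow> complex"
  assumes \<phi>: "\<phi> \<in> schwartz_space" and n: "DIM('a) \<ge> 2"
    and F[measurable]: "F \<in> borel_measurable borel" and F0: "\<And>r. r > 0 \<Longrightarrow> 0 \<le> F r"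
    and M: "\<And>r. r \<ge> 1 \<Longrightarrow> F r \<le> M"
    and fin: "(\<integral>\<^sup>+r. ennreal (r * F r) * indicator {0<..<1} r \<partial>lborel) < \<infinity>"
  shows "integrable lborel (\<lambda>x. complex_of_real (newton_kernel x * F (norm x)) * \<phi> x)"
proof -
  note [measurable] = schwartz_measurable[OF \<phi>]
  define C where "C = 2 ^ (DIM('a) + 1) * (schwartz_seminorm 0 [] \<phi> + schwartz_seminorm (DIM('a) + 1) [] \<phi>)"
  have C: "norm (\<phi> x) \<le> C * (1 / (1 + norm x) ^ (DIM('a) + 1))" for x
    using schwartz_decay[OF \<phi>, of x "DIM('a) + 1"]
    by (simp add: C_def field_simps add_pos_nonneg del: power_Suc)
  have bound: "norm (complex_of_real (newton_kernel x * F (norm x)) * \<phi> x) \<le>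
     norm (C * (newton_kernel x * F (norm x) * (1 / (1 + norm x) ^ (DIM('a) + 1))))" for x :: 'a
  proof -
    have "norm (complex_of_real (newton_kernel x * F (norm x)) * \<phi> x) = \<bar>newton_kernel x * F (norm x)\<bar> * norm (\<phi> x)"
      by (simp only: norm_mult norm_of_real)
    also have "\<dots> \<le> \<bar>newton_kernel x * F (norm x)\<bar> * \<bar>C * (1 / (1 + norm x) ^ (DIM('a) + 1))\<bar>"
      by (intro mult_left_mono order_trans[OF C abs_ge_self]) simp
    also have "\<dots> = norm (C * (newton_kernel x * F (norm x) * (1 / (1 + norm x) ^ (DIM('a) + 1))))"
      by (simp only: real_norm_def abs_mult mult_ac)
    finally show ?thesis .
  qed
  show ?thesis
    by (rule Bochner_Integration.integrable_bound[OF
          integrable_mult_right[OF integrable_newton_kernel_weight[OF n F F0 M fin], of C]])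
       (measurable, rule AE_I2[OF bound])
qed

corollary integrable_newton_kernel_times_schwartz:
  fixes \<phi> :: "'a::euclidean_space \<Rightarrow> complex"
  assumes \<phi>: "\<phi> \<in> schwartz_space" and n: "DIM('a) \<ge> 2"
  shows "integrable lborel (\<lambda>x. complex_of_real (newton_kernel x) * \<phi> x)"
proof -
  have "(\<integral>\<^sup>+r. ennreal (r * 1) * indicator {0<..<1} (r::real) \<partial>lborel) \<le> (\<integral>\<^sup>+r. indicator {0<..<1} (r::real) \<partial>lborel)"
    by (intro nn_integral_mono) (auto simp: indicator_def ennreal_le_1)
  then have "(\<integral>\<^sup>+r. ennreal (r * 1) * indicator {0<..<1} (r::real) \<partial>lborel) < \<infinity>"
    by (rule le_less_trans) simp
  then have "integrable lborel (\<lambda>x. complex_of_real (newton_kernel x * 1) * \<phi> x)"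
    using n by (intro integrable_newton_kernel_schwartz[OF \<phi>, of "\<lambda>_. 1" 1]) auto
  then show ?thesis
    by simp
qed

lemma AE_lborel_nonzero: "AE x in lborel. x \<noteq> (0::'a::euclidean_space)"
  by (rule AE_I[where N="{0}"]) auto

text \<open>All densities below obey a bound of the form \<open>A / \<bar>\<xi>\<bar>\<^sup>2 + B\<close>. It is tempered because \<open>\<bar>\<xi>\<bar>\<^sup>-\<^sup>2\<close> is locally
integrable in dimension at least \<open>3\<close>.\<close>

lemma integrable_frequency_weight:
  fixes m :: "'a::euclidean_space \<Rightarrow> real"
  assumes n: "DIM('a) \<ge> 3" and [measurable]: "m \<in> borel_measurable borel"
    and m: "\<And>\<xi>. \<xi> \<noteq> 0 \<Longrightarrow> \<bar>m \<xi>\<bar> \<le> A / (norm \<xi>)\<^sup>2 + B"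
  shows "integrable lborel (\<lambda>\<xi>. m \<xi> * (1 / (1 + norm \<xi>) ^ (DIM('a) + 1)))"
proof (rule Bochner_Integration.integrable_bound)
  let ?w = "\<lambda>\<xi>::'a. 1 / (1 + norm \<xi>) ^ (DIM('a) + 1)"
  show "integrable lborel (\<lambda>\<xi>::'a. A * (1 / (norm \<xi>)\<^sup>2 * ?w \<xi>) + B * ?w \<xi>)"
    using n by (intro Bochner_Integration.integrable_add integrable_mult_right
      integrable_inverse_square_inverse_power integrable_inverse_power)
  show "AE \<xi> in lborel. norm (m \<xi> * ?w \<xi>) \<le> norm (A * (1 / (norm \<xi>)\<^sup>2 * ?w \<xi>) + B * ?w \<xi>)"
    using AE_lborel_nonzero
  proof eventually_elim
    case (elim \<xi>)
    have "norm (m \<xi> * ?w \<xi>) = \<bar>m \<xi>\<bar> * ?w \<xi>"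
      by (simp add: abs_mult)
    also have "\<dots> \<le> (A / (norm \<xi>)\<^sup>2 + B) * ?w \<xi>"
      using m[OF elim] by (intro mult_right_mono) auto
    also have "\<dots> = A * (1 / (norm \<xi>)\<^sup>2 * ?w \<xi>) + B * ?w \<xi>"
    proof -
      have "(A / q + B) * w = A * (1 / q * w) + B * w" for q w :: real
        by (simp add: distrib_right)
      then show ?thesis .
    qed
    also have "\<dots> \<le> norm (A * (1 / (norm \<xi>)\<^sup>2 * ?w \<xi>) + B * ?w \<xi>)"
      unfolding real_norm_def by (rule abs_ge_self)
    finally show ?case .
  qed
qed measurable

lemma integrable_frequency_fourier:
  fixes m :: "'a::euclidean_space \<Rightarrow> real"
  assumes n: "DIM('a) \<ge> 3" and [measurable]: "m \<in> borel_measurable borel"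
    and m: "\<And>\<xi>. \<xi> \<noteq> 0 \<Longrightarrow> \<bar>m \<xi>\<bar> \<le> A / (norm \<xi>)\<^sup>2 + B"
    and \<phi>: "\<phi> \<in> schwartz_space"
  shows "integrable lborel (\<lambda>\<xi>. complex_of_real (m \<xi>) * fourier \<phi> \<xi>)"
proof -
  note [measurable] = fourier_measurable[OF \<phi>]
  obtain C where C: "\<And>\<xi>. norm (fourier \<phi> \<xi>) \<le> C * (1 / (1 + norm \<xi>) ^ (DIM('a) + 1))"
    using fourier_schwartz_decay[OF \<phi>] by metis
  show ?thesis
  proof (rule Bochner_Integration.integrable_bound)
    show "integrable lborel (\<lambda>\<xi>. C * (m \<xi> * (1 / (1 + norm \<xi>) ^ (DIM('a) + 1))))"
      by (intro integrable_mult_right integrable_frequency_weight[OF n _ m]) simp_all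
    have "norm (complex_of_real (m \<xi>) * fourier \<phi> \<xi>) \<le> norm (C * (m \<xi> * (1 / (1 + norm \<xi>) ^ (DIM('a) + 1))))" for \<xi>
    proof -
      have "norm (complex_of_real (m \<xi>) * fourier \<phi> \<xi>) \<le> \<bar>m \<xi>\<bar> * \<bar>C * (1 / (1 + norm \<xi>) ^ (DIM('a) + 1))\<bar>"
        unfolding norm_mult norm_of_real by (intro mult_left_mono order_trans[OF C abs_ge_self]) simp
      also have "\<dots> = norm (C * (m \<xi> * (1 / (1 + norm \<xi>) ^ (DIM('a) + 1))))"
        by (simp only: real_norm_def abs_mult mult_ac)
      finally show ?thesis .
    qed
    then show "AE \<xi> in lborel. norm (complex_of_real (m \<xi>) * fourier \<phi> \<xi>)
        \<le> norm (C * (m \<xi> * (1 / (1 + norm \<xi>) ^ (DIM('a) + 1))))"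
      by (rule AE_I2)
  qed measurable
qed

text \<open>The substitution of \<open>u \<bar>x\<bar>\<close> for the variable of a half-line Gaussian moment. Parametrising the Gaussians
by \<open>u\<close>, with exponent \<open>u\<^sup>2 \<bar>x\<bar>\<^sup>2\<close>, makes all exponents of \<open>u\<close> integers in every dimension.\<close>

lemma newton_kernel_gaussian_mixture:
  fixes x :: "'a::euclidean_space"
  assumes n: "DIM('a) \<ge> 3" and x: "x \<noteq> 0"
  shows "(\<integral>\<^sup>+u. ennreal (indicator {0<..} u * (u ^ (DIM('a) - 3) * exp (- (u\<^sup>2) * (norm x)\<^sup>2))) \<partial>lborel) =
    ennreal (half_moment (DIM('a) - 3) * newton_kernel x)"
proof -
  let ?m = "DIM('a) - 3" and ?r = "norm x"
  have r: "?r > 0" using x by simp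
  have "(\<integral>\<^sup>+u. ennreal (exp (- u\<^sup>2)) * ennreal (1 * u ^ ?m) * indicator {0<..} u \<partial>lborel) =
     ennreal \<bar>?r\<bar> * (\<integral>\<^sup>+u. ennreal (exp (- (0 + ?r * u)\<^sup>2)) * ennreal (1 * (0 + ?r * u) ^ ?m) * indicator {0<..} (0 + ?r * u) \<partial>lborel)"
    using r by (intro nn_integral_real_affine) auto
  also have "\<dots> = ennreal ?r * (\<integral>\<^sup>+u. ennreal (?r ^ ?m) *
      ennreal (indicator {0<..} u * (u ^ ?m * exp (- (u\<^sup>2) * ?r\<^sup>2))) \<partial>lborel)"
  proof -
    have "ennreal (exp (- (0 + ?r * u)\<^sup>2)) * ennreal (1 * (0 + ?r * u) ^ ?m) * indicator {0<..} (0 + ?r * u) =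
        ennreal (?r ^ ?m) * ennreal (indicator {0<..} u * (u ^ ?m * exp (- (u\<^sup>2) * ?r\<^sup>2)))" for u
    proof (cases "u > 0")
      case True
      then have "exp (- (0 + ?r * u)\<^sup>2) * (1 * (0 + ?r * u) ^ ?m) = ?r ^ ?m * (u ^ ?m * exp (- (u\<^sup>2) * ?r\<^sup>2))"
        by (simp add: power_mult_distrib mult_ac)
      with True r show ?thesis
        by (simp add: ennreal_mult[symmetric])
    next
      case False
      then have "\<not> 0 < ?r * u"
        using r by (simp add: zero_less_mult_iff)
      with False show ?thesis by simp
    qed
    then show ?thesis
      using r by (simp only: abs_of_pos)
  qed
  also have "\<dots> = ennreal (?r * ?r ^ ?m) * (\<integral>\<^sup>+u. ennreal (indicator {0<..} u * (u ^ ?m * exp (- (u\<^sup>2) * ?r\<^sup>2))) \<partial>lborel)"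
    using r by (subst nn_integral_cmult) (auto simp: ennreal_mult mult.assoc)
  also have "?r * ?r ^ ?m = ?r ^ (DIM('a) - 2)"
  proof -
    have "DIM('a) - 2 = Suc ?m" using n by simp
    then show ?thesis by (simp only: power_Suc)
  qed
  finally have "ennreal (?r ^ (DIM('a) - 2)) *
      (\<integral>\<^sup>+u. ennreal (indicator {0<..} u * (u ^ ?m * exp (- (u\<^sup>2) * ?r\<^sup>2))) \<partial>lborel) = ennreal (half_moment ?m)"
    using nn_integral_half_moment[of 1 ?m] by simp
  then have "ennreal (newton_kernel x) * (ennreal (?r ^ (DIM('a) - 2)) *
      (\<integral>\<^sup>+u. ennreal (indicator {0<..} u * (u ^ ?m * exp (- (u\<^sup>2) * ?r\<^sup>2))) \<partial>lborel)) =
      ennreal (half_moment ?m * newton_kernel x)"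
    using half_moment_pos[of ?m] by (simp add: ennreal_mult[symmetric] mult.commute)
  moreover have "ennreal (newton_kernel x) * ennreal (?r ^ (DIM('a) - 2)) = 1"
    using r by (simp add: ennreal_mult[symmetric] newton_kernel_def)
  ultimately show ?thesis
    by (simp add: mult.assoc[symmetric])
qed

text \<open>The integrand is the derivative of \<open>exp(- b / u\<^sup>2) / (2 b)\<close>, continued by \<open>0\<close> at \<open>u = 0\<close>.\<close>

lemma inverse_square_gaussian_mixture:
  assumes b: "b > 0"
  shows "(\<integral>\<^sup>+u. ennreal (indicator {0<..} u * (1 / u ^ 3 * exp (- b / u\<^sup>2))) \<partial>lborel) = ennreal (1 / (2 * b))"
proof -
  let ?f = "\<lambda>u::real. if u > 0 then 1 / u ^ 3 * exp (- b / u\<^sup>2) else 0"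
  let ?F = "\<lambda>u::real. if u > 0 then exp (- b / u\<^sup>2) / (2 * b) else 0"
  have "(\<integral>\<^sup>+u. ennreal (indicator {0<..} u * (1 / u ^ 3 * exp (- b / u\<^sup>2))) \<partial>lborel) =
      (\<integral>\<^sup>+u. ennreal (?f u) * indicator {0..} u \<partial>lborel)"
    by (intro nn_integral_cong) (auto simp: indicator_def)
  also have "\<dots> = ennreal (1 / (2 * b) - ?F 0)"
  proof (rule nn_integral_FTC_atLeast[where F="?F"])
    fix u :: real assume "0 \<le> u"
    \<comment> \<open>At \<open>u = 0\<close> the difference quotient of the continued function tends to \<open>0\<close> from both sides.\<close>
    show "(?F has_real_derivative ?f u) (at u)"
    proof (cases "u > 0")
      case True
      have d: "((\<lambda>u. exp (- b / u\<^sup>2) / (2 * b)) has_real_derivative ?f u) (at u)"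
        using True b by (auto intro!: derivative_eq_intros simp: power2_eq_square power3_eq_cube field_simps)
      have "eventually (\<lambda>y. y > 0) (nhds u)"
        using eventually_nhds_in_open[of "{0<..}" u] True by simp
      then have ev: "eventually (\<lambda>y. exp (- b / y\<^sup>2) / (2 * b) = ?F y) (nhds u)"
        by eventually_elim simp
      show ?thesis
        by (rule iffD1[OF DERIV_cong_ev[OF refl ev refl] d])
    next
      case False
      with \<open>0 \<le> u\<close> have u: "u = 0" by simp
      have "((\<lambda>h. exp (- b / h\<^sup>2) / (2 * b) / h) \<longlongrightarrow> 0) (at_right (0::real))"
        using b by real_asymp
      then have "((\<lambda>h. (?F (0 + h) - ?F 0) / h) \<longlongrightarrow> 0) (at_right 0)"
        by (rule Lim_transform_eventually) (auto simp: eventually_at_filter)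
      moreover have "((\<lambda>h. (?F (0 + h) - ?F 0) / h) \<longlongrightarrow> 0) (at_left (0::real))"
        by (rule tendsto_eventually) (auto simp: eventually_at_filter)
      ultimately show ?thesis
        unfolding u DERIV_def by (simp add: filterlim_split_at)
    qed
  next
    show "(?F \<longlongrightarrow> 1 / (2 * b)) at_top"
    proof (rule Lim_transform_eventually)
      show "((\<lambda>u::real. exp (- b / u\<^sup>2) / (2 * b)) \<longlongrightarrow> 1 / (2 * b)) at_top"
      proof -
        have "((\<lambda>u::real. - b / u\<^sup>2) \<longlongrightarrow> 0) at_top"
          by real_asymp
        then have "((\<lambda>u::real. exp (- b / u\<^sup>2) / (2 * b)) \<longlongrightarrow> exp 0 / (2 * b)) at_top"
          using b by (intro tendsto_intros) auto
        then show ?thesis by simp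
      qed
      show "\<forall>\<^sub>F u in at_top. exp (- b / u\<^sup>2) / (2 * b) = ?F u"
        using eventually_gt_at_top[of "0::real"] by eventually_elim simp
    qed
  qed auto
  finally show ?thesis by simp
qed

text \<open>The Newton kernel is not integrable, so its transform is computed as a mixture: the kernel is a
superposition of the Gaussians \<open>exp(- u\<^sup>2 \<bar>x\<bar>\<^sup>2)\<close> with weights \<open>u\<^sup>n\<^sup>-\<^sup>3\<close>, the transform of such a
Gaussian is proportional to \<open>u\<^sup>-\<^sup>n exp(- \<bar>\<xi>\<bar>\<^sup>2 / (4 u\<^sup>2))\<close>, and the superposition of these transforms is
a multiple of \<open>\<bar>\<xi>\<bar>\<^sup>-\<^sup>2\<close>.\<close>

lemma newton_kernel_pairing:
  fixes \<phi> :: "'a::euclidean_space \<Rightarrow> complex"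
  assumes n: "DIM('a) \<ge> 3" and \<phi>: "\<phi> \<in> schwartz_space"
  defines "c \<equiv> 2 / (half_moment (DIM('a) - 3) * (2 * sqrt pi) ^ DIM('a))"
  shows "(\<integral>x. complex_of_real (newton_kernel x) * \<phi> x \<partial>lborel) =
    (\<integral>\<xi>. complex_of_real (c / (norm \<xi>)\<^sup>2) * fourier \<phi> \<xi> \<partial>lborel)"
proof -
  let ?H = "half_moment (DIM('a) - 3)"
  have H: "?H > 0" by (rule half_moment_pos)
  let ?k = "\<lambda>u (x::'a). indicator {0<..} u * (u ^ (DIM('a) - 3) * exp (- (u\<^sup>2) * (norm x)\<^sup>2)) :: real"
  let ?l = "\<lambda>u (\<xi>::'a). 1 / (2 * sqrt pi) ^ DIM('a) * (indicator {0<..} u * (1 / u ^ 3 * exp (- ((norm \<xi>)\<^sup>2 / 4) / u\<^sup>2))) :: real"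
  have int1: "integrable lborel (\<lambda>x. complex_of_real (?H * newton_kernel x) * \<phi> x)"
    using integrable_mult_right[OF integrable_newton_kernel_times_schwartz[OF \<phi>], of "complex_of_real ?H"] n
    by (simp add: mult.assoc)
  have "(\<integral>x. complex_of_real (?H * newton_kernel x) * \<phi> x \<partial>lborel) =
      (\<integral>u. (\<integral>x. complex_of_real (?k u x) * \<phi> x \<partial>lborel) \<partial>lborel)"
  proof (rule integral_mixture[OF _ schwartz_measurable[OF \<phi>] _ _ _ int1])
    show "AE x in lborel. (\<integral>\<^sup>+u. ennreal (?k u x) \<partial>lborel) = ennreal (?H * newton_kernel x)"
      using AE_lborel_nonzero by eventually_elim (rule newton_kernel_gaussian_mixture[OF n])
  qed (use H in \<open>auto simp: indicator_def\<close>)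
  also have "\<dots> = (\<integral>u. (\<integral>\<xi>. complex_of_real (?l u \<xi>) * fourier \<phi> \<xi> \<partial>lborel) \<partial>lborel)"
  proof (rule Bochner_Integration.integral_cong[OF refl])
    fix u :: real
    show "(\<integral>x. complex_of_real (?k u x) * \<phi> x \<partial>lborel) = (\<integral>\<xi>. complex_of_real (?l u \<xi>) * fourier \<phi> \<xi> \<partial>lborel)"
    proof (cases "u > 0")
      case u: True
      then have u2: "u\<^sup>2 > 0" by simp
      let ?g = "\<lambda>x::'a. u ^ (DIM('a) - 3) * exp (- (u\<^sup>2) * (norm x)\<^sup>2)"
      have "(\<integral>x. ?g x * cos (x \<bullet> \<xi>) \<partial>lborel) / (2 * pi) ^ DIM('a) =
          1 / (2 * sqrt pi) ^ DIM('a) * (1 / u ^ 3 * exp (- ((norm \<xi>)\<^sup>2 / 4) / u\<^sup>2))" for \<xi>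
      proof -
        have "complex_of_real (\<integral>x. exp (- (u\<^sup>2) * (norm x)\<^sup>2) * cos (x \<bullet> \<xi>) \<partial>lborel) =
            complex_of_real (sqrt (pi / u\<^sup>2) ^ DIM('a) * exp (- ((norm \<xi>)\<^sup>2) / (4 * u\<^sup>2)))"
          using integral_even_kernel_iexp[OF integral_gaussian(1)[OF u2], of \<xi>] gaussian_fourier(2)[OF u2, of \<xi>]
          by (simp only: norm_minus_cancel)
        then have "(\<integral>x. exp (- (u\<^sup>2) * (norm x)\<^sup>2) * cos (x \<bullet> \<xi>) \<partial>lborel) =
            sqrt (pi / u\<^sup>2) ^ DIM('a) * exp (- ((norm \<xi>)\<^sup>2) / (4 * u\<^sup>2))"
          by (simp only: of_real_eq_iff)
        moreover have "(\<integral>x. ?g x * cos (x \<bullet> \<xi>) \<partial>lborel) =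
            u ^ (DIM('a) - 3) * (\<integral>x. exp (- (u\<^sup>2) * (norm x)\<^sup>2) * cos (x \<bullet> \<xi>) \<partial>lborel)"
          by (simp only: mult.assoc integral_mult_right_zero)
        moreover have "u ^ (DIM('a) - 3) * sqrt (pi / u\<^sup>2) ^ DIM('a) / (2 * pi) ^ DIM('a) = 1 / (2 * sqrt pi) ^ DIM('a) * (1 / u ^ 3)"
        proof -
          have "sqrt (pi / u\<^sup>2) / (2 * pi) = 1 / (2 * sqrt pi) * (1 / u)"
            using u by (simp add: real_sqrt_divide divide_simps)
          then have "sqrt (pi / u\<^sup>2) ^ DIM('a) / (2 * pi) ^ DIM('a) = 1 / (2 * sqrt pi) ^ DIM('a) * (1 / u ^ DIM('a))"
            by (simp only: power_divide[symmetric] power_one_over[symmetric] power_mult_distrib[symmetric])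
          moreover have "u ^ (DIM('a) - 3) * (1 / u ^ DIM('a)) = 1 / u ^ 3"
          proof -
            have "u ^ DIM('a) = u ^ (DIM('a) - 3) * u ^ 3"
              using n by (simp flip: power_add)
            then show ?thesis using u by simp
          qed
          ultimately show ?thesis
            by (simp only: times_divide_eq_right[symmetric, of "u ^ (DIM('a) - 3)"]
                mult.left_commute[of "u ^ (DIM('a) - 3)"])
        qed
        moreover have "- ((norm \<xi>)\<^sup>2) / (4 * u\<^sup>2) = - ((norm \<xi>)\<^sup>2 / 4) / u\<^sup>2"
          by simp
        moreover have "a * (S * E) / P = a * S / P * E" for a S E P :: real
          by simp
        ultimately show ?thesis
          by (simp only: mult.assoc)
      qed
      moreover have "integrable lborel ?g"
        by (intro integrable_mult_right integral_gaussian(1)[OF u2])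
      ultimately show ?thesis
        using even_kernel_pairing[of ?g \<phi>] \<phi> u by simp
    qed simp
  qed
  also have "\<dots> = (\<integral>\<xi>. complex_of_real (?H * (c / (norm \<xi>)\<^sup>2)) * fourier \<phi> \<xi> \<partial>lborel)"
  proof (rule integral_mixture[symmetric, OF _ fourier_measurable[OF \<phi>]])
    have c: "?H * c = 1 / (2 * sqrt pi) ^ DIM('a) * 2"
      using H by (simp add: c_def)
    then have c0: "0 \<le> ?H * c"
      by simp
    then show pos: "0 \<le> ?H * (c / (norm \<xi>)\<^sup>2)" for \<xi> :: 'a
      by (simp only: times_divide_eq_right) (intro divide_nonneg_nonneg, simp_all)
    have "\<bar>?H * (c / (norm \<xi>)\<^sup>2)\<bar> \<le> ?H * c / (norm \<xi>)\<^sup>2 + 0" for \<xi> :: 'a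
      unfolding abs_of_nonneg[OF pos] by simp
    then show "integrable lborel (\<lambda>\<xi>. complex_of_real (?H * (c / (norm \<xi>)\<^sup>2)) * fourier \<phi> \<xi>)"
      by (intro integrable_frequency_fourier[OF n _ _ \<phi>, where A="?H * c" and B=0]) measurable
    show "AE \<xi> in lborel. (\<integral>\<^sup>+u. ennreal (?l u \<xi>) \<partial>lborel) = ennreal (?H * (c / (norm \<xi>)\<^sup>2))"
      using AE_lborel_nonzero
    proof eventually_elim
      case (elim \<xi>)
      have "(\<integral>\<^sup>+u. ennreal (?l u \<xi>) \<partial>lborel) = ennreal (1 / (2 * sqrt pi) ^ DIM('a)) *
          (\<integral>\<^sup>+u. ennreal (indicator {0<..} u * (1 / u ^ 3 * exp (- ((norm \<xi>)\<^sup>2 / 4) / u\<^sup>2))) \<partial>lborel)"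
        by (subst nn_integral_cmult[symmetric]) (simp_all add: ennreal_mult' del: times_divide_eq_left)
      also have "\<dots> = ennreal (1 / (2 * sqrt pi) ^ DIM('a)) * ennreal (1 / (2 * ((norm \<xi>)\<^sup>2 / 4)))"
        using elim by (subst inverse_square_gaussian_mixture) simp_all
      also have "\<dots> = ennreal (1 / (2 * sqrt pi) ^ DIM('a) * (1 / (2 * ((norm \<xi>)\<^sup>2 / 4))))"
        by (rule ennreal_mult[symmetric]) simp_all
      also have "1 / (2 * sqrt pi) ^ DIM('a) * (1 / (2 * ((norm \<xi>)\<^sup>2 / 4))) = ?H * (c / (norm \<xi>)\<^sup>2)"
        unfolding times_divide_eq_right[of ?H] c by simp
      finally show ?case .
    qed
    show "0 \<le> ?l u \<xi>" for u \<xi>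
      by (auto simp: indicator_def)
  qed measurable
  finally have "complex_of_real ?H * (\<integral>x. complex_of_real (newton_kernel x) * \<phi> x \<partial>lborel) =
      complex_of_real ?H * (\<integral>\<xi>. complex_of_real (c / (norm \<xi>)\<^sup>2) * fourier \<phi> \<xi> \<partial>lborel)"
    by (simp only: of_real_mult mult.assoc integral_mult_right_zero)
  then show ?thesis
    using H by (subst (asm) mult_cancel_left) simp
qed

section \<open>Superposition of truncated kernels\<close>

lemma AE_norm_neq: "AE x in lborel. norm (x::'a::euclidean_space) \<noteq> T"
proof (rule AE_I')
  have "sphere (0::'a) T \<in> null_sets lebesgue"
    using negligible_sphere[of "0::'a" T] by (simp add: negligible_iff_null_sets)
  then show "sphere (0::'a) T \<in> null_sets lborel"
    by (subst (asm) null_sets_completion_iff) auto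
qed auto

text \<open>By monotonicity a superlevel set is an interval with left end point \<open>0\<close>, and \<open>T\<close> is its supremum;
whether the end point belongs to it matters only on a sphere. The point \<open>R\<close>, where \<open>F\<close> does not exceed
the level, keeps the supremum finite.\<close>

lemma superlevel_truncation:
  fixes F :: "real \<Rightarrow> real"
  assumes anti: "\<And>r r'. 0 < r \<Longrightarrow> r \<le> r' \<Longrightarrow> F r' \<le> F r"
    and R: "R > 0" "F R \<le> s"
  obtains T where "T \<ge> 0"
    "AE x::'a::euclidean_space in lborel. (if s < F (norm x) then newton_kernel x else 0) = indicator (ball 0 T) x * newton_kernel x"
proof -
  \<comment> \<open>Adjoining \<open>0\<close> gives \<open>T = 0\<close> when the superlevel set is empty.\<close>
  define D where "D = insert 0 {r. 0 < r \<and> s < F r}"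
  have "r \<le> R" if "r \<in> D" for r
    using that R anti[of R r] by (force simp: D_def not_le)
  then have bdd: "bdd_above D"
    by (auto simp: bdd_above_def)
  have ne: "D \<noteq> {}" by (auto simp: D_def)
  have "0 \<le> Sup D"
    by (rule cSup_upper[OF _ bdd]) (simp add: D_def)
  moreover have "AE x::'a in lborel. (if s < F (norm x) then newton_kernel x else 0) = indicator (ball 0 (Sup D)) x * newton_kernel x"
    using AE_lborel_nonzero AE_norm_neq[of "Sup D"]
  proof eventually_elim
    case (elim x)
    show ?case
    proof (cases "norm x < Sup D")
      case True
      then obtain r where "r \<in> D" "norm x < r"
        using less_cSup_iff[OF ne bdd] by auto
      then have "s < F (norm x)"
        using elim anti[of "norm x" r] by (auto simp: D_def)
      with True show ?thesis by simp
    next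
      case False
      have "\<not> s < F (norm x)"
      proof
        assume "s < F (norm x)"
        then have "norm x \<in> D" using elim by (simp add: D_def)
        then have "norm x \<le> Sup D" by (rule cSup_upper[OF _ bdd])
        with False elim show False by simp
      qed
      with False show ?thesis by simp
    qed
  qed
  ultimately show ?thesis by (rule that)
qed

text \<open>The function \<open>h s\<close> below is the slice of \<open>\<bar>x\<bar>\<^sup>2\<^sup>-\<^sup>n F(\<bar>x\<bar>)\<close> at level \<open>s\<close>, a truncated kernel up to a null
set, and \<open>v s\<close> is its transform. The density \<open>m\<close> is the superposition of the \<open>v s\<close>, divided by \<open>(2\<pi>)\<^sup>n\<close>. Its bound splits
the levels at \<open>F 1\<close>: lower levels use the bound of \<open>v s\<close> by a multiple of \<open>\<bar>\<xi>\<bar>\<^sup>-\<^sup>2\<close>, and for higher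
levels \<open>v s\<close> is at most the integral of \<open>h s\<close>, where all these slices live in the unit ball.\<close>

lemma layer_cake_pairing:
  fixes F :: "real \<Rightarrow> real"
  assumes n: "DIM('a::euclidean_space) \<ge> 3"
    and F[measurable]: "F \<in> borel_measurable borel" and F0: "\<And>r. 0 \<le> F r"
    and anti: "\<And>r r'. 0 < r \<Longrightarrow> r \<le> r' \<Longrightarrow> F r' \<le> F r"
    and vanish: "\<And>s. s > 0 \<Longrightarrow> \<exists>R>0. F R \<le> s"
    and fin: "(\<integral>\<^sup>+r. ennreal (r * F r) * indicator {0<..<1} r \<partial>lborel) < \<infinity>"
  obtains m :: "'a::euclidean_space \<Rightarrow> real" and A B where "m \<in> borel_measurable borel" "\<And>\<xi>. 0 \<le> m \<xi>"
    "\<And>\<xi>. \<xi> \<noteq> 0 \<Longrightarrow> m \<xi> \<le> A / (norm \<xi>)\<^sup>2 + B"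
    "\<And>\<phi>. \<phi> \<in> schwartz_space \<Longrightarrow> (\<integral>x. complex_of_real (newton_kernel x * F (norm x)) * \<phi> x \<partial>lborel) =
       (\<integral>\<xi>. complex_of_real (m \<xi>) * fourier \<phi> \<xi> \<partial>lborel)"
proof -
  have n2: "DIM('a) \<ge> 2" using n by simp
  have le1: "F r \<le> F 1" if "r \<ge> 1" for r
    using anti[of 1 r] that by simp
  define h where "h s x = (if 0 < s \<and> s < F (norm x) then newton_kernel x else 0)" for s and x :: 'a
  define v where "v s \<xi> = (\<integral>x. h s x * cos (x \<bullet> \<xi>) \<partial>lborel)" for s and \<xi> :: 'a
  have h0: "0 \<le> h s x" for s x
    by (simp add: h_def)
  have h_meas[measurable]: "case_prod h \<in> borel_measurable (lborel \<Otimes>\<^sub>M lborel)"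
    unfolding h_def by measurable
  have [measurable]: "h s \<in> borel_measurable borel" for s
    unfolding h_def by measurable
  have trunc: "\<exists>T\<ge>0. AE x in lborel. h s x = indicator (ball 0 T) x * newton_kernel x" for s
  proof (cases "s > 0")
    case True
    then obtain R where R: "R > 0" "F R \<le> s" using vanish by auto
    obtain T where "T \<ge> 0" "AE x::'a in lborel. (if s < F (norm x) then newton_kernel x else 0) =
        indicator (ball 0 T) x * newton_kernel x"
      by (rule superlevel_truncation[of F R s, OF anti R])
    then show ?thesis
      using True by (auto simp: h_def)
  next
    case False
    then show ?thesis
      by (intro exI[of _ 0]) (simp add: h_def)
  qed
  define A where "A = 2 * (measure lborel (ball (0::'a) 1) * real DIM('a) * (real DIM('a) - 2))"
  have A0: "0 \<le> A" using n by (simp add: A_def)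
  have h_int: "integrable lborel (h s)" and v_eq: "\<exists>T\<ge>0. \<forall>\<xi>. v s \<xi> = (\<integral>x. indicator (ball 0 T) x * newton_kernel x * cos (x \<bullet> \<xi>) \<partial>lborel)" for s
  proof -
    obtain T where T: "T \<ge> 0" and ae: "AE x in lborel. h s x = indicator (ball 0 T) x * newton_kernel x"
      using trunc by blast
    have [measurable]: "ball (0::'a) T \<in> sets borel" by simp
    show "integrable lborel (h s)"
      by (rule integrable_cong_AE_imp[OF integrable_truncated_kernel[OF T n2]])
         (measurable, use ae in \<open>eventually_elim, simp\<close>)
    have "v s \<xi> = (\<integral>x. indicator (ball 0 T) x * newton_kernel x * cos (x \<bullet> \<xi>) \<partial>lborel)" for \<xi>
      unfolding v_def by (rule integral_cong_AE) (measurable, use ae in \<open>eventually_elim, simp\<close>)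
    with T show "\<exists>T\<ge>0. \<forall>\<xi>. v s \<xi> = (\<integral>x. indicator (ball 0 T) x * newton_kernel x * cos (x \<bullet> \<xi>) \<partial>lborel)"
      by blast
  qed
  have v0: "0 \<le> v s \<xi>" and v_le: "\<xi> \<noteq> 0 \<Longrightarrow> v s \<xi> \<le> A / (norm \<xi>)\<^sup>2" for s \<xi>
  proof -
    obtain T where T: "T \<ge> 0" "v s \<xi> = (\<integral>x. indicator (ball 0 T) x * newton_kernel x * cos (x \<bullet> \<xi>) \<partial>lborel)"
      using v_eq by blast
    show "0 \<le> v s \<xi>"
      unfolding T(2) by (rule truncated_kernel_transform_bounds(1)[OF T(1) n])
    show "\<xi> \<noteq> 0 \<Longrightarrow> v s \<xi> \<le> A / (norm \<xi>)\<^sup>2"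
      unfolding T(2) A_def using truncated_kernel_transform_bounds(2)[OF T(1) n, of \<xi>] by blast
  qed
  have v_meas[measurable]: "case_prod v \<in> borel_measurable (lborel \<Otimes>\<^sub>M lborel)"
  proof -
    have "(\<lambda>p. \<integral>x. h (fst p) x * cos (x \<bullet> snd p) \<partial>lborel) \<in> borel_measurable (lborel \<Otimes>\<^sub>M lborel)"
    proof (rule lborel.borel_measurable_lebesgue_integral)
      have "(\<lambda>q. h (fst (fst q)) (snd q)) \<in> borel_measurable ((lborel \<Otimes>\<^sub>M lborel) \<Otimes>\<^sub>M lborel)"
        unfolding h_def by measurable
      then show "(\<lambda>(p, x). h (fst p) x * cos (x \<bullet> snd p)) \<in> borel_measurable ((lborel \<Otimes>\<^sub>M lborel) \<Otimes>\<^sub>M lborel)"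
        unfolding split_def by measurable
    qed
    then show ?thesis
      unfolding v_def[abs_def] split_def .
  qed
  have v_nn: "ennreal (v s \<xi>) \<le> (\<integral>\<^sup>+x. ennreal (h s x) \<partial>lborel)" for s \<xi>
  proof -
    have "v s \<xi> \<le> (\<integral>x. h s x \<partial>lborel)"
      unfolding v_def
    proof (rule integral_mono[OF _ h_int])
      show "integrable lborel (\<lambda>x. h s x * cos (x \<bullet> \<xi>))"
        by (rule Bochner_Integration.integrable_bound[OF h_int[of s]])
           (auto simp: abs_mult intro!: mult_right_le_one_le)
      show "h s x * cos (x \<bullet> \<xi>) \<le> h s x" for x
        using h0[of s x] by (simp add: mult_left_le)
    qed
    also have "ennreal \<dots> = (\<integral>\<^sup>+x. ennreal (h s x) \<partial>lborel)"
      by (rule nn_integral_eq_integral[symmetric, OF h_int]) (simp add: h0)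
    finally show ?thesis by (simp add: ennreal_leI)
  qed
  have h_layers: "(\<integral>\<^sup>+s. ennreal (h s x) \<partial>lborel) = ennreal (newton_kernel x * F (norm x))" for x
  proof -
    have "(\<integral>\<^sup>+s. ennreal (h s x) \<partial>lborel) = (\<integral>\<^sup>+s. ennreal (newton_kernel x) * indicator {0<..<F (norm x)} s \<partial>lborel)"
      by (intro nn_integral_cong) (simp add: h_def indicator_def)
    also have "\<dots> = ennreal (newton_kernel x * F (norm x))"
      using F0 by (simp add: nn_integral_cmult ennreal_mult)
    finally show ?thesis .
  qed
  \<comment> \<open>The total mass of the slices above the level \<open>F 1\<close>.\<close>
  define Q where "Q = (\<integral>\<^sup>+s. indicator {F 1<..} s * (\<integral>\<^sup>+x. ennreal (h s x) \<partial>lborel) \<partial>lborel)"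
  have Q: "Q < \<infinity>"
  proof -
    let ?w = "\<lambda>x::'a. newton_kernel x * F (norm x) * (1 / (1 + norm x) ^ (DIM('a) + 1))"
    have "Q = (\<integral>\<^sup>+s. (\<integral>\<^sup>+x. indicator {F 1<..} s * ennreal (h s x) \<partial>lborel) \<partial>lborel)"
      unfolding Q_def by (intro nn_integral_cong nn_integral_cmult[symmetric]) measurable
    also have "\<dots> = (\<integral>\<^sup>+x. (\<integral>\<^sup>+s. indicator {F 1<..} s * ennreal (h s x) \<partial>lborel) \<partial>lborel)"
      by (rule lborel_pair.Fubini') measurable
    also have "\<dots> \<le> (\<integral>\<^sup>+x. ennreal (2 ^ (DIM('a) + 1)) * ennreal (?w x) \<partial>lborel)"
    proof (rule nn_integral_mono)
      fix x :: 'a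
      show "(\<integral>\<^sup>+s. indicator {F 1<..} s * ennreal (h s x) \<partial>lborel) \<le> ennreal (2 ^ (DIM('a) + 1)) * ennreal (?w x)"
      proof (cases "norm x < 1")
        case True
        have "(\<integral>\<^sup>+s. indicator {F 1<..} s * ennreal (h s x) \<partial>lborel) \<le> (\<integral>\<^sup>+s. ennreal (h s x) \<partial>lborel)"
          by (intro nn_integral_mono) (simp add: indicator_def)
        also have "\<dots> = ennreal (newton_kernel x * F (norm x))"
          by (rule h_layers)
        also have "\<dots> \<le> ennreal (2 ^ (DIM('a) + 1) * ?w x)"
        proof (rule ennreal_leI)
          have "(1 + norm x) ^ (DIM('a) + 1) \<le> 2 ^ (DIM('a) + 1)"
            using True by (intro power_mono) auto
          then have "1 \<le> 2 ^ (DIM('a) + 1) * (1 / (1 + norm x) ^ (DIM('a) + 1))"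
            by (simp add: add_pos_nonneg del: power_Suc)
          then have "newton_kernel x * F (norm x) * 1 \<le>
              newton_kernel x * F (norm x) * (2 ^ (DIM('a) + 1) * (1 / (1 + norm x) ^ (DIM('a) + 1)))"
            by (rule mult_left_mono) (simp add: F0)
          then show "newton_kernel x * F (norm x) \<le> 2 ^ (DIM('a) + 1) * ?w x"
            by (simp only: mult_1_right mult_ac)
        qed
        also have "\<dots> = ennreal (2 ^ (DIM('a) + 1)) * ennreal (?w x)"
          by (rule ennreal_mult) (simp_all add: F0)
        finally show ?thesis .
      next
        case False
        then have "indicator {F 1<..} s * ennreal (h s x) = 0" for s
          using le1[of "norm x"] by (auto simp: indicator_def h_def)
        then show ?thesis by (simp only: nn_integral_const) simp
      qed
    qed
    also have "\<dots> = ennreal (2 ^ (DIM('a) + 1)) * (\<integral>\<^sup>+x. ennreal (?w x) \<partial>lborel)"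
      by (rule nn_integral_cmult) measurable
    also have "\<dots> < \<infinity>"
    proof -
      have "integrable lborel ?w"
        using F0 le1 fin by (intro integrable_newton_kernel_weight[OF n2 F, where M="F 1"])
      then have "(\<integral>\<^sup>+x. ennreal (?w x) \<partial>lborel) < \<infinity>"
        by (subst nn_integral_eq_integral) (simp_all add: F0)
      then show ?thesis
        by (simp add: ennreal_mult_less_top)
    qed
    finally show ?thesis .
  qed
  have v_layers: "(\<integral>\<^sup>+s. ennreal (v s \<xi>) \<partial>lborel) \<le> ennreal (F 1 * A / (norm \<xi>)\<^sup>2) + Q" if \<xi>: "\<xi> \<noteq> 0" for \<xi>
  proof -
    have "(\<integral>\<^sup>+s. ennreal (v s \<xi>) \<partial>lborel) \<le>
        (\<integral>\<^sup>+s. ennreal (A / (norm \<xi>)\<^sup>2) * indicator {0..F 1} s + indicator {F 1<..} s * (\<integral>\<^sup>+x. ennreal (h s x) \<partial>lborel) \<partial>lborel)"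
    proof (rule nn_integral_mono)
      fix s :: real
      consider "s < 0" | "0 \<le> s" "s \<le> F 1" | "s > F 1" by linarith
      then show "ennreal (v s \<xi>) \<le> ennreal (A / (norm \<xi>)\<^sup>2) * indicator {0..F 1} s +
          indicator {F 1<..} s * (\<integral>\<^sup>+x. ennreal (h s x) \<partial>lborel)"
      proof cases
        case 1
        then have "v s \<xi> = 0" by (simp add: v_def h_def)
        then show ?thesis by simp
      next
        case 2
        then show ?thesis using v_le[OF \<xi>, of s] by (simp add: ennreal_leI)
      next
        case 3
        then show ?thesis using v_nn by simp
      qed
    qed
    also have "\<dots> = ennreal (A / (norm \<xi>)\<^sup>2) * ennreal (F 1) + Q"
      unfolding Q_def using F0 by (subst nn_integral_add) (simp_all add: nn_integral_cmult)
    also have "ennreal (A / (norm \<xi>)\<^sup>2) * ennreal (F 1) = ennreal (F 1 * A / (norm \<xi>)\<^sup>2)"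
      using A0 F0 by (subst ennreal_mult[symmetric]) (simp_all add: mult.commute)
    finally show ?thesis .
  qed
  define P where "P = (2 * pi) ^ DIM('a)"
  have P: "P > 0" by (simp add: P_def)
  \<comment> \<open>The inner integral may be infinite at \<open>\<xi> = 0\<close>, where \<open>m\<close> then has the value \<open>0\<close>.\<close>
  define m where "m \<xi> = enn2real (\<integral>\<^sup>+s. ennreal (v s \<xi> / P) \<partial>lborel)" for \<xi>
  have m_meas[measurable]: "m \<in> borel_measurable borel"
    unfolding m_def by measurable
  have v_layers': "(\<integral>\<^sup>+s. ennreal (v s \<xi> / P) \<partial>lborel) \<le> ennreal (1 / P * (F 1 * A / (norm \<xi>)\<^sup>2 + enn2real Q))" if \<xi>: "\<xi> \<noteq> 0" for \<xi>
  proof -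
    have "(\<integral>\<^sup>+s. ennreal (v s \<xi> / P) \<partial>lborel) = (\<integral>\<^sup>+s. ennreal (1 / P) * ennreal (v s \<xi>) \<partial>lborel)"
      using P v0 by (intro nn_integral_cong) (simp add: ennreal_mult[symmetric])
    also have "\<dots> = ennreal (1 / P) * (\<integral>\<^sup>+s. ennreal (v s \<xi>) \<partial>lborel)"
      by (rule nn_integral_cmult) measurable
    also have "\<dots> \<le> ennreal (1 / P) * (ennreal (F 1 * A / (norm \<xi>)\<^sup>2) + Q)"
      by (rule mult_left_mono[OF v_layers[OF \<xi>]]) simp
    also have "\<dots> = ennreal (1 / P) * ennreal (F 1 * A / (norm \<xi>)\<^sup>2 + enn2real Q)"
      using Q F0[of 1] A0 by (simp add: ennreal_plus)
    also have "\<dots> = ennreal (1 / P * (F 1 * A / (norm \<xi>)\<^sup>2 + enn2real Q))"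
      using P F0[of 1] A0 by (intro ennreal_mult[symmetric]) auto
    finally show ?thesis .
  qed
  have m0: "0 \<le> m \<xi>" for \<xi>
    by (simp add: m_def)
  have m_eq: "(\<integral>\<^sup>+s. ennreal (v s \<xi> / P) \<partial>lborel) = ennreal (m \<xi>)" if \<xi>: "\<xi> \<noteq> 0" for \<xi>
    unfolding m_def using le_less_trans[OF v_layers'[OF \<xi>] ennreal_less_top] by (intro ennreal_enn2real[symmetric])
  have m_le: "m \<xi> \<le> (F 1 * A / P) / (norm \<xi>)\<^sup>2 + enn2real Q / P" if \<xi>: "\<xi> \<noteq> 0" for \<xi>
  proof -
    have "m \<xi> \<le> 1 / P * (F 1 * A / (norm \<xi>)\<^sup>2 + enn2real Q)"
      using v_layers'[OF \<xi>] P F0[of 1] A0 unfolding m_eq[OF \<xi>] by (subst (asm) ennreal_le_iff) auto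
    also have "\<dots> = (F 1 * A / P) / (norm \<xi>)\<^sup>2 + enn2real Q / P"
      by (simp add: distrib_left mult.commute)
    finally show ?thesis .
  qed
  show ?thesis
  proof (rule that[OF m_meas m0 m_le])
    fix \<phi> :: "'a \<Rightarrow> complex" assume \<phi>: "\<phi> \<in> schwartz_space"
    have int: "integrable lborel (\<lambda>x. complex_of_real (newton_kernel x * F (norm x)) * \<phi> x)"
      using F0 le1 fin by (intro integrable_newton_kernel_schwartz[OF \<phi> n2 F, where M="F 1"])
    have "(\<integral>x. complex_of_real (newton_kernel x * F (norm x)) * \<phi> x \<partial>lborel) =
        (\<integral>s. (\<integral>x. complex_of_real (h s x) * \<phi> x \<partial>lborel) \<partial>lborel)"
      by (rule integral_mixture[OF h_meas schwartz_measurable[OF \<phi>] h0 _ _ int]) (simp_all add: F0 h_layers)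
    also have "\<dots> = (\<integral>s. (\<integral>\<xi>. complex_of_real (v s \<xi> / P) * fourier \<phi> \<xi> \<partial>lborel) \<partial>lborel)"
      unfolding v_def P_def
      by (rule Bochner_Integration.integral_cong[OF refl], rule even_kernel_pairing[OF h_int _ \<phi>]) (simp add: h_def)
    also have "\<dots> = (\<integral>\<xi>. complex_of_real (m \<xi>) * fourier \<phi> \<xi> \<partial>lborel)"
    proof (rule integral_mixture[symmetric, OF _ fourier_measurable[OF \<phi>] _ m0])
      show "(\<lambda>(s, \<xi>). v s \<xi> / P) \<in> borel_measurable (lborel \<Otimes>\<^sub>M lborel)"
        by measurable
      show "0 \<le> v s \<xi> / P" for s \<xi>
        using v0 P by simp
      show "AE \<xi> in lborel. (\<integral>\<^sup>+s. ennreal (v s \<xi> / P) \<partial>lborel) = ennreal (m \<xi>)"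
        using AE_lborel_nonzero by eventually_elim (rule m_eq)
      show "integrable lborel (\<lambda>\<xi>. complex_of_real (m \<xi>) * fourier \<phi> \<xi>)"
        by (rule integrable_frequency_fourier[OF n m_meas _ \<phi>]) (unfold abs_of_nonneg[OF m0], rule m_le)
    qed
    finally show "(\<integral>x. complex_of_real (newton_kernel x * F (norm x)) * \<phi> x \<partial>lborel) =
        (\<integral>\<xi>. complex_of_real (m \<xi>) * fourier \<phi> \<xi> \<partial>lborel)" .
  qed
qed

section \<open>Positive definiteness\<close>

text \<open>Everything is controlled by the integrable weight \<open>?w\<close>. The absolute value of \<open>g\<close> is \<open>?w\<close> times
\<open>(1 + \<bar>x\<bar>)\<^sup>N\<close> with \<open>N = n + 1\<close>; this factor is bounded on compact sets, and against a Schwartz function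
it is bounded by two of the seminorms.\<close>

lemma defines_distribution_newton_kernel_weight:
  fixes F :: "real \<Rightarrow> real" and g :: "'a::euclidean_space \<Rightarrow> complex"
  assumes n: "DIM('a) \<ge> 2"
    and F[measurable]: "F \<in> borel_measurable borel" and F0: "\<And>r. r > 0 \<Longrightarrow> 0 \<le> F r"
    and M: "\<And>r. r \<ge> 1 \<Longrightarrow> F r \<le> M"
    and fin: "(\<integral>\<^sup>+r. ennreal (r * F r) * indicator {0<..<1} r \<partial>lborel) < \<infinity>"
    and g: "\<And>x. x \<noteq> 0 \<Longrightarrow> g x = complex_of_real (newton_kernel x * F (norm x))"
  shows "defines_distribution g"
    and "\<phi> \<in> schwartz_space \<Longrightarrow>
      distribution_of g \<phi> = (\<integral>x. complex_of_real (newton_kernel x * F (norm x)) * \<phi> x \<partial>lborel)"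
proof -
  let ?N = "DIM('a) + 1"
  let ?k = "\<lambda>x::'a. newton_kernel x * F (norm x)"
  let ?w = "\<lambda>x::'a. ?k x * (1 / (1 + norm x) ^ ?N)"
  have w: "integrable lborel ?w"
    by (rule integrable_newton_kernel_weight[OF n F F0 M fin])
  have w0: "AE x in lborel. 0 \<le> ?w x"
    using AE_lborel_nonzero by eventually_elim (simp add: F0)
  have "g = (\<lambda>x. if x = 0 then g 0 else complex_of_real (?k x))"
    using g by auto
  moreover have "(\<lambda>x. if x = 0 then g 0 else complex_of_real (?k x)) \<in> borel_measurable borel"
    by measurable
  ultimately have g_meas[measurable]: "g \<in> borel_measurable borel"
    by simp
  have g_AE: "AE x in lborel. g x * \<phi> x = complex_of_real (?k x) * \<phi> x" for \<phi>
    using AE_lborel_nonzero by eventually_elim (simp add: g)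
  have norm_g: "AE x in lborel. norm (g x) = ?w x * (1 + norm x) ^ ?N"
    using AE_lborel_nonzero
  proof eventually_elim
    case (elim x)
    have "1 + norm x > 0" by (simp add: add_pos_nonneg)
    then show ?case
      using elim F0[of "norm x"] by (simp add: g norm_mult del: power_Suc)
  qed
  have int: "integrable lborel (\<lambda>x. g x * \<phi> x)"
    and eq: "distribution_of g \<phi> = (\<integral>x. complex_of_real (?k x) * \<phi> x \<partial>lborel)"
    and eq': "distribution_of g \<phi> = (\<integral>x. g x * \<phi> x \<partial>lborel)"
    if \<phi>: "\<phi> \<in> schwartz_space" for \<phi>
  proof -
    note [measurable] = schwartz_measurable[OF \<phi>]
    show "integrable lborel (\<lambda>x. g x * \<phi> x)"
      by (rule integrable_cong_AE_imp[OF integrable_newton_kernel_schwartz[OF \<phi> n F F0 M fin]])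
         (measurable, use g_AE[of \<phi>] in \<open>eventually_elim, simp only:\<close>)
    show eq': "distribution_of g \<phi> = (\<integral>x. g x * \<phi> x \<partial>lborel)"
      unfolding distribution_of_def by (rule integral_completion) measurable
    show "distribution_of g \<phi> = (\<integral>x. complex_of_real (?k x) * \<phi> x \<partial>lborel)"
      unfolding eq' by (rule integral_cong_AE[OF _ _ g_AE]) measurable
  qed
  show "\<phi> \<in> schwartz_space \<Longrightarrow> distribution_of g \<phi> = (\<integral>x. complex_of_real (?k x) * \<phi> x \<partial>lborel)"
    by (rule eq)
  have "locally_integrable g"
    unfolding locally_integrable_def
  proof (intro allI impI)
    fix K :: "'a set" assume K: "compact K"
    then have [measurable]: "K \<in> sets borel"
      by (simp add: compact_imp_closed)
    obtain R where R: "\<And>x. x \<in> K \<Longrightarrow> norm x \<le> R"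
      using compact_imp_bounded[OF K] by (auto simp: bounded_iff)
    have "integrable lborel (\<lambda>x. indicator K x *\<^sub>R g x)"
    proof (rule Bochner_Integration.integrable_bound)
      show "integrable lborel (\<lambda>x. (1 + R) ^ ?N * ?w x)"
        by (intro integrable_mult_right w)
      show "AE x in lborel. norm (indicator K x *\<^sub>R g x) \<le> norm ((1 + R) ^ ?N * ?w x)"
        using norm_g w0
      proof eventually_elim
        case (elim x)
        show ?case
        proof (cases "x \<in> K")
          case True
          have "?w x * (1 + norm x) ^ ?N \<le> ?w x * (1 + R) ^ ?N"
            using elim(2) R[OF True] by (intro mult_left_mono power_mono) auto
          also have "\<dots> \<le> norm ((1 + R) ^ ?N * ?w x)"
            unfolding real_norm_def by (subst mult.commute) (rule abs_ge_self)
          finally show ?thesis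
            using True elim(1) by simp
        qed simp
      qed
    qed measurable
    then show "g absolutely_integrable_on K"
      unfolding set_integrable_def by (subst integrable_completion) measurable
  qed
  moreover have "integrable lebesgue (\<lambda>x. g x * \<phi> x)" if \<phi>: "\<phi> \<in> schwartz_space" for \<phi>
    using int[OF \<phi>] schwartz_measurable[OF \<phi>] by (subst integrable_completion) auto
  moreover have "tempered_distribution (distribution_of g)"
    unfolding tempered_distribution_def
  proof (intro conjI ballI allI)
    fix \<phi> \<psi> :: "'a \<Rightarrow> complex" and a b :: complex
    assume \<phi>: "\<phi> \<in> schwartz_space" and \<psi>: "\<psi> \<in> schwartz_space"
    note [measurable] = schwartz_measurable[OF \<phi>] schwartz_measurable[OF \<psi>]
    have "distribution_of g (\<lambda>x. a * \<phi> x + b * \<psi> x) = (\<integral>x. g x * (a * \<phi> x + b * \<psi> x) \<partial>lborel)"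
      unfolding distribution_of_def by (rule integral_completion) measurable
    also have "\<dots> = (\<integral>x. a * (g x * \<phi> x) + b * (g x * \<psi> x) \<partial>lborel)"
      by (simp add: algebra_simps)
    also have "\<dots> = a * distribution_of g \<phi> + b * distribution_of g \<psi>"
      unfolding eq'[OF \<phi>] eq'[OF \<psi>] using int[OF \<phi>] int[OF \<psi>] by simp
    finally show "distribution_of g (\<lambda>x. a * \<phi> x + b * \<psi> x) = a * distribution_of g \<phi> + b * distribution_of g \<psi>" .
  next
    define W where "W = (\<integral>x. ?w x \<partial>lborel)"
    have "norm (distribution_of g \<phi>) \<le> (2 ^ ?N * W) * (\<Sum>(k, bs)\<in>{(0, []), (?N, [])}. schwartz_seminorm k bs \<phi>)"
      if \<phi>: "\<phi> \<in> schwartz_space" for \<phi>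
    proof -
      let ?S = "2 ^ ?N * (schwartz_seminorm 0 [] \<phi> + schwartz_seminorm ?N [] \<phi>)"
      have "norm (distribution_of g \<phi>) \<le> (\<integral>x. norm (g x * \<phi> x) \<partial>lborel)"
        unfolding eq'[OF \<phi>] by (rule integral_norm_bound)
      also have "\<dots> \<le> (\<integral>x. ?S * ?w x \<partial>lborel)"
      proof (rule integral_mono_AE[OF integrable_norm[OF int[OF \<phi>]] integrable_mult_right[OF w]])
        show "AE x in lborel. norm (g x * \<phi> x) \<le> ?S * ?w x"
          using norm_g w0
        proof eventually_elim
          case (elim x)
          have "norm (g x * \<phi> x) = ?w x * ((1 + norm x) ^ ?N * norm (\<phi> x))"
            by (simp only: norm_mult elim(1) mult.assoc)
          also have "\<dots> \<le> ?w x * ?S"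
            by (intro mult_left_mono schwartz_decay[OF \<phi>] elim(2))
          finally show ?case by (simp only: mult.commute)
        qed
      qed
      also have "\<dots> = ?S * W"
        unfolding W_def by (rule integral_mult_right_zero)
      finally show ?thesis
        by (simp add: mult_ac)
    qed
    then show "\<exists>C G. finite G \<and> G \<subseteq> UNIV \<times> lists (Basis::'a set) \<and>
        (\<forall>\<phi>\<in>schwartz_space. norm (distribution_of g \<phi>) \<le> C * (\<Sum>(k, bs)\<in>G. schwartz_seminorm k bs \<phi>))"
      by (intro exI[of _ "2 ^ ?N * W"] exI[of _ "{(0, []), (?N, [])}"]) auto
  qed
  ultimately show "defines_distribution g"
    by (simp add: defines_distribution_def)
qed

lemma positive_definite_density:
  fixes m :: "'a::euclidean_space \<Rightarrow> real"
  assumes n: "DIM('a) \<ge> 3" and T: "tempered_distribution T"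
    and m[measurable]: "m \<in> borel_measurable borel" and m0: "\<And>\<xi>. 0 \<le> m \<xi>"
    and m_le: "\<And>\<xi>. \<xi> \<noteq> 0 \<Longrightarrow> m \<xi> \<le> A / (norm \<xi>)\<^sup>2 + B"
    and eq: "\<And>\<phi>. \<phi> \<in> schwartz_space \<Longrightarrow> T \<phi> = (\<integral>\<xi>. complex_of_real (m \<xi>) * fourier \<phi> \<xi> \<partial>lborel)"
  shows "positive_definite T"
  unfolding positive_definite_def
proof (intro conjI exI ballI)
  let ?\<mu> = "density lborel (\<lambda>\<xi>. ennreal (m \<xi>))"
  show "tempered_measure ?\<mu>"
    unfolding tempered_measure_def
  proof (intro conjI exI)
    have "integrable lborel (\<lambda>\<xi>::'a. m \<xi> * (1 / (1 + norm \<xi>) ^ (DIM('a) + 1)))"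
      by (rule integrable_frequency_weight[OF n m]) (unfold abs_of_nonneg[OF m0], rule m_le)
    then have "(\<integral>\<^sup>+\<xi>. ennreal (m \<xi> * (1 / (1 + norm \<xi>) ^ (DIM('a) + 1))) \<partial>lborel) < \<infinity>"
      by (subst nn_integral_eq_integral) (simp_all add: m0)
    moreover have "(1 + norm \<xi>) powr (- real (DIM('a) + 1)) = 1 / (1 + norm \<xi>) ^ (DIM('a) + 1)" for \<xi> :: 'a
      unfolding powr_minus_divide by (subst powr_realpow) (auto simp: add_pos_nonneg)
    ultimately show "(\<integral>\<^sup>+\<xi>. ennreal ((1 + norm \<xi>) powr (- real (DIM('a) + 1))) \<partial>?\<mu>) < \<infinity>"
      using m0 by (simp add: nn_integral_density ennreal_mult[symmetric] del: power_Suc)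
  qed auto
  fix \<phi> :: "'a \<Rightarrow> complex" assume \<phi>: "\<phi> \<in> schwartz_space"
  have "distribution_of_measure ?\<mu> (fourier \<phi>) = (\<integral>\<xi>. m \<xi> *\<^sub>R fourier \<phi> \<xi> \<partial>lborel)"
    unfolding distribution_of_measure_def
    using fourier_measurable[OF \<phi>] m0 by (intro integral_density) auto
  then show "T \<phi> = fourier_distribution (distribution_of_measure ?\<mu>) \<phi>"
    by (simp add: eq[OF \<phi>] fourier_distribution_def scaleR_conv_of_real)
qed (rule T)

text \<open>The limit \<open>c\<close> of \<open>f\<close> at infinity is split off, since the superlevel sets of \<open>f\<close> at levels below \<open>c\<close> are
unbounded. It contributes a multiple of the full Newton kernel, and \<open>F = f - c\<close> is a superposition of truncated
kernels. The sum of the two densities represents \<open>g\<close>.\<close>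

theorem theorem2:
  fixes f :: "real \<Rightarrow> real"
    and g :: "real ^ 'n \<Rightarrow> complex"
  assumes nonneg: "\<And>r. r > 0 \<Longrightarrow> f r \<ge> 0"
    and noninc: "antimono_on {0<..} f"
    and cond: "(CARD('n) \<ge> 3 \<and> (\<lambda>r. f r * min 1 r) absolutely_integrable_on {0<..}) \<or>
               (CARD('n) \<ge> 9 \<and> (\<forall>R>0. (\<lambda>r. r * f r) absolutely_integrable_on {0<..<R}))"
    and g: "\<And>x. x \<noteq> 0 \<Longrightarrow> g x = complex_of_real (norm x powi (2 - int CARD('n)) * f (norm x))"
  shows "defines_distribution g \<and> positive_definite (distribution_of g)"
proof -
  let ?n = "DIM(real ^ 'n)"
  have n: "?n \<ge> 3" and n2: "?n \<ge> 2"
    using cond by auto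
  have anti: "f r' \<le> f r" if "0 < r" "r \<le> r'" for r r'
    using noninc that by (auto simp: monotone_on_def)
  define c where "c = Inf (f ` {0<..})"
  have c_bdd: "bdd_below (f ` {0<..})"
    using nonneg by (auto simp: bdd_below_def)
  have c_le: "c \<le> f r" if "r > 0" for r
    unfolding c_def using that by (intro cInf_lower c_bdd) auto
  have c0: "0 \<le> c"
    unfolding c_def using nonneg by (intro cInf_greatest) (auto intro: exI[of _ 1])
  define f' where "f' r = (if 0 < r then f r else 0)" for r
  define F where "F r = (if 0 < r then f r - c else 0)" for r
  have f'_meas[measurable]: "f' \<in> borel_measurable borel"
  proof -
    have "mono_on {0<..} (\<lambda>r. - f r)"
      using anti by (auto simp: mono_on_def)
    then have "(\<lambda>r. - f r) \<in> borel_measurable (restrict_space borel {0<..})"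
      by (rule borel_measurable_mono_on_fnc)
    then have "(\<lambda>r. - (- f r)) \<in> borel_measurable (restrict_space borel {0<..})"
      by (rule borel_measurable_uminus)
    then have "(\<lambda>r. if r \<in> {0<..} then f r else 0) \<in> borel_measurable borel"
      by (subst measurable_If_restrict_space_iff) (auto simp: greaterThan_def)
    then show ?thesis
      by (simp add: f'_def[abs_def])
  qed
  have F_eq: "F = (\<lambda>r. if 0 < r then f' r - c else 0)"
    by (auto simp: F_def f'_def)
  have F_meas[measurable]: "F \<in> borel_measurable borel"
    unfolding F_eq by measurable
  have "(\<lambda>r. r * f r) absolutely_integrable_on {0<..<1}"
  proof (cases "(\<lambda>r. f r * min 1 r) absolutely_integrable_on {0<..}")
    case True
    then have "(\<lambda>r. f r * min 1 r) absolutely_integrable_on {0<..<1}"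
      by (rule set_integrable_subset) auto
    then show ?thesis
      by (rule set_integrable_cong[THEN iffD1, rotated -1]) auto
  next
    case False
    then show ?thesis using cond by auto
  qed
  then have "integrable lebesgue (\<lambda>r. indicator {0<..<1} r *\<^sub>R (r * f r))"
    by (simp add: set_integrable_def)
  also have "(\<lambda>r. indicator {0<..<1} r *\<^sub>R (r * f r)) = (\<lambda>r. indicator {0<..<1} r * (r * f' r))"
    by (auto simp: f'_def indicator_def)
  finally have "integrable lborel (\<lambda>r. indicator {0<..<1} r * (r * f' r))"
    by (subst (asm) integrable_completion) measurable
  moreover have "0 \<le> indicator {0<..<1} r * (r * f' r)" for r
    using nonneg by (auto simp: f'_def indicator_def)
  ultimately have "(\<integral>\<^sup>+r. ennreal (indicator {0<..<1} r * (r * f' r)) \<partial>lborel) < \<infinity>"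
    by (subst nn_integral_eq_integral) auto
  also have "(\<integral>\<^sup>+r. ennreal (indicator {0<..<1} r * (r * f' r)) \<partial>lborel) =
      (\<integral>\<^sup>+r. ennreal (r * f' r) * indicator {0<..<1} r \<partial>lborel)"
    by (intro nn_integral_cong) (simp add: indicator_def)
  finally have fin': "(\<integral>\<^sup>+r. ennreal (r * f' r) * indicator {0<..<1} r \<partial>lborel) < \<infinity>" .
  have fin: "(\<integral>\<^sup>+r. ennreal (r * F r) * indicator {0<..<1} r \<partial>lborel) < \<infinity>"
    using c0 by (intro le_less_trans[OF nn_integral_mono fin'])
      (auto simp: F_def f'_def indicator_def intro!: ennreal_leI)
  have g': "g x = complex_of_real (newton_kernel x * f' (norm x))" if x: "x \<noteq> 0" for x
  proof -
    have "2 - int CARD('n) = - int (?n - 2)"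
      using n by (simp add: of_nat_diff)
    then have "norm x powi (2 - int CARD('n)) = newton_kernel x"
      by (simp only: power_int_minus power_int_of_nat) (simp add: newton_kernel_def divide_inverse)
    then show ?thesis
      using g[OF x] x by (simp add: f'_def)
  qed
  have f'0: "0 \<le> f' r" for r
    using nonneg by (simp add: f'_def)
  have f'1: "f' r \<le> f 1" if "r \<ge> 1" for r
    using anti[of 1 r] that by (simp add: f'_def)
  have dist: "defines_distribution g"
    "\<And>\<phi>. \<phi> \<in> schwartz_space \<Longrightarrow>
      distribution_of g \<phi> = (\<integral>x. complex_of_real (newton_kernel x * f' (norm x)) * \<phi> x \<partial>lborel)"
    using defines_distribution_newton_kernel_weight[OF n2 f'_meas f'0 f'1 fin' g'] by blast+
  define C where "C = 2 / (half_moment (?n - 3) * (2 * sqrt pi) ^ ?n)"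
  have C0: "0 \<le> C"
    using half_moment_pos[of "?n - 3"] by (simp add: C_def)
  have F0: "0 \<le> F r" for r
    using c_le by (simp add: F_def)
  have F_anti: "F r' \<le> F r" if "0 < r" "r \<le> r'" for r r'
    using anti[OF that] that by (simp add: F_def)
  have F_vanish: "\<exists>R>0. F R \<le> s" if "s > 0" for s
  proof -
    have "\<exists>y\<in>f ` {0<..}. y < c + s"
      using that c_bdd by (subst cInf_less_iff[symmetric]) (auto simp: c_def intro: exI[of _ 1])
    then obtain R where "R > 0" "f R < c + s"
      by auto
    then show ?thesis
      by (intro exI[of _ R]) (simp add: F_def)
  qed
  obtain m :: "real ^ 'n \<Rightarrow> real" and A B where m[measurable]: "m \<in> borel_measurable borel" "\<And>\<xi>. 0 \<le> m \<xi>"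
    "\<And>\<xi>. \<xi> \<noteq> 0 \<Longrightarrow> m \<xi> \<le> A / (norm \<xi>)\<^sup>2 + B"
    and m_eq: "\<And>\<phi>. \<phi> \<in> schwartz_space \<Longrightarrow> (\<integral>x. complex_of_real (newton_kernel x * F (norm x)) * \<phi> x \<partial>lborel) =
       (\<integral>\<xi>. complex_of_real (m \<xi>) * fourier \<phi> \<xi> \<partial>lborel)"
    using layer_cake_pairing[OF n F_meas F0 F_anti F_vanish fin] by blast
  have "positive_definite (distribution_of g)"
  proof (rule positive_definite_density[OF n])
    let ?m = "\<lambda>\<xi>. c * (C / (norm \<xi>)\<^sup>2) + m \<xi>"
    show "tempered_distribution (distribution_of g)"
      using dist(1) by (simp add: defines_distribution_def)
    show "?m \<in> borel_measurable borel"
      by measurable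
    show "0 \<le> ?m \<xi>" for \<xi>
      using c0 C0 m(2) by simp
    show "?m \<xi> \<le> (c * C + A) / (norm \<xi>)\<^sup>2 + B" if "\<xi> \<noteq> 0" for \<xi>
      using m(3)[OF that] by (simp add: add_divide_distrib)
    fix \<phi> :: "real ^ 'n \<Rightarrow> complex" assume \<phi>: "\<phi> \<in> schwartz_space"
    have split: "complex_of_real (newton_kernel x * f' (norm x)) * \<phi> x =
        complex_of_real c * (complex_of_real (newton_kernel x) * \<phi> x) + complex_of_real (newton_kernel x * F (norm x)) * \<phi> x"
      if "x \<noteq> 0" for x :: "real ^ 'n"
      using that by (simp add: F_def f'_def algebra_simps)
    note i1 = integrable_newton_kernel_times_schwartz[OF \<phi> n2]
    have i2: "integrable lborel (\<lambda>x. complex_of_real (newton_kernel x * F (norm x)) * \<phi> x)"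
      using F_anti[of 1] by (intro integrable_newton_kernel_schwartz[OF \<phi> n2 F_meas F0 _ fin, where M="F 1"]) simp
    have j1: "integrable lborel (\<lambda>\<xi>. complex_of_real (C / (norm \<xi>)\<^sup>2) * fourier \<phi> \<xi>)"
      using C0 by (intro integrable_frequency_fourier[OF n _ _ \<phi>, where A=C and B=0]) auto
    have j2: "integrable lborel (\<lambda>\<xi>. complex_of_real (m \<xi>) * fourier \<phi> \<xi>)"
      by (rule integrable_frequency_fourier[OF n m(1) _ \<phi>]) (unfold abs_of_nonneg[OF m(2)], rule m(3))
    note [measurable] = schwartz_measurable[OF \<phi>]
    have "distribution_of g \<phi> = (\<integral>x. complex_of_real (newton_kernel x * f' (norm x)) * \<phi> x \<partial>lborel)"
      by (rule dist(2)[OF \<phi>])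
    also have "\<dots> = (\<integral>x. complex_of_real c * (complex_of_real (newton_kernel x) * \<phi> x) +
        complex_of_real (newton_kernel x * F (norm x)) * \<phi> x \<partial>lborel)"
    proof (rule integral_cong_AE)
      show "AE x in lborel. complex_of_real (newton_kernel x * f' (norm x)) * \<phi> x =
        complex_of_real c * (complex_of_real (newton_kernel x) * \<phi> x) + complex_of_real (newton_kernel x * F (norm x)) * \<phi> x"
        using AE_lborel_nonzero by eventually_elim (rule split)
    qed measurable
    also have "\<dots> = complex_of_real c * (\<integral>x. complex_of_real (newton_kernel x) * \<phi> x \<partial>lborel) +
        (\<integral>x. complex_of_real (newton_kernel x * F (norm x)) * \<phi> x \<partial>lborel)"
      using i1 i2 by (subst Bochner_Integration.integral_add) auto
    also have "\<dots> = complex_of_real c * (\<integral>\<xi>. complex_of_real (C / (norm \<xi>)\<^sup>2) * fourier \<phi> \<xi> \<partial>lborel) +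
        (\<integral>\<xi>. complex_of_real (m \<xi>) * fourier \<phi> \<xi> \<partial>lborel)"
      unfolding C_def by (simp only: newton_kernel_pairing[OF n \<phi>] m_eq[OF \<phi>])
    also have "\<dots> = (\<integral>\<xi>. complex_of_real c * (complex_of_real (C / (norm \<xi>)\<^sup>2) * fourier \<phi> \<xi>) +
        complex_of_real (m \<xi>) * fourier \<phi> \<xi> \<partial>lborel)"
      by (subst Bochner_Integration.integral_add[OF integrable_mult_right[OF j1] j2])
         (simp only: integral_mult_right_zero)
    also have "\<dots> = (\<integral>\<xi>. complex_of_real (?m \<xi>) * fourier \<phi> \<xi> \<partial>lborel)"
      by (simp only: of_real_add of_real_mult distrib_right mult.assoc)
    finally show "distribution_of g \<phi> = (\<integral>\<xi>. complex_of_real (?m \<xi>) * fourier \<phi> \<xi> \<partial>lborel)" .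
  qed
  with dist(1) show ?thesis
    by blast
qed

end
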